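(* $\mathsf{RCA}_0$ proves: every finitely generated infinite lattice of length 3 contains arbitrarily long finite fences.
   Context: A lattice is $(L,\le_L,\wedge_L,\vee_L)$ with $L\subseteq\mathbb{N}$, $\le_L$ a partial order, and $\wedge_L,\vee_L$ functions giving greatest lower bounds and least upper bounds. A lattice of length 3 has a least element $0_L$ and greatest element $1_L$, and every element $x\ne 0_L,1_L$ is either an atom (no $y$ with $0_L<y<x$) or a coatom (no $y$ with $x<y<1_L$). For a finite set $\{g_0,\dots,g_k\}\subseteq L$ define $F_1=\{g_0,\dots,g_k\}$ and $F_{n+1}=\{x\wedge y: x,y\in F_n\}\cup\{x\vee y: x,y\in F_n\}$ (as a sequence of finite set codes); $L$ is finitely generated if for some such finite set, every $x\in L$ lies in some $F_n$. $L$ contains arbitrarily long finite fences if for every odd $n$ there are elements $x_0,\dots,x_n$ of $L$ with $x_0<_L x_1$, and for each even $i$ with $0<i<n$, $x_i<_L x_{i-1}$ and $x_i<_L x_{i+1}$, and no other comparability relations hold among these elements. *)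

theory Defs
  imports Main
begin

section \<open>The language of second-order arithmetic\<close>

text \<open>
  Formulas are in de Bruijn form, with two independent index spaces: number variables are bound by
  \<open>All\<close> and \<open>Ex\<close>, set variables by \<open>AllS\<close> and \<open>ExS\<close>. As usual for this
  language, equality is primitive only between number terms.
\<close>

datatype tm = Var nat | Zero | One | Plus tm tm | Times tm tm

datatype fm =
    Eq tm tm | Less tm tm | Mem tm nat
  | Fls | Imp fm fm | Con fm fm | Dis fm fm
  | All fm | Ex fm | AllS fm | ExS fm

abbreviation Neg :: "fm \<Rightarrow> fm" where "Neg \<phi> \<equiv> Imp \<phi> Fls"
abbreviation Iff :: "fm \<Rightarrow> fm \<Rightarrow> fm" where "Iff \<phi> \<psi> \<equiv> Con (Imp \<phi> \<psi>) (Imp \<psi> \<phi>)"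

primrec subst_tm :: "(nat \<Rightarrow> tm) \<Rightarrow> tm \<Rightarrow> tm" where
  "subst_tm \<sigma> (Var n) = \<sigma> n"
| "subst_tm \<sigma> Zero = Zero"
| "subst_tm \<sigma> One = One"
| "subst_tm \<sigma> (Plus t u) = Plus (subst_tm \<sigma> t) (subst_tm \<sigma> u)"
| "subst_tm \<sigma> (Times t u) = Times (subst_tm \<sigma> t) (subst_tm \<sigma> u)"

definition shift_tm :: "tm \<Rightarrow> tm" where
  "shift_tm = subst_tm (\<lambda>n. Var (Suc n))"

definition up :: "(nat \<Rightarrow> tm) \<Rightarrow> nat \<Rightarrow> tm" where
  "up \<sigma> = case_nat (Var 0) (\<lambda>n. shift_tm (\<sigma> n))"

definition upS :: "(nat \<Rightarrow> nat) \<Rightarrow> nat \<Rightarrow> nat" where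
  "upS \<rho> = case_nat 0 (\<lambda>n. Suc (\<rho> n))"

text \<open>Simultaneous capture-avoiding substitution of number terms for number variables (\<open>\<sigma>\<close>) and
  of set variables for set variables (\<open>\<rho>\<close>).\<close>

primrec subst :: "(nat \<Rightarrow> tm) \<Rightarrow> (nat \<Rightarrow> nat) \<Rightarrow> fm \<Rightarrow> fm" where
  "subst \<sigma> \<rho> (Eq t u) = Eq (subst_tm \<sigma> t) (subst_tm \<sigma> u)"
| "subst \<sigma> \<rho> (Less t u) = Less (subst_tm \<sigma> t) (subst_tm \<sigma> u)"
| "subst \<sigma> \<rho> (Mem t X) = Mem (subst_tm \<sigma> t) (\<rho> X)"
| "subst \<sigma> \<rho> Fls = Fls"
| "subst \<sigma> \<rho> (Imp \<phi> \<psi>) = Imp (subst \<sigma> \<rho> \<phi>) (subst \<sigma> \<rho> \<psi>)"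
| "subst \<sigma> \<rho> (Con \<phi> \<psi>) = Con (subst \<sigma> \<rho> \<phi>) (subst \<sigma> \<rho> \<psi>)"
| "subst \<sigma> \<rho> (Dis \<phi> \<psi>) = Dis (subst \<sigma> \<rho> \<phi>) (subst \<sigma> \<rho> \<psi>)"
| "subst \<sigma> \<rho> (All \<phi>) = All (subst (up \<sigma>) \<rho> \<phi>)"
| "subst \<sigma> \<rho> (Ex \<phi>) = Ex (subst (up \<sigma>) \<rho> \<phi>)"
| "subst \<sigma> \<rho> (AllS \<phi>) = AllS (subst \<sigma> (upS \<rho>) \<phi>)"
| "subst \<sigma> \<rho> (ExS \<phi>) = ExS (subst \<sigma> (upS \<rho>) \<phi>)"

definition shift :: "fm \<Rightarrow> fm" where
  "shift = subst (\<lambda>n. Var (Suc n)) (\<lambda>X. X)"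

definition shiftS :: "fm \<Rightarrow> fm" where
  "shiftS = subst Var Suc"

definition inst :: "tm \<Rightarrow> fm \<Rightarrow> fm" where
  "inst t = subst (case_nat t Var) (\<lambda>X. X)"

definition instS :: "nat \<Rightarrow> fm \<Rightarrow> fm" where
  "instS Y = subst Var (case_nat Y (\<lambda>X. X))"

section \<open>Provability\<close>

text \<open>Natural deduction for classical two-sorted first-order logic with equality on numbers.
  Eigenvariable conditions are expressed by shifting the context.\<close>

inductive deriv :: "fm list \<Rightarrow> fm \<Rightarrow> bool" where
  Assm: "\<phi> \<in> set \<Gamma> \<Longrightarrow> deriv \<Gamma> \<phi>"
| ImpI: "deriv (\<phi> # \<Gamma>) \<psi> \<Longrightarrow> deriv \<Gamma> (Imp \<phi> \<psi>)"
| ImpE: "deriv \<Gamma> (Imp \<phi> \<psi>) \<Longrightarrow> deriv \<Gamma> \<phi> \<Longrightarrow> deriv \<Gamma> \<psi>"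
| Class: "deriv (Neg \<phi> # \<Gamma>) Fls \<Longrightarrow> deriv \<Gamma> \<phi>"
| ConI: "deriv \<Gamma> \<phi> \<Longrightarrow> deriv \<Gamma> \<psi> \<Longrightarrow> deriv \<Gamma> (Con \<phi> \<psi>)"
| ConE1: "deriv \<Gamma> (Con \<phi> \<psi>) \<Longrightarrow> deriv \<Gamma> \<phi>"
| ConE2: "deriv \<Gamma> (Con \<phi> \<psi>) \<Longrightarrow> deriv \<Gamma> \<psi>"
| DisI1: "deriv \<Gamma> \<phi> \<Longrightarrow> deriv \<Gamma> (Dis \<phi> \<psi>)"
| DisI2: "deriv \<Gamma> \<psi> \<Longrightarrow> deriv \<Gamma> (Dis \<phi> \<psi>)"
| DisE: "deriv \<Gamma> (Dis \<phi> \<psi>) \<Longrightarrow> deriv (\<phi> # \<Gamma>) \<chi> \<Longrightarrow> deriv (\<psi> # \<Gamma>) \<chi> \<Longrightarrow> deriv \<Gamma> \<chi>"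
| AllI: "deriv (map shift \<Gamma>) \<phi> \<Longrightarrow> deriv \<Gamma> (All \<phi>)"
| AllE: "deriv \<Gamma> (All \<phi>) \<Longrightarrow> deriv \<Gamma> (inst t \<phi>)"
| ExI: "deriv \<Gamma> (inst t \<phi>) \<Longrightarrow> deriv \<Gamma> (Ex \<phi>)"
| ExE: "deriv \<Gamma> (Ex \<phi>) \<Longrightarrow> deriv (\<phi> # map shift \<Gamma>) (shift \<chi>) \<Longrightarrow> deriv \<Gamma> \<chi>"
| AllSI: "deriv (map shiftS \<Gamma>) \<phi> \<Longrightarrow> deriv \<Gamma> (AllS \<phi>)"
| AllSE: "deriv \<Gamma> (AllS \<phi>) \<Longrightarrow> deriv \<Gamma> (instS Y \<phi>)"
| ExSI: "deriv \<Gamma> (instS Y \<phi>) \<Longrightarrow> deriv \<Gamma> (ExS \<phi>)"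
| ExSE: "deriv \<Gamma> (ExS \<phi>) \<Longrightarrow> deriv (\<phi> # map shiftS \<Gamma>) (shiftS \<chi>) \<Longrightarrow> deriv \<Gamma> \<chi>"
| EqI: "deriv \<Gamma> (Eq t t)"
| EqE: "deriv \<Gamma> (Eq t u) \<Longrightarrow> deriv \<Gamma> (inst t \<phi>) \<Longrightarrow> deriv \<Gamma> (inst u \<phi>)"

definition proves :: "fm set \<Rightarrow> fm \<Rightarrow> bool" (infix "\<turnstile>" 50) where
  "T \<turnstile> \<phi> \<longleftrightarrow> (\<exists>\<Gamma>. set \<Gamma> \<subseteq> T \<and> deriv \<Gamma> \<phi>)"

section \<open>Named variables for formulas\<close>

text \<open>
  The operators below allow formulas to be written with HOL-bound variables. Object-level terms and
  formulas are represented as functions of the number of enclosing quantifiers of each sort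
  (number quantifiers first); a variable bound at depth \<open>d\<close> and used at depth \<open>d'\<close> becomes the de
  Bruijn index \<open>d' - Suc d\<close>. A closed formula is turned into an element of \<open>fm\<close> by
  \<open>sentence\<close>.
\<close>

type_synonym nterm = "nat \<Rightarrow> tm"
type_synonym sterm = "nat \<Rightarrow> nat"
type_synonym form = "nat \<Rightarrow> nat \<Rightarrow> fm"

definition sentence :: "form \<Rightarrow> fm" where
  "sentence P = P 0 0"

definition zero :: nterm ("\<^bold>0") where "\<^bold>0 = (\<lambda>d. Zero)"
definition one :: nterm ("\<^bold>1") where "\<^bold>1 = (\<lambda>d. One)"

definition plus_t :: "nterm \<Rightarrow> nterm \<Rightarrow> nterm" (infixl "\<^bold>+" 65) where
  "t \<^bold>+ u = (\<lambda>d. Plus (t d) (u d))"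
definition times_t :: "nterm \<Rightarrow> nterm \<Rightarrow> nterm" (infixl "\<^bold>*" 70) where
  "t \<^bold>* u = (\<lambda>d. Times (t d) (u d))"

definition eq_f :: "nterm \<Rightarrow> nterm \<Rightarrow> form" (infix "\<^bold>=" 50) where
  "t \<^bold>= u = (\<lambda>d e. Eq (t d) (u d))"
definition less_f :: "nterm \<Rightarrow> nterm \<Rightarrow> form" (infix "\<^bold><" 50) where
  "t \<^bold>< u = (\<lambda>d e. Less (t d) (u d))"
definition mem_f :: "nterm \<Rightarrow> sterm \<Rightarrow> form" (infix "\<^bold>\<in>" 50) where
  "t \<^bold>\<in> X = (\<lambda>d e. Mem (t d) (X e))"

definition not_f :: "form \<Rightarrow> form" ("\<^bold>\<not> _" [40] 40) where
  "(\<^bold>\<not> P) = (\<lambda>d e. Neg (P d e))"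
definition and_f :: "form \<Rightarrow> form \<Rightarrow> form" (infixr "\<^bold>\<and>" 35) where
  "(P \<^bold>\<and> Q) = (\<lambda>d e. Con (P d e) (Q d e))"
definition or_f :: "form \<Rightarrow> form \<Rightarrow> form" (infixr "\<^bold>\<or>" 30) where
  "(P \<^bold>\<or> Q) = (\<lambda>d e. Dis (P d e) (Q d e))"
definition imp_f :: "form \<Rightarrow> form \<Rightarrow> form" (infixr "\<^bold>\<longrightarrow>" 25) where
  "(P \<^bold>\<longrightarrow> Q) = (\<lambda>d e. Imp (P d e) (Q d e))"
definition iff_f :: "form \<Rightarrow> form \<Rightarrow> form" (infix "\<^bold>\<longleftrightarrow>" 25) where
  "(P \<^bold>\<longleftrightarrow> Q) = (\<lambda>d e. Iff (P d e) (Q d e))"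

definition all_f :: "(nterm \<Rightarrow> form) \<Rightarrow> form" (binder "\<^bold>\<forall>" 10) where
  "all_f P = (\<lambda>d e. All (P (\<lambda>d'. Var (d' - Suc d)) (Suc d) e))"
definition ex_f :: "(nterm \<Rightarrow> form) \<Rightarrow> form" (binder "\<^bold>\<exists>" 10) where
  "ex_f P = (\<lambda>d e. Ex (P (\<lambda>d'. Var (d' - Suc d)) (Suc d) e))"
definition all_set :: "(sterm \<Rightarrow> form) \<Rightarrow> form" (binder "\<^bold>\<forall>\<^sub>S" 10) where
  "all_set P = (\<lambda>d e. AllS (P (\<lambda>e'. e' - Suc e) d (Suc e)))"
definition ex_set :: "(sterm \<Rightarrow> form) \<Rightarrow> form" (binder "\<^bold>\<exists>\<^sub>S" 10) where
  "ex_set P = (\<lambda>d e. ExS (P (\<lambda>e'. e' - Suc e) d (Suc e)))"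

abbreviation neq_f :: "nterm \<Rightarrow> nterm \<Rightarrow> form" (infix "\<^bold>\<noteq>" 50) where
  "t \<^bold>\<noteq> u \<equiv> \<^bold>\<not> (t \<^bold>= u)"

section \<open>The axioms of RCA_0\<close>

text \<open>\<open>nbound \<phi>\<close> and \<open>sbound \<phi>\<close> are strict upper bounds on the indices of the free number and
  set variables, so that \<open>closure \<phi>\<close> is a universal closure.\<close>

primrec nbound_tm :: "tm \<Rightarrow> nat" where
  "nbound_tm (Var n) = Suc n"
| "nbound_tm Zero = 0"
| "nbound_tm One = 0"
| "nbound_tm (Plus t u) = max (nbound_tm t) (nbound_tm u)"
| "nbound_tm (Times t u) = max (nbound_tm t) (nbound_tm u)"

primrec nbound :: "fm \<Rightarrow> nat" where
  "nbound (Eq t u) = max (nbound_tm t) (nbound_tm u)"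
| "nbound (Less t u) = max (nbound_tm t) (nbound_tm u)"
| "nbound (Mem t X) = nbound_tm t"
| "nbound Fls = 0"
| "nbound (Imp \<phi> \<psi>) = max (nbound \<phi>) (nbound \<psi>)"
| "nbound (Con \<phi> \<psi>) = max (nbound \<phi>) (nbound \<psi>)"
| "nbound (Dis \<phi> \<psi>) = max (nbound \<phi>) (nbound \<psi>)"
| "nbound (All \<phi>) = nbound \<phi> - 1"
| "nbound (Ex \<phi>) = nbound \<phi> - 1"
| "nbound (AllS \<phi>) = nbound \<phi>"
| "nbound (ExS \<phi>) = nbound \<phi>"

primrec sbound :: "fm \<Rightarrow> nat" where
  "sbound (Eq t u) = 0"
| "sbound (Less t u) = 0"
| "sbound (Mem t X) = Suc X"
| "sbound Fls = 0"
| "sbound (Imp \<phi> \<psi>) = max (sbound \<phi>) (sbound \<psi>)"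
| "sbound (Con \<phi> \<psi>) = max (sbound \<phi>) (sbound \<psi>)"
| "sbound (Dis \<phi> \<psi>) = max (sbound \<phi>) (sbound \<psi>)"
| "sbound (All \<phi>) = sbound \<phi>"
| "sbound (Ex \<phi>) = sbound \<phi>"
| "sbound (AllS \<phi>) = sbound \<phi> - 1"
| "sbound (ExS \<phi>) = sbound \<phi> - 1"

definition closure :: "fm \<Rightarrow> fm" where
  "closure \<phi> = (All ^^ nbound \<phi>) ((AllS ^^ sbound \<phi>) \<phi>)"

text \<open>Bounded-quantifier formulas; free set variables (parameters) are allowed. The shift says
  that the bounded variable does not occur in the bounding term.\<close>

inductive Delta0 :: "fm \<Rightarrow> bool" where
  "Delta0 (Eq t u)"
| "Delta0 (Less t u)"
| "Delta0 (Mem t X)"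
| "Delta0 Fls"
| "Delta0 \<phi> \<Longrightarrow> Delta0 \<psi> \<Longrightarrow> Delta0 (Imp \<phi> \<psi>)"
| "Delta0 \<phi> \<Longrightarrow> Delta0 \<psi> \<Longrightarrow> Delta0 (Con \<phi> \<psi>)"
| "Delta0 \<phi> \<Longrightarrow> Delta0 \<psi> \<Longrightarrow> Delta0 (Dis \<phi> \<psi>)"
| "Delta0 \<phi> \<Longrightarrow> Delta0 (All (Imp (Less (Var 0) (shift_tm t)) \<phi>))"
| "Delta0 \<phi> \<Longrightarrow> Delta0 (Ex (Con (Less (Var 0) (shift_tm t)) \<phi>))"

definition Sigma1 :: "fm \<Rightarrow> bool" where
  "Sigma1 \<phi> \<longleftrightarrow> (\<exists>\<theta>. Delta0 \<theta> \<and> \<phi> = Ex \<theta>)"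

definition Pi1 :: "fm \<Rightarrow> bool" where
  "Pi1 \<phi> \<longleftrightarrow> (\<exists>\<theta>. Delta0 \<theta> \<and> \<phi> = All \<theta>)"

definition basic_axioms :: "fm set" where
  "basic_axioms = sentence ` {
    \<^bold>\<forall>n. n \<^bold>+ \<^bold>1 \<^bold>\<noteq> \<^bold>0,
    \<^bold>\<forall>m n. m \<^bold>+ \<^bold>1 \<^bold>= n \<^bold>+ \<^bold>1 \<^bold>\<longrightarrow> m \<^bold>= n,
    \<^bold>\<forall>m. m \<^bold>+ \<^bold>0 \<^bold>= m,
    \<^bold>\<forall>m n. m \<^bold>+ (n \<^bold>+ \<^bold>1) \<^bold>= (m \<^bold>+ n) \<^bold>+ \<^bold>1,
    \<^bold>\<forall>m. m \<^bold>* \<^bold>0 \<^bold>= \<^bold>0,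
    \<^bold>\<forall>m n. m \<^bold>* (n \<^bold>+ \<^bold>1) \<^bold>= m \<^bold>* n \<^bold>+ m,
    \<^bold>\<forall>m. \<^bold>\<not> m \<^bold>< \<^bold>0,
    \<^bold>\<forall>m n. m \<^bold>< n \<^bold>+ \<^bold>1 \<^bold>\<longleftrightarrow> (m \<^bold>< n \<^bold>\<or> m \<^bold>= n) }"

text \<open>In both schemes the number variable of the scheme is index 0, and all other free variables of
  \<open>\<phi>\<close> and \<open>\<psi>\<close> are parameters.\<close>

definition induction_ax :: "fm \<Rightarrow> fm" where
  "induction_ax \<phi> =
    Imp (Con (inst Zero \<phi>)
             (All (Imp \<phi> (subst (case_nat (Plus (Var 0) One) (\<lambda>n. Var (Suc n))) (\<lambda>X. X) \<phi>))))
        (All \<phi>)"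

definition comprehension_ax :: "fm \<Rightarrow> fm \<Rightarrow> fm" where
  "comprehension_ax \<phi> \<psi> =
    Imp (All (Iff \<phi> \<psi>)) (ExS (All (Iff (Mem (Var 0) 0) (shiftS \<phi>))))"

definition RCA0 :: "fm set" where
  "RCA0 = basic_axioms
     \<union> {closure (induction_ax \<phi>) | \<phi>. Sigma1 \<phi>}
     \<union> {closure (comprehension_ax \<phi> \<psi>) | \<phi> \<psi>. Sigma1 \<phi> \<and> Pi1 \<psi>}"

section \<open>Coding in second-order arithmetic\<close>

text \<open>The usual pairing \<open>(m + n)\<^sup>2 + m\<close>.\<close>

definition pair :: "nterm \<Rightarrow> nterm \<Rightarrow> nterm" ("\<^bold>\<langle>_,/ _\<^bold>\<rangle>") where
  "\<^bold>\<langle>t, u\<^bold>\<rangle> = (t \<^bold>+ u) \<^bold>* (t \<^bold>+ u) \<^bold>+ t"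

text \<open>A number \<open>(k,(m,n))\<close> codes the finite set of all \<open>i < k\<close> such that \<open>m(i+1)+1\<close> divides \<open>n\<close>
  (Goedel's beta function); the canonical code of a finite set is the least number coding it.\<close>

definition codes_set :: "nterm \<Rightarrow> form" where
  "codes_set c = (\<^bold>\<exists>k m n. c \<^bold>= \<^bold>\<langle>k, \<^bold>\<langle>m, n\<^bold>\<rangle>\<^bold>\<rangle>)"

definition in_code :: "nterm \<Rightarrow> nterm \<Rightarrow> form" (infix "\<^bold>\<epsilon>" 50) where
  "i \<^bold>\<epsilon> c = (\<^bold>\<exists>k m n q. c \<^bold>= \<^bold>\<langle>k, \<^bold>\<langle>m, n\<^bold>\<rangle>\<^bold>\<rangle> \<^bold>\<and> i \<^bold>< k \<^bold>\<and> n \<^bold>= (m \<^bold>* (i \<^bold>+ \<^bold>1) \<^bold>+ \<^bold>1) \<^bold>* q)"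

definition canonical_code :: "nterm \<Rightarrow> form" where
  "canonical_code c = (codes_set c \<^bold>\<and>
     (\<^bold>\<forall>c'. c' \<^bold>< c \<^bold>\<and> codes_set c' \<^bold>\<longrightarrow> \<^bold>\<not> (\<^bold>\<forall>i. i \<^bold>\<epsilon> c' \<^bold>\<longleftrightarrow> i \<^bold>\<epsilon> c)))"

text \<open>A finite sequence of length \<open>l\<close> is (the code of) a finite set of pairs that is a function with
  domain \<open>{i. i < l}\<close>.\<close>

definition seq_of_length :: "nterm \<Rightarrow> nterm \<Rightarrow> form" where
  "seq_of_length s l = (canonical_code s \<^bold>\<and>
     (\<^bold>\<forall>p. p \<^bold>\<epsilon> s \<^bold>\<longrightarrow> (\<^bold>\<exists>i x. i \<^bold>< l \<^bold>\<and> p \<^bold>= \<^bold>\<langle>i, x\<^bold>\<rangle>)) \<^bold>\<and>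
     (\<^bold>\<forall>i. i \<^bold>< l \<^bold>\<longrightarrow> (\<^bold>\<exists>x. \<^bold>\<langle>i, x\<^bold>\<rangle> \<^bold>\<epsilon> s \<^bold>\<and> (\<^bold>\<forall>y. \<^bold>\<langle>i, y\<^bold>\<rangle> \<^bold>\<epsilon> s \<^bold>\<longrightarrow> y \<^bold>= x))))"

definition finite_set_seq :: "sterm \<Rightarrow> form" where
  "finite_set_seq F =
    ((\<^bold>\<forall>p. p \<^bold>\<in> F \<^bold>\<longrightarrow> (\<^bold>\<exists>n c. p \<^bold>= \<^bold>\<langle>n, c\<^bold>\<rangle> \<^bold>\<and> canonical_code c)) \<^bold>\<and>
     (\<^bold>\<forall>n. \<^bold>\<exists>c. \<^bold>\<langle>n, c\<^bold>\<rangle> \<^bold>\<in> F \<^bold>\<and> (\<^bold>\<forall>c'. \<^bold>\<langle>n, c'\<^bold>\<rangle> \<^bold>\<in> F \<^bold>\<longrightarrow> c' \<^bold>= c)))"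

definition infinite_f :: "sterm \<Rightarrow> form" where
  "infinite_f X = (\<^bold>\<not> (\<^bold>\<exists>k. \<^bold>\<forall>i. i \<^bold>\<in> X \<^bold>\<longrightarrow> i \<^bold>< k))"

section \<open>Lattices and fences\<close>

text \<open>\<open>R\<close>, \<open>M\<close> and \<open>J\<close> are the sets of pairs coding the order, meet and join of a lattice with
  underlying set \<open>L\<close>.\<close>

definition le_f :: "sterm \<Rightarrow> nterm \<Rightarrow> nterm \<Rightarrow> form" where
  "le_f R x y = (\<^bold>\<langle>x, y\<^bold>\<rangle> \<^bold>\<in> R)"

definition lt_f :: "sterm \<Rightarrow> nterm \<Rightarrow> nterm \<Rightarrow> form" where
  "lt_f R x y = (le_f R x y \<^bold>\<and> x \<^bold>\<noteq> y)"

definition partial_order_f :: "sterm \<Rightarrow> sterm \<Rightarrow> form" where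
  "partial_order_f L R =
    ((\<^bold>\<forall>p. p \<^bold>\<in> R \<^bold>\<longrightarrow> (\<^bold>\<exists>x y. x \<^bold>\<in> L \<^bold>\<and> y \<^bold>\<in> L \<^bold>\<and> p \<^bold>= \<^bold>\<langle>x, y\<^bold>\<rangle>)) \<^bold>\<and>
     (\<^bold>\<forall>x. x \<^bold>\<in> L \<^bold>\<longrightarrow> le_f R x x) \<^bold>\<and>
     (\<^bold>\<forall>x y. le_f R x y \<^bold>\<and> le_f R y x \<^bold>\<longrightarrow> x \<^bold>= y) \<^bold>\<and>
     (\<^bold>\<forall>x y z. le_f R x y \<^bold>\<and> le_f R y z \<^bold>\<longrightarrow> le_f R x z))"

definition binop :: "sterm \<Rightarrow> sterm \<Rightarrow> form" where
  "binop L G =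
    ((\<^bold>\<forall>p. p \<^bold>\<in> G \<^bold>\<longrightarrow>
        (\<^bold>\<exists>x y z. x \<^bold>\<in> L \<^bold>\<and> y \<^bold>\<in> L \<^bold>\<and> z \<^bold>\<in> L \<^bold>\<and> p \<^bold>= \<^bold>\<langle>\<^bold>\<langle>x, y\<^bold>\<rangle>, z\<^bold>\<rangle>)) \<^bold>\<and>
     (\<^bold>\<forall>x y. x \<^bold>\<in> L \<^bold>\<and> y \<^bold>\<in> L \<^bold>\<longrightarrow>
        (\<^bold>\<exists>z. \<^bold>\<langle>\<^bold>\<langle>x, y\<^bold>\<rangle>, z\<^bold>\<rangle> \<^bold>\<in> G \<^bold>\<and> (\<^bold>\<forall>w. \<^bold>\<langle>\<^bold>\<langle>x, y\<^bold>\<rangle>, w\<^bold>\<rangle> \<^bold>\<in> G \<^bold>\<longrightarrow> w \<^bold>= z))))"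

definition lattice_f :: "sterm \<Rightarrow> sterm \<Rightarrow> sterm \<Rightarrow> sterm \<Rightarrow> form" where
  "lattice_f L R M J =
    (partial_order_f L R \<^bold>\<and> binop L M \<^bold>\<and> binop L J \<^bold>\<and>
     (\<^bold>\<forall>x y z. \<^bold>\<langle>\<^bold>\<langle>x, y\<^bold>\<rangle>, z\<^bold>\<rangle> \<^bold>\<in> M \<^bold>\<longrightarrow>
        le_f R z x \<^bold>\<and> le_f R z y \<^bold>\<and> (\<^bold>\<forall>w. le_f R w x \<^bold>\<and> le_f R w y \<^bold>\<longrightarrow> le_f R w z)) \<^bold>\<and>
     (\<^bold>\<forall>x y z. \<^bold>\<langle>\<^bold>\<langle>x, y\<^bold>\<rangle>, z\<^bold>\<rangle> \<^bold>\<in> J \<^bold>\<longrightarrow>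
        le_f R x z \<^bold>\<and> le_f R y z \<^bold>\<and> (\<^bold>\<forall>w. le_f R x w \<^bold>\<and> le_f R y w \<^bold>\<longrightarrow> le_f R z w)))"

definition length_three :: "sterm \<Rightarrow> sterm \<Rightarrow> form" where
  "length_three L R =
    (\<^bold>\<exists>b t. b \<^bold>\<in> L \<^bold>\<and> t \<^bold>\<in> L \<^bold>\<and>
       (\<^bold>\<forall>x. x \<^bold>\<in> L \<^bold>\<longrightarrow> le_f R b x \<^bold>\<and> le_f R x t) \<^bold>\<and>
       (\<^bold>\<forall>x. x \<^bold>\<in> L \<^bold>\<and> x \<^bold>\<noteq> b \<^bold>\<and> x \<^bold>\<noteq> t \<^bold>\<longrightarrow>
          \<^bold>\<not> (\<^bold>\<exists>y. y \<^bold>\<in> L \<^bold>\<and> lt_f R b y \<^bold>\<and> lt_f R y x) \<^bold>\<or>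
          \<^bold>\<not> (\<^bold>\<exists>y. y \<^bold>\<in> L \<^bold>\<and> lt_f R x y \<^bold>\<and> lt_f R y t)))"

text \<open>Only the values of \<open>F\<close> at positive arguments matter: \<open>F 1\<close> is the (nonempty) set of
  generators.\<close>

definition finitely_generated :: "sterm \<Rightarrow> sterm \<Rightarrow> sterm \<Rightarrow> form" where
  "finitely_generated L M J =
    (\<^bold>\<exists>\<^sub>S F. finite_set_seq F \<^bold>\<and>
       (\<^bold>\<exists>g. \<^bold>\<langle>\<^bold>1, g\<^bold>\<rangle> \<^bold>\<in> F \<^bold>\<and> (\<^bold>\<exists>x. x \<^bold>\<epsilon> g) \<^bold>\<and> (\<^bold>\<forall>x. x \<^bold>\<epsilon> g \<^bold>\<longrightarrow> x \<^bold>\<in> L)) \<^bold>\<and>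
       (\<^bold>\<forall>n a a'. \<^bold>0 \<^bold>< n \<^bold>\<and> \<^bold>\<langle>n, a\<^bold>\<rangle> \<^bold>\<in> F \<^bold>\<and> \<^bold>\<langle>n \<^bold>+ \<^bold>1, a'\<^bold>\<rangle> \<^bold>\<in> F \<^bold>\<longrightarrow>
          (\<^bold>\<forall>z. z \<^bold>\<epsilon> a' \<^bold>\<longleftrightarrow>
             (\<^bold>\<exists>x y. x \<^bold>\<epsilon> a \<^bold>\<and> y \<^bold>\<epsilon> a \<^bold>\<and>
                (\<^bold>\<langle>\<^bold>\<langle>x, y\<^bold>\<rangle>, z\<^bold>\<rangle> \<^bold>\<in> M \<^bold>\<or> \<^bold>\<langle>\<^bold>\<langle>x, y\<^bold>\<rangle>, z\<^bold>\<rangle> \<^bold>\<in> J)))) \<^bold>\<and>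
       (\<^bold>\<forall>x. x \<^bold>\<in> L \<^bold>\<longrightarrow> (\<^bold>\<exists>n a. \<^bold>0 \<^bold>< n \<^bold>\<and> \<^bold>\<langle>n, a\<^bold>\<rangle> \<^bold>\<in> F \<^bold>\<and> x \<^bold>\<epsilon> a)))"

definition even_f :: "nterm \<Rightarrow> form" where
  "even_f n = (\<^bold>\<exists>m. n \<^bold>= m \<^bold>+ m)"

definition odd_f :: "nterm \<Rightarrow> form" where
  "odd_f n = (\<^bold>\<exists>m. n \<^bold>= m \<^bold>+ m \<^bold>+ \<^bold>1)"

text \<open>The sequence \<open>s\<close> of length \<open>n + 1\<close> is a fence. The last conjunct says that there are no
  comparabilities beyond the required ones; in particular the entries are distinct. It is stated
  for \<open>\<le>\<close>, in the form: \<open>x\<^sub>i \<le> x\<^sub>j\<close> only if \<open>i = j\<close>, or \<open>i\<close> is even and \<open>j\<close> is a neighbour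
  of \<open>i\<close>.\<close>

definition fence :: "sterm \<Rightarrow> sterm \<Rightarrow> nterm \<Rightarrow> nterm \<Rightarrow> form" where
  "fence L R s n =
    (seq_of_length s (n \<^bold>+ \<^bold>1) \<^bold>\<and>
     (\<^bold>\<forall>i x. \<^bold>\<langle>i, x\<^bold>\<rangle> \<^bold>\<epsilon> s \<^bold>\<longrightarrow> x \<^bold>\<in> L) \<^bold>\<and>
     (\<^bold>\<forall>x y. \<^bold>\<langle>\<^bold>0, x\<^bold>\<rangle> \<^bold>\<epsilon> s \<^bold>\<and> \<^bold>\<langle>\<^bold>1, y\<^bold>\<rangle> \<^bold>\<epsilon> s \<^bold>\<longrightarrow> lt_f R x y) \<^bold>\<and>
     (\<^bold>\<forall>i h w x y. even_f i \<^bold>\<and> \<^bold>0 \<^bold>< i \<^bold>\<and> i \<^bold>< n \<^bold>\<and> h \<^bold>+ \<^bold>1 \<^bold>= i \<^bold>\<and>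
        \<^bold>\<langle>h, w\<^bold>\<rangle> \<^bold>\<epsilon> s \<^bold>\<and> \<^bold>\<langle>i, x\<^bold>\<rangle> \<^bold>\<epsilon> s \<^bold>\<and> \<^bold>\<langle>i \<^bold>+ \<^bold>1, y\<^bold>\<rangle> \<^bold>\<epsilon> s \<^bold>\<longrightarrow>
        lt_f R x w \<^bold>\<and> lt_f R x y) \<^bold>\<and>
     (\<^bold>\<forall>i j x y. \<^bold>\<langle>i, x\<^bold>\<rangle> \<^bold>\<epsilon> s \<^bold>\<and> \<^bold>\<langle>j, y\<^bold>\<rangle> \<^bold>\<epsilon> s \<^bold>\<and> le_f R x y \<^bold>\<longrightarrow>
        i \<^bold>= j \<^bold>\<or> (even_f i \<^bold>\<and> (j \<^bold>= i \<^bold>+ \<^bold>1 \<^bold>\<or> i \<^bold>= j \<^bold>+ \<^bold>1))))"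

definition long_fences :: "sterm \<Rightarrow> sterm \<Rightarrow> form" where
  "long_fences L R = (\<^bold>\<forall>n. odd_f n \<^bold>\<longrightarrow> (\<^bold>\<exists>s. fence L R s n))"

end

theory Submission
  imports Defs "HOL-Library.Countable"
begin

text \<open>By completeness it suffices to work in an arbitrary, possibly nonstandard, model of \<open>RCA\<^sub>0\<close>.
  There, an element of high rank in the generation of the lattice descends, one rank at a time and
  always to a comparable element, so that the comparability graph on the elements other than the
  bounds contains arbitrarily long paths. This graph has no four-cycles, since two coatoms have only
  one meet, and it has no chains of three elements, so that a fence is an induced path.

  It remains to find a long induced path in a finite graph without four-cycles that has a very long
  path; suppose that there is none with \<open>K\<close> vertices. Gyarfas' argument builds an induced path by
  deleting the neighbourhood of its current last vertex \<open>v\<close> and continuing in what is left. Call two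
  points of the long path related if they remain connected, within their segment, after this
  deletion. The relation is transitive, so a large set of points contains a large chain or a large
  antichain. A chain lets the induced path grow, which can happen fewer than \<open>K\<close> times in a row. An
  antichain makes \<open>v\<close> a hub: every connection between two of its points meets a neighbour of \<open>v\<close>. Once
  there are more hubs than pairs of positions on a path with \<open>K\<close> vertices, short paths in two disjoint
  segments contain common neighbours of the same two hubs, which is a four-cycle. The sizes decrease
  by square roots, which \<open>\<Sigma>\<^sub>1\<close> induction can follow.\<close>


section \<open>Substitution\<close>

text \<open>The obstacle is the weakness of induction: Ramsey or infinite pigeonhole arguments on
  the whole lattice are out of reach of \<open>RCA0\<close>. For each \<open>K\<close> the search is
  therefore confined to a path of fixed length \<open>N\<close>, and every set in it is a number
  below a bound given in advance. Connectedness is then decidable, and "a state was reached after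
  \<open>t\<close> rounds" is a Sigma-1 statement about codes.

  The rounds are counted by \<open>h * K + j\<close>, where \<open>h\<close> is the number of hubs
  and \<open>j + 1\<close> the number of vertices on the current induced path. A chain raises
  \<open>j\<close>; an antichain resets \<open>j\<close> but raises \<open>h\<close>, and
  \<open>j < K\<close>. The pairs of positions up to \<open>K\<close> have codes below
  \<open>pr K K + 1\<close>, so \<open>h\<close> is at most \<open>pr K K + 1\<close> and there are
  fewer than \<open>(pr K K + 1 + 1) * K\<close> rounds. \<open>size_bound\<close> runs the loss of
  breakpoints backwards from four, the ends of two disjoint segments.

  Confining connections to segments serves twice: the relation between breakpoints becomes
  transitive, since a larger segment contains the smaller ones, and common neighbours found in
  disjoint segments are distinct, as a four-cycle requires.\<close>

lemma up_Var: "up Var = Var"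
  by (auto simp: up_def shift_tm_def fun_eq_iff split: nat.split)

lemma upS_id: "upS (\<lambda>X. X) = (\<lambda>X. X)"
  by (auto simp: upS_def fun_eq_iff split: nat.split)

lemma subst_tm_Var: "subst_tm Var t = t"
  by (induction t) auto

lemma subst_Var: "subst Var (\<lambda>X. X) \<phi> = \<phi>"
  by (induction \<phi>) (auto simp: subst_tm_Var up_Var upS_id)

lemma subst_tm_comp: "subst_tm \<sigma>' (subst_tm \<sigma> t) = subst_tm (\<lambda>n. subst_tm \<sigma>' (\<sigma> n)) t"
  by (induction t) auto

lemma up_comp: "(\<lambda>n. subst_tm (up \<sigma>') (up \<sigma> n)) = up (\<lambda>n. subst_tm \<sigma>' (\<sigma> n))"
  by (auto simp: up_def shift_tm_def fun_eq_iff subst_tm_comp split: nat.split)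

lemma upS_comp: "(\<lambda>n. upS \<rho>' (upS \<rho> n)) = upS (\<lambda>n. \<rho>' (\<rho> n))"
  by (auto simp: upS_def fun_eq_iff split: nat.split)

lemma subst_comp:
  "subst \<sigma>' \<rho>' (subst \<sigma> \<rho> \<phi>) = subst (\<lambda>n. subst_tm \<sigma>' (\<sigma> n)) (\<lambda>X. \<rho>' (\<rho> X)) \<phi>"
  by (induction \<phi> arbitrary: \<sigma> \<sigma>' \<rho> \<rho>') (auto simp: subst_tm_comp up_comp upS_comp)

lemma subst_shift: "subst (up \<sigma>) \<rho> (shift \<phi>) = shift (subst \<sigma> \<rho> \<phi>)"
  by (simp add: shift_def subst_comp) (simp add: up_def shift_tm_def)

lemma subst_shiftS: "subst \<sigma> (upS \<rho>) (shiftS \<phi>) = shiftS (subst \<sigma> \<rho> \<phi>)"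
  by (simp add: shiftS_def subst_comp subst_tm_Var) (simp add: upS_def)

lemma subst_case_up: "subst_tm (case_nat t Var) (up \<sigma> n) = case_nat t \<sigma> n"
  by (auto simp: up_def shift_tm_def subst_tm_comp subst_tm_Var split: nat.split)

lemma inst_up: "inst t (subst (up \<sigma>) \<rho> \<phi>) = subst (case_nat t \<sigma>) \<rho> \<phi>"
  by (simp add: inst_def subst_comp subst_case_up)

lemma instS_upS: "instS Y (subst \<sigma> (upS \<rho>) \<phi>) = subst \<sigma> (case_nat Y \<rho>) \<phi>"
proof -
  have "(\<lambda>X. case_nat Y (\<lambda>X. X) (upS \<rho> X)) = case_nat Y \<rho>"
    by (auto simp: upS_def fun_eq_iff split: nat.split)
  then show ?thesis by (simp add: instS_def subst_comp subst_tm_Var)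
qed

lemma subst_inst: "subst \<sigma> \<rho> (inst t \<phi>) = inst (subst_tm \<sigma> t) (subst (up \<sigma>) \<rho> \<phi>)"
proof -
  have "(\<lambda>n. subst_tm \<sigma> (case_nat t Var n)) = case_nat (subst_tm \<sigma> t) \<sigma>"
    by (auto simp: fun_eq_iff split: nat.split)
  then show ?thesis unfolding inst_up by (simp add: inst_def subst_comp)
qed

lemma subst_instS: "subst \<sigma> \<rho> (instS Y \<phi>) = instS (\<rho> Y) (subst \<sigma> (upS \<rho>) \<phi>)"
proof -
  have "(\<lambda>X. \<rho> (case_nat Y (\<lambda>X. X) X)) = case_nat (\<rho> Y) \<rho>"
    by (auto simp: fun_eq_iff split: nat.split)
  then show ?thesis unfolding instS_upS by (simp add: instS_def subst_comp)
qed

lemma subst_tm_cong: "(\<And>n. n < nbound_tm t \<Longrightarrow> \<sigma> n = \<sigma>' n) \<Longrightarrow> subst_tm \<sigma> t = subst_tm \<sigma>' t"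
  by (induction t) auto

text \<open>This is what makes an index above both bounds fresh: renaming it leaves the formula
  alone.\<close>

lemma subst_cong:
  "(\<And>n. n < nbound \<phi> \<Longrightarrow> \<sigma> n = \<sigma>' n) \<Longrightarrow> (\<And>X. X < sbound \<phi> \<Longrightarrow> \<rho> X = \<rho>' X) \<Longrightarrow>
   subst \<sigma> \<rho> \<phi> = subst \<sigma>' \<rho>' \<phi>"
proof (induction \<phi> arbitrary: \<sigma> \<sigma>' \<rho> \<rho>')
  case (Eq t u) then show ?case using subst_tm_cong[of _ \<sigma> \<sigma>'] by simp
next
  case (Less t u) then show ?case using subst_tm_cong[of _ \<sigma> \<sigma>'] by simp
next
  case (Mem t u) then show ?case using subst_tm_cong[of _ \<sigma> \<sigma>'] by simp
next
  case (Imp \<phi> \<psi>)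
  from Imp.IH(1)[of \<sigma> \<sigma>' \<rho> \<rho>'] Imp.IH(2)[of \<sigma> \<sigma>' \<rho> \<rho>'] Imp.prems show ?case by simp
next
  case (Con \<phi> \<psi>)
  from Con.IH(1)[of \<sigma> \<sigma>' \<rho> \<rho>'] Con.IH(2)[of \<sigma> \<sigma>' \<rho> \<rho>'] Con.prems show ?case by simp
next
  case (Dis \<phi> \<psi>)
  from Dis.IH(1)[of \<sigma> \<sigma>' \<rho> \<rho>'] Dis.IH(2)[of \<sigma> \<sigma>' \<rho> \<rho>'] Dis.prems show ?case by simp
next
  case (All \<phi>)
  have "up \<sigma> n = up \<sigma>' n" if "n < nbound \<phi>" for n
    using All.prems(1)[of "n - 1"] that by (auto simp: up_def split: nat.split)
  with All.IH[of "up \<sigma>" "up \<sigma>'" \<rho> \<rho>'] All.prems(2) show ?case by simp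
next
  case (Ex \<phi>)
  have "up \<sigma> n = up \<sigma>' n" if "n < nbound \<phi>" for n
    using Ex.prems(1)[of "n - 1"] that by (auto simp: up_def split: nat.split)
  with Ex.IH[of "up \<sigma>" "up \<sigma>'" \<rho> \<rho>'] Ex.prems(2) show ?case by simp
next
  case (AllS \<phi>)
  have "upS \<rho> n = upS \<rho>' n" if "n < sbound \<phi>" for n
    using AllS.prems(2)[of "n - 1"] that by (auto simp: upS_def split: nat.split)
  with AllS.IH[of \<sigma> \<sigma>' "upS \<rho>" "upS \<rho>'"] AllS.prems(1) show ?case by simp
next
  case (ExS \<phi>)
  have "upS \<rho> n = upS \<rho>' n" if "n < sbound \<phi>" for n
    using ExS.prems(2)[of "n - 1"] that by (auto simp: upS_def split: nat.split)
  with ExS.IH[of \<sigma> \<sigma>' "upS \<rho>" "upS \<rho>'"] ExS.prems(1) show ?case by simp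
qed simp

text \<open>Needed to rename a fresh Henkin variable to the de Bruijn index that the rules
  \<open>ExE\<close> and \<open>ExSE\<close> expect for their eigenvariable.\<close>

lemma deriv_subst: "deriv \<Gamma> \<phi> \<Longrightarrow> deriv (map (subst \<sigma> \<rho>) \<Gamma>) (subst \<sigma> \<rho> \<phi>)"
proof (induction arbitrary: \<sigma> \<rho> rule: deriv.induct)
  case (AllI \<Gamma> \<phi>)
  from AllI.IH[of "up \<sigma>" \<rho>] show ?case
    by (simp add: comp_def subst_shift deriv.AllI)
next
  case (AllE \<Gamma> \<phi> t)
  from deriv.AllE[OF AllE.IH[of \<sigma> \<rho>, simplified]] show ?case by (simp add: subst_inst)
next
  case (ExI \<Gamma> t \<phi>)
  from ExI.IH[of \<sigma> \<rho>] show ?case by (auto simp: subst_inst intro: deriv.ExI)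
next
  case (ExE \<Gamma> \<phi> \<chi>)
  show ?case
    by (rule deriv.ExE[OF ExE.IH(1)[of \<sigma> \<rho>, unfolded subst.simps]])
      (use ExE.IH(2)[of "up \<sigma>" \<rho>] in \<open>simp add: comp_def subst_shift\<close>)
next
  case (AllSI \<Gamma> \<phi>)
  from AllSI.IH[of \<sigma> "upS \<rho>"] show ?case
    by (simp add: comp_def subst_shiftS deriv.AllSI)
next
  case (AllSE \<Gamma> \<phi> Y)
  from deriv.AllSE[OF AllSE.IH[of \<sigma> \<rho>, simplified]] show ?case by (simp add: subst_instS)
next
  case (ExSI \<Gamma> Y \<phi>)
  from ExSI.IH[of \<sigma> \<rho>] show ?case by (auto simp: subst_instS intro: deriv.ExSI)
next
  case (ExSE \<Gamma> \<phi> \<chi>)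
  show ?case
    by (rule deriv.ExSE[OF ExSE.IH(1)[of \<sigma> \<rho>, unfolded subst.simps]])
      (use ExSE.IH(2)[of \<sigma> "upS \<rho>"] in \<open>simp add: comp_def subst_shiftS\<close>)
next
  case (EqE \<Gamma> t u \<phi>)
  from EqE.IH(1)[of \<sigma> \<rho>] EqE.IH(2)[of \<sigma> \<rho>] show ?case
    by (auto simp: subst_inst intro: deriv.EqE)
next
  case (DisE \<Gamma> \<phi> \<psi> \<chi>)
  from DisE.IH[of \<sigma> \<rho>] show ?case by simp (erule (2) deriv.DisE)
next
  case (ImpE \<Gamma> \<phi> \<psi>)
  from ImpE.IH[of \<sigma> \<rho>] show ?case by simp (erule (1) deriv.ImpE)
next
  case (ConE1 \<Gamma> \<phi> \<psi>)
  from ConE1.IH[of \<sigma> \<rho>] show ?case by simp (erule deriv.ConE1)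
next
  case (ConE2 \<Gamma> \<phi> \<psi>)
  from ConE2.IH[of \<sigma> \<rho>] show ?case by simp (erule deriv.ConE2)
qed (auto intro: deriv.intros)

lemma deriv_mono: "deriv \<Gamma> \<phi> \<Longrightarrow> set \<Gamma> \<subseteq> set \<Delta> \<Longrightarrow> deriv \<Delta> \<phi>"
proof (induction arbitrary: \<Delta> rule: deriv.induct)
  case (ImpI \<phi> \<Gamma> \<psi>)
  from ImpI.IH[of "\<phi> # \<Delta>"] ImpI.prems show ?case by (auto intro: deriv.ImpI)
next
  case (Class \<phi> \<Gamma>)
  from Class.IH[of "Neg \<phi> # \<Delta>"] Class.prems show ?case by (auto intro: deriv.Class)
next
  case (DisE \<Gamma> \<phi> \<psi> \<chi>)
  from DisE.IH(1)[of \<Delta>] DisE.IH(2)[of "\<phi> # \<Delta>"] DisE.IH(3)[of "\<psi> # \<Delta>"] DisE.prems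
  show ?case by (intro deriv.DisE[of \<Delta> \<phi> \<psi> \<chi>]) auto
next
  case (AllI \<Gamma> \<phi>)
  from AllI.IH[of "map shift \<Delta>"] AllI.prems show ?case by (auto intro!: deriv.AllI)
next
  case (ExE \<Gamma> \<phi> \<chi>)
  from ExE.IH(1)[of \<Delta>] ExE.IH(2)[of "\<phi> # map shift \<Delta>"] ExE.prems
  show ?case by (intro deriv.ExE[of \<Delta> \<phi> \<chi>]) auto
next
  case (AllSI \<Gamma> \<phi>)
  from AllSI.IH[of "map shiftS \<Delta>"] AllSI.prems show ?case by (auto intro!: deriv.AllSI)
next
  case (ExSE \<Gamma> \<phi> \<chi>)
  from ExSE.IH(1)[of \<Delta>] ExSE.IH(2)[of "\<phi> # map shiftS \<Delta>"] ExSE.prems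
  show ?case by (intro deriv.ExSE[of \<Delta> \<phi> \<chi>]) auto
qed (blast intro: deriv.intros)+

section \<open>Henkin sets\<close>

lemma proves_mono: "A \<turnstile> \<phi> \<Longrightarrow> A \<subseteq> B \<Longrightarrow> B \<turnstile> \<phi>"
  unfolding proves_def by blast

lemma proves_assm: "\<phi> \<in> A \<Longrightarrow> A \<turnstile> \<phi>"
  unfolding proves_def by (rule exI[of _ "[\<phi>]"]) (auto intro: deriv.Assm)

text \<open>The finite list behind \<open>proves\<close> may contain the added hypothesis anywhere,
  repeatedly or not at all. With it at the head, the discharging rules apply.\<close>

lemma proves_insertE:
  assumes "insert \<phi> A \<turnstile> \<psi>"
  obtains \<Gamma> where "set \<Gamma> \<subseteq> A" "deriv (\<phi> # \<Gamma>) \<psi>"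
proof -
  from assms obtain \<Gamma> where \<Gamma>: "set \<Gamma> \<subseteq> insert \<phi> A" "deriv \<Gamma> \<psi>" unfolding proves_def by blast
  show thesis
    by (rule that[of "filter (\<lambda>\<gamma>. \<gamma> \<in> A) \<Gamma>"]) (use \<Gamma> in \<open>auto intro!: deriv_mono[of \<Gamma> \<psi>]\<close>)
qed

lemma proves_combine:
  assumes "A \<turnstile> \<phi>" "A \<turnstile> \<psi>"
  obtains \<Gamma> where "set \<Gamma> \<subseteq> A" "deriv \<Gamma> \<phi>" "deriv \<Gamma> \<psi>"
proof -
  from assms obtain \<Gamma> \<Delta> where "set \<Gamma> \<subseteq> A" "deriv \<Gamma> \<phi>" "set \<Delta> \<subseteq> A" "deriv \<Delta> \<psi>"
    unfolding proves_def by blast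
  then show thesis by (intro that[of "\<Gamma> @ \<Delta>"]) (auto intro: deriv_mono)
qed

lemma proves_ImpI: "insert \<phi> A \<turnstile> \<psi> \<Longrightarrow> A \<turnstile> Imp \<phi> \<psi>"
  by (erule proves_insertE) (auto simp: proves_def intro: deriv.ImpI)

lemma proves_Class: "insert (Neg \<phi>) A \<turnstile> Fls \<Longrightarrow> A \<turnstile> \<phi>"
  by (erule proves_insertE) (auto simp: proves_def intro: deriv.Class)

lemma proves_ImpE: "A \<turnstile> Imp \<phi> \<psi> \<Longrightarrow> A \<turnstile> \<phi> \<Longrightarrow> A \<turnstile> \<psi>"
  by (erule (1) proves_combine) (auto simp: proves_def intro: deriv.ImpE)

lemma proves_ConI: "A \<turnstile> \<phi> \<Longrightarrow> A \<turnstile> \<psi> \<Longrightarrow> A \<turnstile> Con \<phi> \<psi>"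
  by (erule (1) proves_combine) (auto simp: proves_def intro: deriv.ConI)

lemma proves_EqE: "A \<turnstile> Eq t u \<Longrightarrow> A \<turnstile> inst t \<phi> \<Longrightarrow> A \<turnstile> inst u \<phi>"
  by (erule (1) proves_combine) (auto simp: proves_def intro: deriv.EqE)

lemma proves_one:
  shows proves_ConE1: "A \<turnstile> Con \<phi> \<psi> \<Longrightarrow> A \<turnstile> \<phi>"
    and proves_ConE2: "A \<turnstile> Con \<phi> \<psi> \<Longrightarrow> A \<turnstile> \<psi>"
    and proves_DisI1: "A \<turnstile> \<phi> \<Longrightarrow> A \<turnstile> Dis \<phi> \<psi>"
    and proves_DisI2: "A \<turnstile> \<psi> \<Longrightarrow> A \<turnstile> Dis \<phi> \<psi>"
    and proves_AllE: "A \<turnstile> All \<chi> \<Longrightarrow> A \<turnstile> inst t \<chi>"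
    and proves_ExI: "A \<turnstile> inst t \<chi> \<Longrightarrow> A \<turnstile> Ex \<chi>"
    and proves_AllSE: "A \<turnstile> AllS \<chi> \<Longrightarrow> A \<turnstile> instS Y \<chi>"
    and proves_ExSI: "A \<turnstile> instS Y \<chi> \<Longrightarrow> A \<turnstile> ExS \<chi>"
  unfolding proves_def by (blast intro: deriv.intros)+

lemma proves_EqI: "A \<turnstile> Eq t t"
  unfolding proves_def by (rule exI[of _ "[]"]) (simp add: deriv.EqI)

lemma proves_DisE:
  assumes "A \<turnstile> Dis \<phi> \<psi>" "insert \<phi> A \<turnstile> \<chi>" "insert \<psi> A \<turnstile> \<chi>"
  shows "A \<turnstile> \<chi>"
proof -
  from assms(1) obtain \<Gamma> where \<Gamma>: "set \<Gamma> \<subseteq> A" "deriv \<Gamma> (Dis \<phi> \<psi>)" unfolding proves_def by blast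
  from assms(2) obtain \<Delta> where \<Delta>: "set \<Delta> \<subseteq> A" "deriv (\<phi> # \<Delta>) \<chi>" by (rule proves_insertE)
  from assms(3) obtain \<Theta> where \<Theta>: "set \<Theta> \<subseteq> A" "deriv (\<psi> # \<Theta>) \<chi>" by (rule proves_insertE)
  let ?\<Xi> = "\<Gamma> @ \<Delta> @ \<Theta>"
  have "deriv ?\<Xi> (Dis \<phi> \<psi>)" "deriv (\<phi> # ?\<Xi>) \<chi>" "deriv (\<psi> # ?\<Xi>) \<chi>"
    using \<Gamma> \<Delta> \<Theta> by (auto intro: deriv_mono)
  then have "deriv ?\<Xi> \<chi>" by (rule deriv.DisE)
  with \<Gamma> \<Delta> \<Theta> show ?thesis unfolding proves_def by (intro exI[of _ ?\<Xi>]) auto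
qed

text \<open>Turns a refuted universal formula into an existential one, so that witnesses for
  \<open>Ex\<close> also provide counterexamples to \<open>All\<close>.\<close>

lemma proves_not_AllD:
  assumes "A \<turnstile> Neg (All \<phi>)"
  shows "A \<turnstile> Ex (Neg \<phi>)"
proof (rule proves_Class)
  let ?N = "Neg (Ex (Neg \<phi>))"
  have "deriv (Neg \<phi> # map shift [?N]) (inst (Var 0) (subst (up (\<lambda>n. Var (Suc n))) (\<lambda>X. X) (Neg \<phi>)))"
  proof -
    \<comment> \<open>Shifting past a new index 0 and instantiating that index by itself is the
      identity.\<close>
    have "case_nat (Var 0) (\<lambda>n. Var (Suc n)) = Var" by (auto simp: fun_eq_iff split: nat.split)
    then show ?thesis unfolding inst_up by (simp only: subst_Var) (simp add: deriv.Assm)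
  qed
  then have "deriv (Neg \<phi> # map shift [?N]) (Ex (subst (up (\<lambda>n. Var (Suc n))) (\<lambda>X. X) (Neg \<phi>)))"
    by (rule deriv.ExI)
  moreover have "deriv (Neg \<phi> # map shift [?N])
      (Neg (Ex (subst (up (\<lambda>n. Var (Suc n))) (\<lambda>X. X) (Neg \<phi>))))"
    by (rule deriv.Assm) (simp add: shift_def)
  ultimately have "deriv (Neg \<phi> # map shift [?N]) Fls" by (rule deriv.ImpE[rotated])
  then have "deriv [?N] (All \<phi>)" by (intro deriv.AllI) (rule deriv.Class)
  then have "insert ?N A \<turnstile> All \<phi>" unfolding proves_def by (intro exI[of _ "[?N]"]) auto
  moreover have "insert ?N A \<turnstile> Neg (All \<phi>)" using assms by (rule proves_mono) auto
  ultimately show "insert ?N A \<turnstile> Fls" by (rule proves_ImpE[rotated])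
qed

lemma proves_not_AllSD:
  assumes "A \<turnstile> Neg (AllS \<phi>)"
  shows "A \<turnstile> ExS (Neg \<phi>)"
proof (rule proves_Class)
  let ?N = "Neg (ExS (Neg \<phi>))"
  have "deriv (Neg \<phi> # map shiftS [?N]) (instS 0 (subst Var (upS Suc) (Neg \<phi>)))"
  proof -
    have "case_nat 0 Suc = (\<lambda>n. n)" by (auto simp: fun_eq_iff split: nat.split)
    then show ?thesis unfolding instS_upS by (simp only: subst_Var) (simp add: deriv.Assm)
  qed
  then have "deriv (Neg \<phi> # map shiftS [?N]) (ExS (subst Var (upS Suc) (Neg \<phi>)))"
    by (rule deriv.ExSI)
  moreover have "deriv (Neg \<phi> # map shiftS [?N]) (Neg (ExS (subst Var (upS Suc) (Neg \<phi>))))"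
    by (rule deriv.Assm) (simp add: shiftS_def)
  ultimately have "deriv (Neg \<phi> # map shiftS [?N]) Fls" by (rule deriv.ImpE[rotated])
  then have "deriv [?N] (AllS \<phi>)" by (intro deriv.AllSI) (rule deriv.Class)
  then have "insert ?N A \<turnstile> AllS \<phi>" unfolding proves_def by (intro exI[of _ "[?N]"]) auto
  moreover have "insert ?N A \<turnstile> Neg (AllS \<phi>)" using assms by (rule proves_mono) auto
  ultimately show "insert ?N A \<turnstile> Fls" by (rule proves_ImpE[rotated])
qed

definition consistent :: "fm set \<Rightarrow> bool" where
  "consistent A \<longleftrightarrow> \<not> A \<turnstile> Fls"

text \<open>Since \<open>x\<close> is fresh, the renaming that sends \<open>x\<close> to index 0 and
  raises all other indices takes the instance back to \<open>\<psi>\<close> and acts on the context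
  as \<open>shift\<close>. The result is the second premise of \<open>ExE\<close>.\<close>

lemma consistent_witness:
  assumes "consistent A" "Ex \<psi> \<in> A" and x: "\<And>\<gamma>. \<gamma> \<in> A \<Longrightarrow> nbound \<gamma> \<le> x"
  shows "consistent (insert (inst (Var x) \<psi>) A)"
  unfolding consistent_def
proof
  assume "insert (inst (Var x) \<psi>) A \<turnstile> Fls"
  then obtain \<Gamma> where \<Gamma>: "set \<Gamma> \<subseteq> A" "deriv (inst (Var x) \<psi> # \<Gamma>) Fls" by (rule proves_insertE)
  let ?\<sigma> = "\<lambda>n. if n = x then Var 0 else Var (Suc n)"
  have "subst ?\<sigma> (\<lambda>X. X) (inst (Var x) \<psi>) = subst Var (\<lambda>X. X) \<psi>"
    unfolding inst_def subst_comp
  proof (rule subst_cong)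
    fix n assume "n < nbound \<psi>"
    then have "n \<le> x" using x[OF assms(2)] by auto
    \<comment> \<open>Under the binder all indices are one higher, so \<open>n \<le> x\<close> still
      means that the variable behind a positive \<open>n\<close>, namely \<open>n - 1\<close>,
      differs from \<open>x\<close>.\<close>
    then show "subst_tm ?\<sigma> (case_nat (Var x) Var n) = Var n" by (auto split: nat.split)
  qed simp
  moreover have "subst ?\<sigma> (\<lambda>X. X) \<gamma> = shift \<gamma>" if "\<gamma> \<in> set \<Gamma>" for \<gamma>
  proof -
    have "nbound \<gamma> \<le> x" using that x \<Gamma>(1) by blast
    then show ?thesis unfolding shift_def by (intro subst_cong) auto
  qed
  then have "map (subst ?\<sigma> (\<lambda>X. X)) \<Gamma> = map shift \<Gamma>" by (rule map_cong[OF refl])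
  ultimately have "deriv (\<psi> # map shift \<Gamma>) (shift Fls)"
    using deriv_subst[OF \<Gamma>(2), of ?\<sigma> "\<lambda>X. X"] by (simp only: list.map subst_Var) (simp add: shift_def)
  then have "deriv (\<psi> # map shift (Ex \<psi> # \<Gamma>)) (shift Fls)" by (rule deriv_mono) auto
  then have "deriv (Ex \<psi> # \<Gamma>) Fls" by (rule deriv.ExE[rotated]) (simp add: deriv.Assm)
  then have "A \<turnstile> Fls" using \<Gamma>(1) assms(2) unfolding proves_def by (intro exI[of _ "Ex \<psi> # \<Gamma>"]) auto
  with assms(1) show False unfolding consistent_def by blast
qed

lemma consistent_witnessS:
  assumes "consistent A" "ExS \<psi> \<in> A" and x: "\<And>\<gamma>. \<gamma> \<in> A \<Longrightarrow> sbound \<gamma> \<le> x"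
  shows "consistent (insert (instS x \<psi>) A)"
  unfolding consistent_def
proof
  assume "insert (instS x \<psi>) A \<turnstile> Fls"
  then obtain \<Gamma> where \<Gamma>: "set \<Gamma> \<subseteq> A" "deriv (instS x \<psi> # \<Gamma>) Fls" by (rule proves_insertE)
  let ?\<rho> = "\<lambda>n. if n = x then 0 else Suc n"
  have "subst Var ?\<rho> (instS x \<psi>) = subst Var (\<lambda>X. X) \<psi>"
    unfolding instS_def subst_comp
  proof (rule subst_cong)
    fix n assume "n < sbound \<psi>"
    then have "n \<le> x" using x[OF assms(2)] by auto
    then show "?\<rho> (case_nat x (\<lambda>X. X) n) = n" by (auto split: nat.split)
  qed simp
  moreover have "subst Var ?\<rho> \<gamma> = shiftS \<gamma>" if "\<gamma> \<in> set \<Gamma>" for \<gamma>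
  proof -
    have "sbound \<gamma> \<le> x" using that x \<Gamma>(1) by blast
    then show ?thesis unfolding shiftS_def by (intro subst_cong) auto
  qed
  then have "map (subst Var ?\<rho>) \<Gamma> = map shiftS \<Gamma>" by (rule map_cong[OF refl])
  ultimately have "deriv (\<psi> # map shiftS \<Gamma>) (shiftS Fls)"
    using deriv_subst[OF \<Gamma>(2), of Var ?\<rho>] by (simp only: list.map subst_Var) (simp add: shiftS_def)
  then have "deriv (\<psi> # map shiftS (ExS \<psi> # \<Gamma>)) (shiftS Fls)" by (rule deriv_mono) auto
  then have "deriv (ExS \<psi> # \<Gamma>) Fls" by (rule deriv.ExSE[rotated]) (simp add: deriv.Assm)
  then have "A \<turnstile> Fls" using \<Gamma>(1) assms(2) unfolding proves_def by (intro exI[of _ "ExS \<psi> # \<Gamma>"]) auto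
  with assms(1) show False unfolding consistent_def by blast
qed

section \<open>Lindenbaum construction with variables as witnesses\<close>

instance tm :: countable by countable_datatype
instance fm :: countable by countable_datatype

text \<open>Free variables play the part of Henkin constants. The construction starts from
  sentences, and each stage keeps a common bound; the limit need not have one.\<close>

definition bounded_vars :: "fm set \<Rightarrow> bool" where
  "bounded_vars A \<longleftrightarrow> (\<exists>x. \<forall>\<gamma>\<in>A. nbound \<gamma> \<le> x \<and> sbound \<gamma> \<le> x)"

lemma bounded_vars_insert: "bounded_vars A \<Longrightarrow> bounded_vars (insert \<phi> A)"
  unfolding bounded_vars_def
  by (metis insert_iff le_max_iff_disj max.cobounded2)

definition fresh_var :: "fm set \<Rightarrow> nat" where
  "fresh_var A = (SOME x. \<forall>\<gamma>\<in>A. nbound \<gamma> \<le> x \<and> sbound \<gamma> \<le> x)"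

lemma fresh_var: "bounded_vars A \<Longrightarrow> \<gamma> \<in> A \<Longrightarrow> nbound \<gamma> \<le> fresh_var A \<and> sbound \<gamma> \<le> fresh_var A"
  unfolding bounded_vars_def fresh_var_def by (rule bspec[OF someI_ex])

definition add_witness :: "nat \<Rightarrow> fm \<Rightarrow> fm set \<Rightarrow> fm set" where
  "add_witness x \<phi> B =
    (case \<phi> of Ex \<psi> \<Rightarrow> insert (inst (Var x) \<psi>) B | ExS \<psi> \<Rightarrow> insert (instS x \<psi>) B | _ \<Rightarrow> B)"

text \<open>A formula is decided and, if existential, receives its witness in the same step, so a
  single enumeration yields both maximality and the Henkin property.\<close>

definition henkin_step :: "fm \<Rightarrow> fm set \<Rightarrow> fm set" where
  "henkin_step \<phi> A =
    (let B = insert \<phi> A in if consistent B then add_witness (fresh_var B) \<phi> B else A)"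

lemma add_witness:
  assumes "bounded_vars B" "consistent B" "\<phi> \<in> B"
  shows "bounded_vars (add_witness (fresh_var B) \<phi> B)" "consistent (add_witness (fresh_var B) \<phi> B)"
    "B \<subseteq> add_witness (fresh_var B) \<phi> B"
proof -
  note b = fresh_var[OF assms(1)]
  note w = consistent_witness[OF assms(2), of _ "fresh_var B"]
    consistent_witnessS[OF assms(2), of _ "fresh_var B"]
  show "consistent (add_witness (fresh_var B) \<phi> B)"
    using assms(2,3) b w unfolding add_witness_def by (auto split: fm.split)
  show "bounded_vars (add_witness (fresh_var B) \<phi> B)" "B \<subseteq> add_witness (fresh_var B) \<phi> B"
    using assms(1) bounded_vars_insert[OF assms(1)] by (auto simp: add_witness_def split: fm.split)
qed

lemma henkin_step:
  assumes "bounded_vars A" "consistent A"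
  shows "bounded_vars (henkin_step \<phi> A)" "consistent (henkin_step \<phi> A)" "A \<subseteq> henkin_step \<phi> A"
  using assms add_witness[OF bounded_vars_insert[OF assms(1)], of \<phi> \<phi>]
  by (auto simp: henkin_step_def Let_def)

primrec henkin_stage :: "fm set \<Rightarrow> nat \<Rightarrow> fm set" where
  "henkin_stage A 0 = A"
| "henkin_stage A (Suc n) = henkin_step (from_nat n) (henkin_stage A n)"

locale henkin =
  fixes H :: "fm set"
  assumes cons: "consistent H"
    and maximal: "\<phi> \<notin> H \<Longrightarrow> \<not> consistent (insert \<phi> H)"
    and wit_Ex: "Ex \<psi> \<in> H \<Longrightarrow> \<exists>x. inst (Var x) \<psi> \<in> H"
    and wit_ExS: "ExS \<psi> \<in> H \<Longrightarrow> \<exists>x. instS x \<psi> \<in> H"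

lemma henkin_extension:
  assumes "bounded_vars A" "consistent A"
  shows "\<exists>H. henkin H \<and> A \<subseteq> H"
proof -
  let ?S = "henkin_stage A"
  define H where "H = (\<Union>n. ?S n)"
  have st: "bounded_vars (?S n) \<and> consistent (?S n)" for n
    by (induction n) (use assms henkin_step in auto)
  have "mono ?S" by (rule mono_iff_le_Suc[THEN iffD2]) (use st henkin_step in auto)
  then have mono: "?S m \<subseteq> ?S n" if "m \<le> n" for m n using that by (auto dest: monoD)
  have fin: "\<exists>n. set \<Gamma> \<subseteq> ?S n" if "set \<Gamma> \<subseteq> H" for \<Gamma>
    using that
  proof (induction \<Gamma>)
    case (Cons \<gamma> \<Gamma>)
    then obtain n m where "set \<Gamma> \<subseteq> ?S n" "\<gamma> \<in> ?S m" by (auto simp: H_def)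
    then have "set (\<gamma> # \<Gamma>) \<subseteq> ?S (max n m)" using mono[of n "max n m"] mono[of m "max n m"] by auto
    then show ?case by blast
  qed auto
  have "consistent H"
    unfolding consistent_def proves_def
  proof
    assume "\<exists>\<Gamma>. set \<Gamma> \<subseteq> H \<and> deriv \<Gamma> Fls"
    then obtain \<Gamma> where "set \<Gamma> \<subseteq> H" "deriv \<Gamma> Fls" by blast
    with fin obtain n where "?S n \<turnstile> Fls" unfolding proves_def by blast
    with st show False unfolding consistent_def by blast
  qed
  \<comment> \<open>\<open>from_nat (to_nat \<phi>) = \<phi>\<close>, so the turn of
    \<open>\<phi>\<close> comes exactly at stage \<open>to_nat \<phi>\<close>.\<close>
  have step: "\<exists>x. \<phi> \<in> add_witness x \<phi> {\<phi>} \<and> add_witness x \<phi> {\<phi>} \<subseteq> H"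
    if "consistent (insert \<phi> (?S (to_nat \<phi>)))" for \<phi>
  proof -
    have "add_witness (fresh_var (insert \<phi> (?S (to_nat \<phi>)))) \<phi> {\<phi>} \<subseteq> ?S (Suc (to_nat \<phi>))"
      using that by (auto simp: henkin_step_def Let_def add_witness_def split: fm.splits)
    moreover have "\<phi> \<in> add_witness x \<phi> {\<phi>}" for x
      by (simp add: add_witness_def split: fm.split)
    ultimately show ?thesis unfolding H_def by blast
  qed
  have sub: "consistent (insert \<phi> (?S n))" if "consistent (insert \<phi> H)" for \<phi> n
    using that proves_mono[of "insert \<phi> (?S n)" Fls "insert \<phi> H"]
    unfolding consistent_def H_def by blast
  have "henkin H"
  proof
    show "consistent H" by fact
    show "\<not> consistent (insert \<phi> H)" if "\<phi> \<notin> H" for \<phi> using that step sub by blast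
    show "\<exists>x. inst (Var x) \<psi> \<in> H" if "Ex \<psi> \<in> H" for \<psi>
      using step[OF sub, of "Ex \<psi>"] \<open>consistent H\<close> that by (auto simp: insert_absorb add_witness_def)
    show "\<exists>x. instS x \<psi> \<in> H" if "ExS \<psi> \<in> H" for \<psi>
      using step[OF sub, of "ExS \<psi>"] \<open>consistent H\<close> that by (auto simp: insert_absorb add_witness_def)
  qed
  moreover have "A \<subseteq> H" unfolding H_def using henkin_stage.simps(1) by blast
  ultimately show ?thesis by blast
qed

section \<open>Truth conditions inside a Henkin set\<close>

context henkin
begin

lemma closed: "H \<turnstile> \<phi> \<Longrightarrow> \<phi> \<in> H"
proof (rule ccontr)
  assume a: "H \<turnstile> \<phi>" "\<phi> \<notin> H"
  from maximal[OF a(2)] have "H \<turnstile> Neg \<phi>" unfolding consistent_def by (auto intro: proves_ImpI)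
  from proves_ImpE[OF this a(1)] cons show False unfolding consistent_def by blast
qed

lemma in_iff: "\<phi> \<in> H \<longleftrightarrow> H \<turnstile> \<phi>"
  using closed proves_assm by blast

lemma Fls_iff: "Fls \<notin> H"
  using cons unfolding consistent_def in_iff .

lemma Neg_iff: "Neg \<phi> \<in> H \<longleftrightarrow> \<phi> \<notin> H"
proof
  assume "Neg \<phi> \<in> H" then show "\<phi> \<notin> H" using Fls_iff proves_ImpE unfolding in_iff by blast
next
  assume "\<phi> \<notin> H"
  then have "insert \<phi> H \<turnstile> Fls" using maximal unfolding consistent_def by blast
  then show "Neg \<phi> \<in> H" unfolding in_iff by (rule proves_ImpI)
qed

lemma Imp_iff: "Imp \<phi> \<psi> \<in> H \<longleftrightarrow> (\<phi> \<in> H \<longrightarrow> \<psi> \<in> H)"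
proof
  assume "Imp \<phi> \<psi> \<in> H" then show "\<phi> \<in> H \<longrightarrow> \<psi> \<in> H" using proves_ImpE unfolding in_iff by blast
next
  assume *: "\<phi> \<in> H \<longrightarrow> \<psi> \<in> H"
  have "insert \<phi> H \<turnstile> \<psi>"
  proof (cases "\<phi> \<in> H")
    case True then show ?thesis using * by (intro proves_assm) auto
  next
    case False
    then have "insert \<phi> H \<turnstile> Fls" using maximal unfolding consistent_def by blast
    then have "insert (Neg \<psi>) (insert \<phi> H) \<turnstile> Fls" by (rule proves_mono) auto
    then show ?thesis by (rule proves_Class)
  qed
  then show "Imp \<phi> \<psi> \<in> H" unfolding in_iff by (rule proves_ImpI)
qed

lemma Con_iff: "Con \<phi> \<psi> \<in> H \<longleftrightarrow> \<phi> \<in> H \<and> \<psi> \<in> H"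
  unfolding in_iff by (blast intro: proves_ConI proves_ConE1 proves_ConE2)

lemma Dis_iff: "Dis \<phi> \<psi> \<in> H \<longleftrightarrow> \<phi> \<in> H \<or> \<psi> \<in> H"
proof
  assume D: "Dis \<phi> \<psi> \<in> H"
  show "\<phi> \<in> H \<or> \<psi> \<in> H"
  proof (rule ccontr)
    assume "\<not> ?thesis"
    then have "insert \<phi> H \<turnstile> Fls" "insert \<psi> H \<turnstile> Fls" using maximal unfolding consistent_def by auto
    with D have "H \<turnstile> Fls" unfolding in_iff by (auto intro: proves_DisE)
    then show False using Fls_iff in_iff by blast
  qed
next
  assume "\<phi> \<in> H \<or> \<psi> \<in> H" then show "Dis \<phi> \<psi> \<in> H"
    unfolding in_iff by (auto intro: proves_DisI1 proves_DisI2)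
qed

lemma Ex_iff: "Ex \<phi> \<in> H \<longleftrightarrow> (\<exists>t. inst t \<phi> \<in> H)"
  using wit_Ex[of \<phi>] proves_ExI[of H _ \<phi>] unfolding in_iff by blast

lemma ExS_iff: "ExS \<phi> \<in> H \<longleftrightarrow> (\<exists>Y. instS Y \<phi> \<in> H)"
  using wit_ExS[of \<phi>] proves_ExSI[of H _ \<phi>] unfolding in_iff by blast

lemma inst_Neg: "inst t (Neg \<phi>) = Neg (inst t \<phi>)" by (simp add: inst_def)
lemma instS_Neg: "instS t (Neg \<phi>) = Neg (instS t \<phi>)" by (simp add: instS_def)

lemma All_iff: "All \<phi> \<in> H \<longleftrightarrow> (\<forall>t. inst t \<phi> \<in> H)"
proof
  assume "All \<phi> \<in> H" then show "\<forall>t. inst t \<phi> \<in> H" unfolding in_iff by (blast intro: proves_AllE)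
next
  assume *: "\<forall>t. inst t \<phi> \<in> H"
  show "All \<phi> \<in> H"
  proof (rule ccontr)
    assume "All \<phi> \<notin> H"
    then have "Ex (Neg \<phi>) \<in> H" using Neg_iff in_iff proves_not_AllD by blast
    then show False using * unfolding Ex_iff inst_Neg Neg_iff by blast
  qed
qed

lemma AllS_iff: "AllS \<phi> \<in> H \<longleftrightarrow> (\<forall>Y. instS Y \<phi> \<in> H)"
proof
  assume "AllS \<phi> \<in> H" then show "\<forall>t. instS t \<phi> \<in> H" unfolding in_iff by (blast intro: proves_AllSE)
next
  assume *: "\<forall>t. instS t \<phi> \<in> H"
  show "AllS \<phi> \<in> H"
  proof (rule ccontr)
    assume "AllS \<phi> \<notin> H"
    then have "ExS (Neg \<phi>) \<in> H" using Neg_iff in_iff proves_not_AllSD by blast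
    then show False using * unfolding ExS_iff instS_Neg Neg_iff by blast
  qed
qed

lemma Eq_refl: "Eq t t \<in> H" unfolding in_iff by (rule proves_EqI)

lemma Eq_subst: "Eq t u \<in> H \<Longrightarrow> subst (case_nat t Var) (\<lambda>X. X) \<phi> \<in> H \<Longrightarrow>
    subst (case_nat u Var) (\<lambda>X. X) \<phi> \<in> H"
  unfolding in_iff inst_def[symmetric] by (rule proves_EqE)

lemma inst_shift_tm: "subst_tm (case_nat t Var) (shift_tm u) = u"
  by (simp add: shift_tm_def subst_tm_comp subst_tm_Var)

lemma Eq_sym: "Eq t u \<in> H \<Longrightarrow> Eq u t \<in> H"
  using Eq_subst[of t u "Eq (Var 0) (shift_tm t)"] Eq_refl by (simp add: inst_shift_tm)

lemma Eq_trans: "Eq t u \<in> H \<Longrightarrow> Eq u v \<in> H \<Longrightarrow> Eq t v \<in> H"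
  using Eq_subst[of u v "Eq (shift_tm t) (Var 0)"] by (simp add: inst_shift_tm)

lemma Eq_Plus: "Eq t t' \<in> H \<Longrightarrow> Eq u u' \<in> H \<Longrightarrow> Eq (Plus t u) (Plus t' u') \<in> H"
  using Eq_subst[of t t' "Eq (Plus (shift_tm t) (shift_tm u)) (Plus (Var 0) (shift_tm u))"]
    Eq_subst[of u u' "Eq (Plus (shift_tm t) (shift_tm u)) (Plus (shift_tm t') (Var 0))"] Eq_refl
  by (simp add: inst_shift_tm)

lemma Eq_Times: "Eq t t' \<in> H \<Longrightarrow> Eq u u' \<in> H \<Longrightarrow> Eq (Times t u) (Times t' u') \<in> H"
  using Eq_subst[of t t' "Eq (Times (shift_tm t) (shift_tm u)) (Times (Var 0) (shift_tm u))"]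
    Eq_subst[of u u' "Eq (Times (shift_tm t) (shift_tm u)) (Times (shift_tm t') (Var 0))"] Eq_refl
  by (simp add: inst_shift_tm)

lemma Less_cong: "Eq t t' \<in> H \<Longrightarrow> Eq u u' \<in> H \<Longrightarrow> Less t u \<in> H \<longleftrightarrow> Less t' u' \<in> H"
proof -
  have "Less t' u' \<in> H" if "Eq t t' \<in> H" "Eq u u' \<in> H" "Less t u \<in> H" for t t' u u'
    using that Eq_subst[of t t' "Less (Var 0) (shift_tm u)"] Eq_subst[of u u' "Less (shift_tm t')
        (Var 0)"]
    by (simp add: inst_shift_tm)
  then show "Eq t t' \<in> H \<Longrightarrow> Eq u u' \<in> H \<Longrightarrow> Less t u \<in> H \<longleftrightarrow> Less t' u' \<in> H"
    using Eq_sym by blast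
qed

lemma Mem_cong: "Eq t t' \<in> H \<Longrightarrow> Mem t Y \<in> H \<longleftrightarrow> Mem t' Y \<in> H"
proof -
  have "Mem t' Y \<in> H" if "Eq t t' \<in> H" "Mem t Y \<in> H" for t t'
    using that Eq_subst[of t t' "Mem (Var 0) Y"] by simp
  then show "Eq t t' \<in> H \<Longrightarrow> Mem t Y \<in> H \<longleftrightarrow> Mem t' Y \<in> H"
    using Eq_sym by blast
qed

end

section \<open>Models\<close>

text \<open>Henkin semantics: set quantifiers range over the family \<open>sets\<close>, which need
  not contain all subsets of \<open>dom\<close>. The completeness theorem is for this
  reading.\<close>

record 'a model =
  dom :: "'a set"
  sets :: "'a set set"
  zer :: 'a
  uno :: 'a
  add :: "'a \<Rightarrow> 'a \<Rightarrow> 'a"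
  mul :: "'a \<Rightarrow> 'a \<Rightarrow> 'a"
  les :: "'a \<Rightarrow> 'a \<Rightarrow> bool"

primrec ev :: "'a model \<Rightarrow> (nat \<Rightarrow> 'a) \<Rightarrow> tm \<Rightarrow> 'a" where
  "ev M e (Var n) = e n"
| "ev M e Zero = zer M"
| "ev M e One = uno M"
| "ev M e (Plus t u) = add M (ev M e t) (ev M e u)"
| "ev M e (Times t u) = mul M (ev M e t) (ev M e u)"

primrec sat :: "'a model \<Rightarrow> (nat \<Rightarrow> 'a) \<Rightarrow> (nat \<Rightarrow> 'a set) \<Rightarrow> fm \<Rightarrow> bool" where
  "sat M e E (Eq t u) \<longleftrightarrow> ev M e t = ev M e u"
| "sat M e E (Less t u) \<longleftrightarrow> les M (ev M e t) (ev M e u)"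
| "sat M e E (Mem t X) \<longleftrightarrow> ev M e t \<in> E X"
| "sat M e E Fls \<longleftrightarrow> False"
| "sat M e E (Imp \<phi> \<psi>) \<longleftrightarrow> (sat M e E \<phi> \<longrightarrow> sat M e E \<psi>)"
| "sat M e E (Con \<phi> \<psi>) \<longleftrightarrow> sat M e E \<phi> \<and> sat M e E \<psi>"
| "sat M e E (Dis \<phi> \<psi>) \<longleftrightarrow> sat M e E \<phi> \<or> sat M e E \<psi>"
| "sat M e E (All \<phi>) \<longleftrightarrow> (\<forall>x\<in>dom M. sat M (case_nat x e) E \<phi>)"
| "sat M e E (Ex \<phi>) \<longleftrightarrow> (\<exists>x\<in>dom M. sat M (case_nat x e) E \<phi>)"
| "sat M e E (AllS \<phi>) \<longleftrightarrow> (\<forall>X\<in>sets M. sat M e (case_nat X E) \<phi>)"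
| "sat M e E (ExS \<phi>) \<longleftrightarrow> (\<exists>X\<in>sets M. sat M e (case_nat X E) \<phi>)"

text \<open>A class of provably equal terms is represented by the least code of one of its members, so that
  the carrier of the term model is a set of natural numbers.\<close>

context henkin
begin

definition cl :: "tm \<Rightarrow> nat" where
  "cl t = (LEAST m. \<exists>u. Eq t u \<in> H \<and> m = to_nat u)"

definition rep :: "nat \<Rightarrow> tm" where
  "rep a = (SOME t. cl t = a)"

lemma cl_iff: "cl t = cl u \<longleftrightarrow> Eq t u \<in> H"
proof
  have *: "\<exists>v. Eq t v \<in> H \<and> cl t = to_nat v" for t
    unfolding cl_def by (rule LeastI_ex) (use Eq_refl in blast)
  assume "cl t = cl u"
  with *[of t] *[of u] obtain v w where "Eq t v \<in> H" "Eq u w \<in> H" "to_nat v = to_nat w" by auto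
  then show "Eq t u \<in> H" using Eq_sym Eq_trans by (metis to_nat_split)
next
  assume "Eq t u \<in> H"
  then have "Eq t v \<in> H \<longleftrightarrow> Eq u v \<in> H" for v using Eq_sym Eq_trans by blast
  then show "cl t = cl u" unfolding cl_def by simp
qed

lemma cl_rep: "cl (rep (cl t)) = cl t"
  unfolding rep_def by (rule someI_ex) blast

text \<open>Two set variables with the same extension are identified. This is harmless because the
  language has no equality between sets.\<close>

definition ext :: "nat \<Rightarrow> nat set" where
  "ext Y = {cl t |t. Mem t Y \<in> H}"

definition TM :: "nat model" where
  "TM = \<lparr>dom = range cl, sets = range ext, zer = cl Zero, uno = cl One,
     add = \<lambda>a b. cl (Plus (rep a) (rep b)), mul = \<lambda>a b. cl (Times (rep a) (rep b)),
     les = \<lambda>a b. Less (rep a) (rep b) \<in> H\<rparr>"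

lemma Eq_rep: "Eq (rep (cl t)) t \<in> H"
  using cl_rep cl_iff by blast

lemma ev_TM: "ev TM (\<lambda>n. cl (\<sigma> n)) t = cl (subst_tm \<sigma> t)"
  by (induction t) (auto simp: TM_def cl_iff intro: Eq_Plus Eq_Times Eq_rep)

lemma case_nat_comp: "case_nat (f t) (\<lambda>n. f (\<sigma> n)) = (\<lambda>n. f (case_nat t \<sigma> n))"
  by (auto simp: fun_eq_iff split: nat.split)

text \<open>The truth lemma. It is stated for all substitutions because every element of the model
  is the class of a term: extending the assignment under a quantifier is extending the substitution,
  and this matches instantiation by \<open>inst_up\<close> and \<open>instS_upS\<close>.\<close>

lemma sat_TM: "sat TM (\<lambda>n. cl (\<sigma> n)) (\<lambda>X. ext (\<rho> X)) \<phi> \<longleftrightarrow> subst \<sigma> \<rho> \<phi> \<in> H"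
proof (induction \<phi> arbitrary: \<sigma> \<rho>)
  case (Less t u)
  show ?case using Less_cong[OF Eq_rep Eq_rep] by (simp add: ev_TM) (simp add: TM_def)
next
  case (Mem t X)
  show ?case using Mem_cong Eq_refl by (simp add: ev_TM ext_def cl_iff) blast
next
  case (All \<phi>)
  have "dom TM = range cl" by (simp add: TM_def)
  then show ?case using All.IH by (simp add: case_nat_comp All_iff inst_up)
next
  case (Ex \<phi>)
  have "dom TM = range cl" by (simp add: TM_def)
  then show ?case using Ex.IH by (simp add: case_nat_comp Ex_iff inst_up)
next
  case (AllS \<phi>)
  have "sets TM = range ext" by (simp add: TM_def)
  then show ?case using AllS.IH by (simp add: case_nat_comp[of ext] AllS_iff instS_upS)
next
  case (ExS \<phi>)
  have "sets TM = range ext" by (simp add: TM_def)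
  then show ?case using ExS.IH by (simp add: case_nat_comp[of ext] ExS_iff instS_upS)
qed (simp_all add: ev_TM cl_iff Fls_iff Imp_iff Con_iff Dis_iff)

end

section \<open>Validity, universal closures and completeness\<close>

definition wf_model :: "'a model \<Rightarrow> bool" where
  "wf_model M \<longleftrightarrow> zer M \<in> dom M \<and> uno M \<in> dom M \<and> sets M \<subseteq> Pow (dom M) \<and> sets M \<noteq> {} \<and>
     (\<forall>a\<in>dom M. \<forall>b\<in>dom M. add M a b \<in> dom M \<and> mul M a b \<in> dom M)"

definition models :: "'a model \<Rightarrow> fm \<Rightarrow> bool" where
  "models M \<phi> \<longleftrightarrow> (\<forall>e E. range e \<subseteq> dom M \<and> range E \<subseteq> sets M \<longrightarrow> sat M e E \<phi>)"

lemma ev_cong: "(\<And>n. n < nbound_tm t \<Longrightarrow> e n = e' n) \<Longrightarrow> ev M e t = ev M e' t"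
  by (induction t) auto

lemma sat_cong:
  "(\<And>n. n < nbound \<phi> \<Longrightarrow> e n = e' n) \<Longrightarrow> (\<And>X. X < sbound \<phi> \<Longrightarrow> E X = E' X) \<Longrightarrow>
   sat M e E \<phi> = sat M e' E' \<phi>"
proof (induction \<phi> arbitrary: e e' E E')
  case (Eq t u) then show ?case using ev_cong[of _ e e' M] by simp
next
  case (Less t u) then show ?case using ev_cong[of _ e e' M] by simp
next
  case (Mem t u) then show ?case using ev_cong[of _ e e' M] by simp
next
  case (Imp \<phi> \<psi>)
  from Imp.IH(1)[of e e' E E'] Imp.IH(2)[of e e' E E'] Imp.prems show ?case by simp
next
  case (Con \<phi> \<psi>)
  from Con.IH(1)[of e e' E E'] Con.IH(2)[of e e' E E'] Con.prems show ?case by simp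
next
  case (Dis \<phi> \<psi>)
  from Dis.IH(1)[of e e' E E'] Dis.IH(2)[of e e' E E'] Dis.prems show ?case by simp
next
  case (All \<phi>)
  have "sat M (case_nat x e) E \<phi> = sat M (case_nat x e') E' \<phi>" for x
  proof (rule All.IH)
    fix n assume "n < nbound \<phi>"
    then show "case_nat x e n = case_nat x e' n"
      using All.prems(1)[of "n - 1"] by (auto split: nat.split)
  qed (use All.prems in auto)
  then show ?case by simp
next
  case (Ex \<phi>)
  have "sat M (case_nat x e) E \<phi> = sat M (case_nat x e') E' \<phi>" for x
  proof (rule Ex.IH)
    fix n assume "n < nbound \<phi>"
    then show "case_nat x e n = case_nat x e' n"
      using Ex.prems(1)[of "n - 1"] by (auto split: nat.split)
  qed (use Ex.prems in auto)
  then show ?case by simp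
next
  case (AllS \<phi>)
  have "sat M e (case_nat x E) \<phi> = sat M e' (case_nat x E') \<phi>" for x
  proof (rule AllS.IH)
    fix n assume "n < sbound \<phi>"
    then show "case_nat x E n = case_nat x E' n"
      using AllS.prems(2)[of "n - 1"] by (auto split: nat.split)
  qed (use AllS.prems in auto)
  then show ?case by simp
next
  case (ExS \<phi>)
  have "sat M e (case_nat x E) \<phi> = sat M e' (case_nat x E') \<phi>" for x
  proof (rule ExS.IH)
    fix n assume "n < sbound \<phi>"
    then show "case_nat x E n = case_nat x E' n"
      using ExS.prems(2)[of "n - 1"] by (auto split: nat.split)
  qed (use ExS.prems in auto)
  then show ?case by simp
qed simp

lemma ev_subst: "ev M e (subst_tm \<sigma> t) = ev M (\<lambda>n. ev M e (\<sigma> n)) t"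
  by (induction t) auto

lemma ev_up: "(\<lambda>n. ev M (case_nat x e) (up \<sigma> n)) = case_nat x (\<lambda>n. ev M e (\<sigma> n))"
  by (auto simp: up_def shift_tm_def ev_subst fun_eq_iff split: nat.split)

lemma case_upS: "(\<lambda>n. case_nat X E (upS \<rho> n)) = case_nat X (\<lambda>n. E (\<rho> n))"
  by (auto simp: upS_def fun_eq_iff split: nat.split)

lemma sat_subst: "sat M e E (subst \<sigma> \<rho> \<phi>) = sat M (\<lambda>n. ev M e (\<sigma> n)) (\<lambda>X. E (\<rho> X)) \<phi>"
  by (induction \<phi> arbitrary: \<sigma> \<rho> e E) (auto simp: ev_subst ev_up case_upS)

lemma nbound_iterate: "nbound ((All ^^ n) \<phi>) = nbound \<phi> - n" "nbound ((AllS ^^ n) \<phi>) = nbound \<phi>"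
  by (induction n) auto

lemma sbound_iterate: "sbound ((All ^^ n) \<phi>) = sbound \<phi>" "sbound ((AllS ^^ n) \<phi>) = sbound \<phi> - n"
  by (induction n) auto

lemma closure_closed: "nbound (closure \<phi>) = 0" "sbound (closure \<phi>) = 0"
  by (simp_all add: closure_def nbound_iterate sbound_iterate)

lemma if_case_nat:
  "(\<lambda>i. if i < n then a i else case_nat x e (i - n)) =
   (\<lambda>i. if i < Suc n then (a(n := x)) i else e (i - Suc n))"
proof
  fix i
  consider "i < n" | "i = n" | "i - n = Suc (i - Suc n)" "n < i" by linarith
  then show "(if i < n then a i else case_nat x e (i - n)) =
      (if i < Suc n then (a(n := x)) i else e (i - Suc n))" by cases auto
qed

text \<open>The innermost quantifier binds index 0 and the outermost index \<open>n - 1\<close>; the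
  block thus supplies the indices below \<open>n\<close> and pushes \<open>e\<close> up by
  \<open>n\<close>.\<close>

lemma sat_All_iterate:
  "sat M e E ((All ^^ n) \<phi>) \<longleftrightarrow>
    (\<forall>a. (\<forall>i<n. a i \<in> dom M) \<longrightarrow> sat M (\<lambda>i. if i < n then a i else e (i - n)) E \<phi>)"
proof (induction n arbitrary: e)
  case (Suc n)
  show ?case (is "_ \<longleftrightarrow> ?R")
  proof
    assume L: "sat M e E ((All ^^ Suc n) \<phi>)"
    show ?R
    proof (intro allI impI)
      fix a assume a: "\<forall>i<Suc n. a i \<in> dom M"
      then have "sat M (\<lambda>i. if i < n then a i else case_nat (a n) e (i - n)) E \<phi>"
        using L Suc.IH by auto
      moreover have "(\<lambda>i. if i < n then a i else case_nat (a n) e (i - n)) =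
          (\<lambda>i. if i < Suc n then a i else e (i - Suc n))"
        unfolding if_case_nat fun_upd_triv ..
      ultimately show "sat M (\<lambda>i. if i < Suc n then a i else e (i - Suc n)) E \<phi>" by simp
    qed
  next
    assume R: ?R
    have "sat M (\<lambda>i. if i < n then a i else case_nat x e (i - n)) E \<phi>"
      if x: "x \<in> dom M" and a: "\<forall>i<n. a i \<in> dom M" for x a
    proof -
      have "(\<lambda>i. if i < n then a i else case_nat x e (i - n)) =
          (\<lambda>i. if i < Suc n then (a(n := x)) i else e (i - Suc n))"
        by (rule if_case_nat)
      moreover have "\<forall>i<Suc n. (a(n := x)) i \<in> dom M" using x a by auto
      ultimately show ?thesis using R[THEN spec, of "a(n := x)"] by (simp only:)
    qed
    then show "sat M e E ((All ^^ Suc n) \<phi>)" using Suc.IH by auto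
  qed
qed simp

lemma sat_AllS_iterate:
  "sat M e E ((AllS ^^ n) \<phi>) \<longleftrightarrow>
    (\<forall>A. (\<forall>i<n. A i \<in> sets M) \<longrightarrow> sat M e (\<lambda>i. if i < n then A i else E (i - n)) \<phi>)"
proof (induction n arbitrary: E)
  case (Suc n)
  show ?case (is "_ \<longleftrightarrow> ?R")
  proof
    assume L: "sat M e E ((AllS ^^ Suc n) \<phi>)"
    show ?R
    proof (intro allI impI)
      fix a assume a: "\<forall>i<Suc n. a i \<in> sets M"
      then have "sat M e (\<lambda>i. if i < n then a i else case_nat (a n) E (i - n)) \<phi>"
        using L Suc.IH by auto
      moreover have "(\<lambda>i. if i < n then a i else case_nat (a n) E (i - n)) =
          (\<lambda>i. if i < Suc n then a i else E (i - Suc n))"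
        unfolding if_case_nat fun_upd_triv ..
      ultimately show "sat M e (\<lambda>i. if i < Suc n then a i else E (i - Suc n)) \<phi>" by simp
    qed
  next
    assume R: ?R
    have "sat M e (\<lambda>i. if i < n then a i else case_nat x E (i - n)) \<phi>"
      if x: "x \<in> sets M" and a: "\<forall>i<n. a i \<in> sets M" for x a
    proof -
      have "(\<lambda>i. if i < n then a i else case_nat x E (i - n)) =
          (\<lambda>i. if i < Suc n then (a(n := x)) i else E (i - Suc n))"
        by (rule if_case_nat)
      moreover have "\<forall>i<Suc n. (a(n := x)) i \<in> sets M" using x a by auto
      ultimately show ?thesis using R[THEN spec, of "a(n := x)"] by (simp only:)
    qed
    then show "sat M e E ((AllS ^^ Suc n) \<phi>)" using Suc.IH by auto
  qed
qed simp

lemma models_closure: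
  fixes M :: "'a model"
  shows "models M (closure \<phi>) \<longleftrightarrow> models M \<phi>"
proof
  assume c: "models M (closure \<phi>)"
  show "models M \<phi>" unfolding models_def
  proof (intro allI impI)
    fix e :: "nat \<Rightarrow> 'a" and E :: "nat \<Rightarrow> 'a set" assume eE: "range e \<subseteq> dom M \<and> range E \<subseteq> sets M"
    then have "sat M e E (closure \<phi>)" using c unfolding models_def by blast
    \<comment> \<open>The closure is instantiated with the values of \<open>e\<close> and
      \<open>E\<close> themselves. Beyond the bounds the result differs from \<open>e\<close> and
      \<open>E\<close>, but there \<open>\<phi>\<close> has no free variables.\<close>
    then have "sat M (\<lambda>i. if i < nbound \<phi> then e i else e (i - nbound \<phi>))
        (\<lambda>i. if i < sbound \<phi> then E i else E (i - sbound \<phi>)) \<phi>"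
      unfolding closure_def sat_All_iterate sat_AllS_iterate using eE
      by (elim allE[of _ e] allE[of _ E]) (auto simp: image_subset_iff)
    also have "?this \<longleftrightarrow> sat M e E \<phi>" by (rule sat_cong) auto
    finally show "sat M e E \<phi>" .
  qed
next
  assume m: "models M \<phi>"
  show "models M (closure \<phi>)" unfolding models_def closure_def sat_All_iterate sat_AllS_iterate
  proof (intro allI impI)
    fix e a :: "nat \<Rightarrow> 'a" and E A :: "nat \<Rightarrow> 'a set"
    assume "range e \<subseteq> dom M \<and> range E \<subseteq> sets M" "\<forall>i<nbound \<phi>. a i \<in> dom M" "\<forall>i<sbound \<phi>. A i \<in> sets M"
    then show "sat M (\<lambda>i. if i < nbound \<phi> then a i else e (i - nbound \<phi>))
        (\<lambda>i. if i < sbound \<phi> then A i else E (i - sbound \<phi>)) \<phi>"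
      using m unfolding models_def by (auto simp: image_subset_iff)
  qed
qed

theorem completeness:
  assumes sent: "\<And>\<gamma>. \<gamma> \<in> T \<Longrightarrow> nbound \<gamma> = 0 \<and> sbound \<gamma> = 0" "nbound \<phi> = 0 \<and> sbound \<phi> = 0"
    and "\<not> T \<turnstile> \<phi>"
  shows "\<exists>M :: nat model. wf_model M \<and> (\<forall>\<gamma>\<in>T. models M \<gamma>) \<and> \<not> models M \<phi>"
proof -
  have "consistent (insert (Neg \<phi>) T)"
    using assms(3) proves_Class unfolding consistent_def by blast
  moreover have "bounded_vars (insert (Neg \<phi>) T)"
    using sent unfolding bounded_vars_def by (intro exI[of _ 0]) auto
  ultimately obtain H where H: "henkin H" "insert (Neg \<phi>) T \<subseteq> H" using henkin_extension by blast
  interpret henkin H by fact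
  have wf: "wf_model TM" unfolding wf_model_def TM_def ext_def by auto
  have *: "models TM \<gamma> \<longleftrightarrow> \<gamma> \<in> H" if "nbound \<gamma> = 0 \<and> sbound \<gamma> = 0" for \<gamma>
  proof -
    have "sat TM e E \<gamma> = sat TM (\<lambda>n. cl (Var n)) ext \<gamma>" for e E
      using that by (intro sat_cong) auto
    then have s: "sat TM e E \<gamma> \<longleftrightarrow> \<gamma> \<in> H" for e E
      using sat_TM[of Var "\<lambda>X. X" \<gamma>] by (simp add: subst_Var)
    have "\<exists>e E. range e \<subseteq> dom TM \<and> range E \<subseteq> sets TM"
      using wf unfolding wf_model_def
          by (intro exI[of _ "\<lambda>_. zer TM"] exI[of _ "\<lambda>_. SOME X. X \<in> sets TM"])
        (auto intro: someI)
    then show ?thesis unfolding models_def s by auto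
  qed
  have "\<forall>\<gamma>\<in>T. models TM \<gamma>" using H(2) sent(1) * by auto
  moreover have "\<not> models TM \<phi>" using H(2) sent(2) * Neg_iff by auto
  ultimately show ?thesis using wf by blast
qed

section \<open>A countermodel as a type\<close>

text \<open>The value of \<open>MM\<close> when no countermodel exists. It satisfies
  \<open>RCA0\<close>, so the axioms may be used in \<open>MM\<close> unconditionally.\<close>

definition std :: "nat model" where
  "std = \<lparr>dom = UNIV, sets = UNIV, zer = 0, uno = 1, add = (+), mul = (*), les = (<)\<rparr>"

lemma wf_std: "wf_model std"
  by (simp add: wf_model_def std_def)

lemmas form_defs = sentence_def all_f_def ex_f_def all_set_def ex_set_def zero_def one_def plus_t_def
  times_t_def eq_f_def less_f_def mem_f_def not_f_def and_f_def or_f_def imp_f_def iff_f_def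

lemma std_basic: "\<gamma> \<in> basic_axioms \<Longrightarrow> models std \<gamma>"
  unfolding basic_axioms_def by (auto simp: form_defs models_def std_def)

lemma sat_induction_ax:
  "sat M e E (induction_ax \<phi>) \<longleftrightarrow>
    (sat M (case_nat (zer M) e) E \<phi> \<and>
     (\<forall>x\<in>dom M. sat M (case_nat x e) E \<phi> \<longrightarrow> sat M (case_nat (add M x (uno M)) e) E \<phi>) \<longrightarrow>
     (\<forall>x\<in>dom M. sat M (case_nat x e) E \<phi>))"
proof -
  have "(\<lambda>n. ev M e (case_nat Zero Var n)) = case_nat (zer M) e"
    "\<And>x. (\<lambda>n. ev M (case_nat x e) (case_nat (Plus (Var 0) One) (\<lambda>n. Var (Suc n)) n)) =
      case_nat (add M x (uno M)) e"
    by (auto simp: fun_eq_iff split: nat.split)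
  then show ?thesis unfolding induction_ax_def inst_def by (simp add: sat_subst)
qed

lemma sat_comprehension_ax:
  "sat M e E (comprehension_ax \<phi> \<psi>) \<longleftrightarrow>
    ((\<forall>x\<in>dom M. sat M (case_nat x e) E \<phi> \<longleftrightarrow> sat M (case_nat x e) E \<psi>) \<longrightarrow>
     (\<exists>X\<in>sets M. \<forall>x\<in>dom M. x \<in> X \<longleftrightarrow> sat M (case_nat x e) E \<phi>))"
  by (simp add: comprehension_ax_def shiftS_def sat_subst) blast

lemma std_RCA0: "\<gamma> \<in> RCA0 \<Longrightarrow> models std \<gamma>"
proof -
  have "models std (induction_ax \<phi>)" for \<phi>
    unfolding models_def sat_induction_ax
  proof (intro allI impI ballI)
    fix e :: "nat \<Rightarrow> nat" and E :: "nat \<Rightarrow> nat set" and x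
    assume "sat std (case_nat (zer std) e) E \<phi> \<and>
      (\<forall>x\<in>dom std. sat std (case_nat x e) E \<phi> \<longrightarrow> sat std (case_nat (add std x (uno std)) e) E \<phi>)"
    then show "sat std (case_nat x e) E \<phi>" by (induction x) (auto simp: std_def)
  qed
  moreover have "models std (comprehension_ax \<phi> \<psi>)" for \<phi> \<psi>
    unfolding models_def sat_comprehension_ax
  proof (intro allI impI)
    fix e :: "nat \<Rightarrow> nat" and E :: "nat \<Rightarrow> nat set"
    show "\<exists>X\<in>sets std. \<forall>x\<in>dom std. x \<in> X \<longleftrightarrow> sat std (case_nat x e) E \<phi>"
      by (rule bexI[of _ "{x. sat std (case_nat x e) E \<phi>}"]) (auto simp: std_def)
  qed
  ultimately show "\<gamma> \<in> RCA0 \<Longrightarrow> models std \<gamma>"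
    using std_basic unfolding RCA0_def by (auto simp: models_closure)
qed

lemma RCA0_closed: "\<gamma> \<in> RCA0 \<Longrightarrow> nbound \<gamma> = 0 \<and> sbound \<gamma> = 0"
proof -
  have "\<gamma> \<in> basic_axioms \<Longrightarrow> nbound \<gamma> = 0 \<and> sbound \<gamma> = 0"
    unfolding basic_axioms_def by (auto simp: form_defs)
  then show "\<gamma> \<in> RCA0 \<Longrightarrow> nbound \<gamma> = 0 \<and> sbound \<gamma> = 0"
    unfolding RCA0_def by (auto simp: closure_closed)
qed

definition fence_sentence :: fm where
  "fence_sentence = sentence (\<^bold>\<forall>\<^sub>S L R M J.
    lattice_f L R M J \<^bold>\<and> length_three L R \<^bold>\<and> finitely_generated L M J \<^bold>\<and> infinite_f L \<^bold>\<longrightarrow>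
    long_fences L R)"

lemmas fence_defs = lattice_f_def partial_order_f_def binop_def le_f_def lt_f_def pair_def
  length_three_def finitely_generated_def finite_set_seq_def canonical_code_def codes_set_def
  in_code_def infinite_f_def long_fences_def fence_def seq_of_length_def even_f_def odd_f_def

lemma fence_sentence_closed: "nbound fence_sentence = 0 \<and> sbound fence_sentence = 0"
  by (simp add: fence_sentence_def fence_defs form_defs)

text \<open>Fixing the countermodel as a constant (the standard model, if there is none) lets its numbers form
  a type, so that the arithmetic type classes apply to them.\<close>

definition MM :: "nat model" where
  "MM = (if RCA0 \<turnstile> fence_sentence then std
    else SOME M. wf_model M \<and> (\<forall>\<gamma>\<in>RCA0. models M \<gamma>) \<and> \<not> models M fence_sentence)"

lemma MM_cases:
  "(RCA0 \<turnstile> fence_sentence \<and> MM = std) \<or>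
   (wf_model MM \<and> (\<forall>\<gamma>\<in>RCA0. models MM \<gamma>) \<and> \<not> models MM fence_sentence)"
proof (cases "RCA0 \<turnstile> fence_sentence")
  case False
  from someI_ex[OF completeness[OF RCA0_closed fence_sentence_closed this]] False
  show ?thesis unfolding MM_def by simp
qed (simp add: MM_def)

lemma wf_MM: "wf_model MM"
  using MM_cases wf_std by auto

lemma MM_RCA0: "\<gamma> \<in> RCA0 \<Longrightarrow> models MM \<gamma>"
  using MM_cases std_RCA0 by auto

text \<open>Reduces the theorem to truth in one model: either the sentence is provable anyway, or
  \<open>MM\<close> was chosen to falsify it.\<close>

lemma proves_fence_sentence: "models MM fence_sentence \<Longrightarrow> RCA0 \<turnstile> fence_sentence"
  using MM_cases by auto

section \<open>The numbers of the countermodel as a type\<close>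

typedef mnum = "dom MM"
  using wf_MM unfolding wf_model_def by blast

instantiation mnum :: "{zero, one, plus, times, ord}"
begin

definition "0 = Abs_mnum (zer MM)"
definition "1 = Abs_mnum (uno MM)"
definition "x + y = Abs_mnum (add MM (Rep_mnum x) (Rep_mnum y))"
definition "x * y = Abs_mnum (mul MM (Rep_mnum x) (Rep_mnum y))"
definition "x < y \<longleftrightarrow> les MM (Rep_mnum x) (Rep_mnum y)"
definition "x \<le> y \<longleftrightarrow> x < y \<or> x = (y :: mnum)"

instance ..

end

lemmas mnum_defs = zero_mnum_def one_mnum_def plus_mnum_def times_mnum_def less_mnum_def

definition SS :: "mnum set set" where
  "SS = {X. Rep_mnum ` X \<in> sets MM}"

definition mm :: "mnum model" where
  "mm = \<lparr>dom = UNIV, sets = SS, zer = 0, uno = 1, add = (+), mul = (*), les = (<)\<rparr>"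

lemma mm_simps [simp]:
  "dom mm = UNIV" "sets mm = SS" "zer mm = 0" "uno mm = 1" "add mm = (+)" "mul mm = (*)" "les mm = (<)"
  by (simp_all add: mm_def)

lemma Rep_ops:
  "Rep_mnum 0 = zer MM" "Rep_mnum 1 = uno MM"
  "Rep_mnum (x + y) = add MM (Rep_mnum x) (Rep_mnum y)"
  "Rep_mnum (x * y) = mul MM (Rep_mnum x) (Rep_mnum y)"
  using wf_MM Rep_mnum unfolding wf_model_def mnum_defs by (simp_all add: Abs_mnum_inverse)

lemma ev_mm: "ev MM (\<lambda>n. Rep_mnum (e n)) t = Rep_mnum (ev mm e t)"
  by (induction t) (simp_all add: Rep_ops)

lemma case_nat_fun: "case_nat (f x) (\<lambda>n. f (e n)) = (\<lambda>n. f (case_nat x e n))"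
  by (auto simp: fun_eq_iff split: nat.split)

lemma dom_MM: "dom MM = range Rep_mnum"
  using type_definition.Rep_range[OF type_definition_mnum] by simp

lemma sets_MM: "sets MM = (`) Rep_mnum ` SS"
proof -
  have "X \<in> (`) Rep_mnum ` SS" if "X \<in> sets MM" for X
  proof (rule image_eqI)
    show *: "X = Rep_mnum ` (Rep_mnum -` X)" using that wf_MM unfolding wf_model_def dom_MM by auto
    show "Rep_mnum -` X \<in> SS" unfolding SS_def mem_Collect_eq *[symmetric] by (rule that)
  qed
  then show ?thesis unfolding SS_def by auto
qed

lemma SS_nonempty: "SS \<noteq> {}"
  using wf_MM sets_MM unfolding wf_model_def by auto

lemma sat_mm: "sat MM (\<lambda>n. Rep_mnum (e n)) (\<lambda>X. Rep_mnum ` E X) \<phi> = sat mm e E \<phi>"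
proof (induction \<phi> arbitrary: e E)
  case (Mem t X)
  show ?case by (auto simp: ev_mm Rep_mnum_inject)
next
  case (AllS \<phi>)
  then show ?case by (simp add: sets_MM case_nat_fun[of "(`) Rep_mnum"])
next
  case (ExS \<phi>)
  then show ?case by (simp add: sets_MM case_nat_fun[of "(`) Rep_mnum"])
qed (simp_all add: ev_mm Rep_mnum_inject less_mnum_def dom_MM case_nat_fun)

lemma models_mm: "models MM \<phi> \<longleftrightarrow> (\<forall>e E. range E \<subseteq> SS \<longrightarrow> sat mm e E \<phi>)"
proof
  assume m: "models MM \<phi>"
  show "\<forall>e E. range E \<subseteq> SS \<longrightarrow> sat mm e E \<phi>"
  proof (intro allI impI)
    fix e :: "nat \<Rightarrow> mnum" and E :: "nat \<Rightarrow> mnum set" assume "range E \<subseteq> SS"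
    then have "range (\<lambda>n. Rep_mnum (e n)) \<subseteq> dom MM" "range (\<lambda>X. Rep_mnum ` E X) \<subseteq> sets MM"
      by (auto simp: dom_MM sets_MM)
    then show "sat mm e E \<phi>" using m unfolding models_def sat_mm[symmetric] by blast
  qed
next
  assume s: "\<forall>e E. range E \<subseteq> SS \<longrightarrow> sat mm e E \<phi>"
  show "models MM \<phi>" unfolding models_def
  proof (intro allI impI)
    fix e :: "nat \<Rightarrow> nat" and E :: "nat \<Rightarrow> nat set" assume eE: "range e \<subseteq> dom MM \<and> range E \<subseteq> sets MM"
    then have "\<forall>n. \<exists>x. e n = Rep_mnum x" "\<forall>n. \<exists>X\<in>SS. E n = Rep_mnum ` X"
      unfolding dom_MM sets_MM by blast+
    then obtain e' E' where eE': "\<forall>n. e n = Rep_mnum (e' n)" "\<forall>n. E' n \<in> SS \<and> E n = Rep_mnum ` E' n"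
      unfolding choice_iff Bex_def by blast
    then have "range E' \<subseteq> SS" by auto
    moreover from eE' have "e = (\<lambda>n. Rep_mnum (e' n))" "E = (\<lambda>n. Rep_mnum ` E' n)"
      by (auto simp: fun_eq_iff)
    ultimately show "sat MM e E \<phi>" using s sat_mm by simp
  qed
qed

section \<open>Definable predicates\<close>

text \<open>Predicates and functions on the numbers of the model are treated semantically, as functions of
  an assignment \<open>\<rho>\<close> to the number variables. Quantifiers bind \<open>\<rho> 0\<close>, as in the de Bruijn syntax.\<close>

type_synonym env = "nat \<Rightarrow> mnum"

inductive Tm :: "(env \<Rightarrow> mnum) \<Rightarrow> bool" where
  Tm_var: "Tm (\<lambda>\<rho>. \<rho> i)"
| Tm_const: "Tm (\<lambda>\<rho>. c)"
| Tm_plus: "Tm t \<Longrightarrow> Tm u \<Longrightarrow> Tm (\<lambda>\<rho>. t \<rho> + u \<rho>)"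
| Tm_times: "Tm t \<Longrightarrow> Tm u \<Longrightarrow> Tm (\<lambda>\<rho>. t \<rho> * u \<rho>)"

text \<open>The semantic counterpart of \<open>Delta0\<close> with parameters built in: constants of
  \<open>Tm\<close> are arbitrary elements and \<open>Del_mem\<close> admits any set of the model.
  The bound \<open>t \<rho>\<close> is evaluated outside the scope of the bound variable, as the
  shift in \<open>Delta0\<close> prescribes.\<close>

inductive Del :: "(env \<Rightarrow> bool) \<Rightarrow> bool" where
  Del_eq: "Tm t \<Longrightarrow> Tm u \<Longrightarrow> Del (\<lambda>\<rho>. t \<rho> = u \<rho>)"
| Del_less: "Tm t \<Longrightarrow> Tm u \<Longrightarrow> Del (\<lambda>\<rho>. t \<rho> < u \<rho>)"
| Del_mem: "Tm t \<Longrightarrow> X \<in> SS \<Longrightarrow> Del (\<lambda>\<rho>. t \<rho> \<in> X)"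
| Del_False: "Del (\<lambda>\<rho>. False)"
| Del_imp: "Del P \<Longrightarrow> Del Q \<Longrightarrow> Del (\<lambda>\<rho>. P \<rho> \<longrightarrow> Q \<rho>)"
| Del_conj: "Del P \<Longrightarrow> Del Q \<Longrightarrow> Del (\<lambda>\<rho>. P \<rho> \<and> Q \<rho>)"
| Del_disj: "Del P \<Longrightarrow> Del Q \<Longrightarrow> Del (\<lambda>\<rho>. P \<rho> \<or> Q \<rho>)"
| Del_all': "Del P \<Longrightarrow> Tm t \<Longrightarrow> Del (\<lambda>\<rho>. \<forall>x<t \<rho>. P (case_nat x \<rho>))"
| Del_ex': "Del P \<Longrightarrow> Tm t \<Longrightarrow> Del (\<lambda>\<rho>. \<exists>x<t \<rho>. P (case_nat x \<rho>))"

text \<open>Here the body is a function of the bound variable and the outer environment, the form in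
  which a goal with a bounded quantifier unifies with the rule.\<close>

lemma Del_all: "Del (\<lambda>\<rho>. Q (\<rho> 0) (\<lambda>n. \<rho> (Suc n))) \<Longrightarrow> Tm t \<Longrightarrow> Del (\<lambda>\<rho>. \<forall>x<t \<rho>. Q x \<rho>)"
  by (drule (1) Del_all') simp

lemma Del_ex: "Del (\<lambda>\<rho>. Q (\<rho> 0) (\<lambda>n. \<rho> (Suc n))) \<Longrightarrow> Tm t \<Longrightarrow> Del (\<lambda>\<rho>. \<exists>x<t \<rho>. Q x \<rho>)"
  by (drule (1) Del_ex') simp

lemma Del_not: "Del P \<Longrightarrow> Del (\<lambda>\<rho>. \<not> P \<rho>)"
  using Del_imp[OF _ Del_False] by simp

lemma Del_True: "Del (\<lambda>\<rho>. True)"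
  using Del_not[OF Del_False] by simp

lemma Tm_subst: "Tm t \<Longrightarrow> (\<And>n. Tm (s n)) \<Longrightarrow> Tm (\<lambda>\<rho>. t (\<lambda>n. s n \<rho>))"
  by (induction rule: Tm.induct) (auto intro: Tm.intros)

lemma Tm_lift: "Tm t \<Longrightarrow> Tm (\<lambda>\<rho>. t (\<lambda>n. \<rho> (Suc n)))"
  by (erule Tm_subst) (rule Tm_var)

text \<open>Under a quantifier the substitution is lifted by the semantic version of
  \<open>up\<close>: the bound variable stays and the substituted terms look past it.\<close>

lemma Del_subst: "Del P \<Longrightarrow> (\<And>n. Tm (s n)) \<Longrightarrow> Del (\<lambda>\<rho>. P (\<lambda>n. s n \<rho>))"
proof (induction arbitrary: s rule: Del.induct)
  case (Del_all' P t)
  let ?s = "case_nat (\<lambda>\<rho>. \<rho> 0) (\<lambda>n \<rho>. s n (\<lambda>n. \<rho> (Suc n)))"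
  have "Tm (?s n)" for n using Del_all'.prems by (auto intro: Tm_var Tm_lift split: nat.split)
  then have "Del (\<lambda>\<rho>. P (\<lambda>n. ?s n \<rho>))" by (rule Del_all'.IH)
  moreover have "(\<lambda>n. ?s n (case_nat x \<rho>)) = case_nat x (\<lambda>n. s n \<rho>)" for x \<rho>
    by (auto simp: fun_eq_iff split: nat.split)
  ultimately show ?case
    using Del.Del_all'[OF _ Tm_subst[OF Del_all'.hyps(2) Del_all'.prems], of "\<lambda>\<rho>. P (\<lambda>n. ?s n \<rho>)"]
    by simp
next
  case (Del_ex' P t)
  let ?s = "case_nat (\<lambda>\<rho>. \<rho> 0) (\<lambda>n \<rho>. s n (\<lambda>n. \<rho> (Suc n)))"
  have "Tm (?s n)" for n using Del_ex'.prems by (auto intro: Tm_var Tm_lift split: nat.split)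
  then have "Del (\<lambda>\<rho>. P (\<lambda>n. ?s n \<rho>))" by (rule Del_ex'.IH)
  moreover have "(\<lambda>n. ?s n (case_nat x \<rho>)) = case_nat x (\<lambda>n. s n \<rho>)" for x \<rho>
    by (auto simp: fun_eq_iff split: nat.split)
  ultimately show ?case
    using Del.Del_ex'[OF _ Tm_subst[OF Del_ex'.hyps(2) Del_ex'.prems], of "\<lambda>\<rho>. P (\<lambda>n. ?s n \<rho>)"]
    by simp
next
  case (Del_eq t u)
  from Tm_subst[OF this(1,3)] Tm_subst[OF this(2,3)] show ?case by (rule Del.Del_eq)
next
  case (Del_less t u)
  from Tm_subst[OF this(1,3)] Tm_subst[OF this(2,3)] show ?case by (rule Del.Del_less)
next
  case (Del_mem t X)
  from Tm_subst[OF this(1,3)] this(2) show ?case by (rule Del.Del_mem)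
next
  case Del_False
  show ?case by (rule Del.Del_False)
next
  case (Del_imp P Q)
  from this(3,4)[OF this(5)] show ?case by (rule Del.Del_imp)
next
  case (Del_conj P Q)
  from this(3,4)[OF this(5)] show ?case by (rule Del.Del_conj)
next
  case (Del_disj P Q)
  from this(3,4)[OF this(5)] show ?case by (rule Del.Del_disj)
qed

section \<open>From semantic bounded predicates back to formulas\<close>

definition extend :: "nat \<Rightarrow> env \<Rightarrow> env \<Rightarrow> env" where
  "extend n e \<rho> = (\<lambda>i. if i < n then \<rho> i else e (i - n))"

lemma extend_Suc: "extend (Suc n) e (case_nat x \<rho>) = case_nat x (extend n e \<rho>)"
  by (auto simp: extend_def fun_eq_iff split: nat.split)

text \<open>Parameters are supplied by the part of the environment from position \<open>n\<close> on. Asking for a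
  formula for every list of parameters that contains the needed ones lets subformulas be combined
  without renaming.\<close>

definition tm_representable :: "mnum set \<Rightarrow> nat \<Rightarrow> (env \<Rightarrow> mnum) \<Rightarrow> bool" where
  "tm_representable A m t \<longleftrightarrow>
    finite A \<and> (\<forall>n\<ge>m. \<forall>e. A \<subseteq> range e \<longrightarrow> (\<exists>u. \<forall>\<rho>. ev mm (extend n e \<rho>) u = t \<rho>))"

lemma tm_representableD:
  "tm_representable A m t \<Longrightarrow> m \<le> n \<Longrightarrow> A \<subseteq> range e \<Longrightarrow> \<exists>u. \<forall>\<rho>. ev mm (extend n e \<rho>) u = t \<rho>"
  "tm_representable A m t \<Longrightarrow> finite A"
  by (simp_all add: tm_representable_def)

lemma tm_representable_binary:
  assumes "tm_representable A m t" "tm_representable A' m' u"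
    and r: "\<And>e v w. \<exists>z. ev mm e z = f (ev mm e v) (ev mm e w) \<and> z = g v w"
  shows "tm_representable (A \<union> A') (max m m') (\<lambda>\<rho>. f (t \<rho>) (u \<rho>))"
  unfolding tm_representable_def
proof (intro conjI allI impI)
  show "finite (A \<union> A')" using assms tm_representableD(2) by blast
  fix n e assume a: "max m m' \<le> n" "A \<union> A' \<subseteq> range (e :: env)"
  obtain v where v: "\<And>\<rho>. ev mm (extend n e \<rho>) v = t \<rho>"
    using tm_representableD(1)[OF assms(1), of n e] a by auto
  obtain w where w: "\<And>\<rho>. ev mm (extend n e \<rho>) w = u \<rho>"
    using tm_representableD(1)[OF assms(2), of n e] a by auto
  have "ev mm (extend n e \<rho>) (g v w) = f (t \<rho>) (u \<rho>)" for \<rho>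
    using r[of "extend n e \<rho>" v w] v w by simp
  then show "\<exists>z. \<forall>\<rho>. ev mm (extend n e \<rho>) z = f (t \<rho>) (u \<rho>)" by blast
qed

lemma Tm_representable: "Tm t \<Longrightarrow> \<exists>A m. tm_representable A m t"
proof (induction rule: Tm.induct)
  case (Tm_var i)
  have "tm_representable {} (Suc i) (\<lambda>\<rho>. \<rho> i)"
    unfolding tm_representable_def by (auto intro!: exI[of _ "Var i"] simp: extend_def)
  then show ?case by blast
next
  case (Tm_const c)
  have "tm_representable {c} 0 (\<lambda>\<rho>. c)"
    unfolding tm_representable_def
  proof (intro conjI allI impI)
    fix n e assume "{c} \<subseteq> range (e :: env)"
    then obtain k where "e k = c" by auto
    then show "\<exists>u. \<forall>\<rho>. ev mm (extend n e \<rho>) u = c"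
      by (auto intro!: exI[of _ "Var (n + k)"] simp: extend_def)
  qed simp
  then show ?case by blast
next
  case (Tm_plus t u)
  then show ?case using tm_representable_binary[of _ _ t _ _ u "(+)" Plus] by simp blast
next
  case (Tm_times t u)
  then show ?case using tm_representable_binary[of _ _ t _ _ u "(*)" Times] by simp blast
qed

definition represents :: "nat \<Rightarrow> env \<Rightarrow> (nat \<Rightarrow> mnum set) \<Rightarrow> fm \<Rightarrow> (env \<Rightarrow> bool) \<Rightarrow> bool" where
  "represents n e E \<phi> P \<longleftrightarrow> Delta0 \<phi> \<and> (\<forall>\<rho>. sat mm (extend n e \<rho>) E \<phi> = P \<rho>)"

definition representable :: "mnum set \<Rightarrow> mnum set set \<Rightarrow> nat \<Rightarrow> (env \<Rightarrow> bool) \<Rightarrow> bool" where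
  "representable A B m P \<longleftrightarrow> finite A \<and> finite B \<and> B \<subseteq> SS \<and>
    (\<forall>n e E. m \<le> n \<longrightarrow> A \<subseteq> range e \<longrightarrow> B \<subseteq> range E \<longrightarrow> (\<exists>\<phi>. represents n e E \<phi> P))"

lemma representableD:
  "representable A B m P \<Longrightarrow> m \<le> n \<Longrightarrow> A \<subseteq> range e \<Longrightarrow> B \<subseteq> range E \<Longrightarrow> \<exists>\<phi>. represents n e E \<phi> P"
  "representable A B m P \<Longrightarrow> finite A \<and> finite B \<and> B \<subseteq> SS"
  by (simp_all add: representable_def)

lemma representable_atom:
  assumes t: "Tm t" and u: "Tm u" and B: "finite B" "B \<subseteq> SS"
    and r: "\<And>n e E v w. B \<subseteq> range E \<Longrightarrow> (\<And>\<rho>. ev mm (extend n e \<rho>) v = t \<rho>) \<Longrightarrow>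
      (\<And>\<rho>. ev mm (extend n e \<rho>) w = u \<rho>) \<Longrightarrow> \<exists>\<phi>. represents n e E \<phi> P"
  shows "\<exists>A m. representable A B m P"
proof -
  from Tm_representable[OF t] Tm_representable[OF u] obtain A m A' m'
    where *: "tm_representable A m t" "tm_representable A' m' u" by blast
  show ?thesis unfolding representable_def
  proof (rule exI[of _ "A \<union> A'"], rule exI[of _ "max m m'"], intro conjI allI impI)
    fix n e E assume "max m m' \<le> n" "A \<union> A' \<subseteq> range (e :: env)" "B \<subseteq> range (E :: nat \<Rightarrow> mnum set)"
    then obtain v w where "\<forall>\<rho>. ev mm (extend n e \<rho>) v = t \<rho>" "\<forall>\<rho>. ev mm (extend n e \<rho>) w = u \<rho>"
      using tm_representableD(1)[OF *(1), of n e] tm_representableD(1)[OF *(2), of n e] by auto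
    then show "\<exists>\<phi>. represents n e E \<phi> P" using r[OF \<open>B \<subseteq> range E\<close>, of n e v w] by blast
  qed (use tm_representableD(2)[OF *(1)] tm_representableD(2)[OF *(2)] B in simp_all)
qed

lemma representable_binary:
  assumes "representable A B m P" "representable A' B' m' Q"
    and r: "\<And>n e E \<phi> \<psi>. represents n e E \<phi> P \<Longrightarrow> represents n e E \<psi> Q \<Longrightarrow> \<exists>\<chi>. represents n e E \<chi> R"
  shows "representable (A \<union> A') (B \<union> B') (max m m') R"
  unfolding representable_def
proof (intro conjI allI impI)
  fix n e E assume a: "max m m' \<le> n" "A \<union> A' \<subseteq> range (e :: env)" "B \<union> B' \<subseteq> range (E :: nat \<Rightarrow> mnum set)"
  obtain \<phi> \<psi> where "represents n e E \<phi> P" "represents n e E \<psi> Q"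
    using representableD(1)[OF assms(1), of n e E] representableD(1)[OF assms(2), of n e E] a by auto
  then show "\<exists>\<chi>. represents n e E \<chi> R" by (rule r)
qed (use assms(1,2) in \<open>auto simp: representable_def\<close>)

text \<open>The body has one local variable more. Since representability gives a formula for every
  \<open>n\<close> above the threshold, the same parameter list serves at
  \<open>Suc n\<close>.\<close>

lemma representable_quantifier:
  assumes P: "representable A B m P" and t: "Tm t"
    and r: "\<And>n e E \<phi> v. represents (Suc n) e E \<phi> P \<Longrightarrow> (\<And>\<rho>. ev mm (extend n e \<rho>) v = t \<rho>) \<Longrightarrow>
      \<exists>\<chi>. represents n e E \<chi> Q"
  shows "\<exists>A m. representable A B m Q"
proof -
  from Tm_representable[OF t] obtain A' m' where *: "tm_representable A' m' t" by blast
  show ?thesis unfolding representable_def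
  proof (rule exI[of _ "A \<union> A'"], rule exI[of _ "max m m'"], intro conjI allI impI)
    fix n e E assume a: "max m m' \<le> n" "A \<union> A' \<subseteq> range (e :: env)" "B \<subseteq> range (E :: nat \<Rightarrow> mnum set)"
    obtain \<phi> where "represents (Suc n) e E \<phi> P" using representableD(1)[OF P, of "Suc n" e E] a by auto
    moreover obtain v where "\<And>\<rho>. ev mm (extend n e \<rho>) v = t \<rho>"
        using tm_representableD(1)[OF *, of n e] a by auto
    ultimately show "\<exists>\<chi>. represents n e E \<chi> Q" by (rule r)
  qed (use tm_representableD(2)[OF *] P in \<open>simp_all add: representable_def\<close>)
qed

lemma ev_shift_tm: "ev M (case_nat x e) (shift_tm t) = ev M e t"
  by (simp add: shift_tm_def ev_subst)

lemma sat_extend_Suc: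
  "represents (Suc n) e E \<phi> P \<Longrightarrow> sat mm (case_nat x (extend n e \<rho>)) E \<phi> = P (case_nat x \<rho>)"
  by (simp add: represents_def flip: extend_Suc)

lemma Del_representable: "Del P \<Longrightarrow> \<exists>A B m. representable A B m P"
proof (induction rule: Del.induct)
  case (Del_eq t u)
  have "\<exists>A m. representable A {} m (\<lambda>\<rho>. t \<rho> = u \<rho>)"
    by (rule representable_atom[OF Del_eq], auto)
      (rule_tac x="Eq v w" in exI, auto simp: represents_def intro: Delta0.intros)
  then show ?case by blast
next
  case (Del_less t u)
  have "\<exists>A m. representable A {} m (\<lambda>\<rho>. t \<rho> < u \<rho>)"
    by (rule representable_atom[OF Del_less], auto)
      (rule_tac x="Less v w" in exI, auto simp: represents_def intro: Delta0.intros)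
  then show ?case by blast
next
  case (Del_mem t X)
  have "\<exists>\<phi>. represents n e E \<phi> (\<lambda>\<rho>. t \<rho> \<in> X)"
    if "{X} \<subseteq> range E" "\<And>\<rho>. ev mm (extend n e \<rho>) v = t \<rho>" for n e E v
  proof -
    from that(1) obtain Y where "E Y = X" by auto
    then have "represents n e E (Mem v Y) (\<lambda>\<rho>. t \<rho> \<in> X)"
      using that(2) by (simp add: represents_def Delta0.intros)
    then show ?thesis by blast
  qed
  then have "\<exists>A m. representable A {X} m (\<lambda>\<rho>. t \<rho> \<in> X)"
    using Del_mem by (intro representable_atom[OF Del_mem(1) Del_mem(1)]) blast+
  then show ?case by blast
next
  case Del_False
  have "represents n e E Fls (\<lambda>\<rho>. False)" for n e E by (simp add: represents_def Delta0.intros)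
  then have "representable {} {} 0 (\<lambda>\<rho>. False)" unfolding representable_def by blast
  then show ?case by blast
next
  case (Del_imp P Q)
  then obtain A B m A' B' m' where *: "representable A B m P" "representable A' B' m' Q" by blast
  have "\<exists>\<chi>. represents n e E \<chi> (\<lambda>\<rho>. P \<rho> \<longrightarrow> Q \<rho>)"
    if "represents n e E \<phi> P" "represents n e E \<psi> Q" for n e E \<phi> \<psi>
    using that by (intro exI[of _ "Imp \<phi> \<psi>"]) (simp add: represents_def Delta0.intros)
  then show ?case by (intro exI) (rule representable_binary[OF *])
next
  case (Del_conj P Q)
  then obtain A B m A' B' m' where *: "representable A B m P" "representable A' B' m' Q" by blast
  have "\<exists>\<chi>. represents n e E \<chi> (\<lambda>\<rho>. P \<rho> \<and> Q \<rho>)"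
    if "represents n e E \<phi> P" "represents n e E \<psi> Q" for n e E \<phi> \<psi>
    using that by (intro exI[of _ "Con \<phi> \<psi>"]) (simp add: represents_def Delta0.intros)
  then show ?case by (intro exI) (rule representable_binary[OF *])
next
  case (Del_disj P Q)
  then obtain A B m A' B' m' where *: "representable A B m P" "representable A' B' m' Q" by blast
  have "\<exists>\<chi>. represents n e E \<chi> (\<lambda>\<rho>. P \<rho> \<or> Q \<rho>)"
    if "represents n e E \<phi> P" "represents n e E \<psi> Q" for n e E \<phi> \<psi>
    using that by (intro exI[of _ "Dis \<phi> \<psi>"]) (simp add: represents_def Delta0.intros)
  then show ?case by (intro exI) (rule representable_binary[OF *])
next
  case (Del_all' P t)
  then obtain A B m where *: "representable A B m P" by blast
  have "\<exists>\<chi>. represents n e E \<chi> (\<lambda>\<rho>. \<forall>x<t \<rho>. P (case_nat x \<rho>))"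
    if "represents (Suc n) e E \<phi> P" "\<And>\<rho>. ev mm (extend n e \<rho>) v = t \<rho>" for n e E \<phi> v
    using that(2) sat_extend_Suc[OF that(1)] that(1)[unfolded represents_def]
    by (intro exI[of _ "All (Imp (Less (Var 0) (shift_tm v)) \<phi>)"])
      (simp add: represents_def Delta0.intros ev_shift_tm)
  then have "\<exists>A m. representable A B m (\<lambda>\<rho>. \<forall>x<t \<rho>. P (case_nat x \<rho>))"
    by (rule representable_quantifier[OF * Del_all'.hyps(2)])
  then show ?case by blast
next
  case (Del_ex' P t)
  then obtain A B m where *: "representable A B m P" by blast
  have "\<exists>\<chi>. represents n e E \<chi> (\<lambda>\<rho>. \<exists>x<t \<rho>. P (case_nat x \<rho>))"
    if "represents (Suc n) e E \<phi> P" "\<And>\<rho>. ev mm (extend n e \<rho>) v = t \<rho>" for n e E \<phi> v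
    using that(2) sat_extend_Suc[OF that(1)] that(1)[unfolded represents_def]
    by (intro exI[of _ "Ex (Con (Less (Var 0) (shift_tm v)) \<phi>)"])
      (simp add: represents_def Delta0.intros ev_shift_tm)
  then have "\<exists>A m. representable A B m (\<lambda>\<rho>. \<exists>x<t \<rho>. P (case_nat x \<rho>))"
    by (rule representable_quantifier[OF * Del_ex'.hyps(2)])
  then show ?case by blast
qed

section \<open>Sigma-1 predicates and their induction principle\<close>

definition SIG :: "(env \<Rightarrow> bool) \<Rightarrow> bool" where
  "SIG P \<longleftrightarrow> (\<exists>Q. Del Q \<and> P = (\<lambda>\<rho>. \<exists>x. Q (case_nat x \<rho>)))"

lemma finite_subset_range:
  assumes "finite A" "A \<subseteq> C" "C \<noteq> {}"
  shows "\<exists>e :: nat \<Rightarrow> 'a. A \<subseteq> range e \<and> range e \<subseteq> C"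
proof -
  from assms(1) obtain xs where xs: "set xs = A" using finite_list by blast
  from assms(3) obtain c where c: "c \<in> C" by blast
  let ?e = "\<lambda>i. if i < length xs then xs ! i else c"
  have "A \<subseteq> range ?e"
  proof
    fix x assume "x \<in> A"
    then obtain i where "i < length xs" "x = xs ! i" using xs by (metis in_set_conv_nth)
    then have "x = ?e i" by simp
    then show "x \<in> range ?e" by blast
  qed
  moreover have "range ?e \<subseteq> C" using assms(2) c xs by auto
  ultimately show ?thesis by blast
qed

lemma case_nat_extend:
  "case_nat y (\<lambda>i. extend (Suc n) e \<rho> (Suc i)) = extend (Suc n) e (case_nat y (\<lambda>i. \<rho> (Suc i)))"
  by (auto simp: extend_def fun_eq_iff split: nat.split)

text \<open>The gateway to the axioms: the represented matrix yields an instance of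
  \<open>induction_ax\<close> whose parameters are the values of \<open>e\<close> and
  \<open>E\<close>, and its closure is an axiom.\<close>

lemma sigma_induct:
  assumes S: "SIG (\<lambda>\<rho>. p (\<rho> 0))" and "p 0" and "\<And>x. p x \<Longrightarrow> p (x + 1)"
  shows "p x"
proof -
  from S obtain Q where Q: "Del Q" "(\<lambda>\<rho>. p (\<rho> 0)) = (\<lambda>\<rho>. \<exists>x. Q (case_nat x \<rho>))"
    unfolding SIG_def by blast
  from Del_representable[OF Q(1)] obtain A B m where r: "representable A B m Q" by blast
  note f = representableD(2)[OF r]
  obtain e :: env where e: "A \<subseteq> range e" using f finite_subset_range[of A UNIV] by auto
  obtain E :: "nat \<Rightarrow> mnum set" where E: "B \<subseteq> range E" "range E \<subseteq> SS"
    using finite_subset_range[of B SS] f SS_nonempty by blast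
  \<comment> \<open>Two positions are reserved beyond the threshold: the existential witness (index
    0) and the induction variable (index 1).\<close>
  obtain \<theta> where \<theta>: "represents (Suc (Suc m)) e E \<theta> Q"
    using representableD(1)[OF r _ e E(1), of "Suc (Suc m)"] by auto
  let ?e = "\<lambda>i. extend (Suc m) e (\<lambda>_. 0) (Suc i)"
  have "sat mm (case_nat y ?e) E (Ex \<theta>) \<longleftrightarrow> p y" for y
  proof -
    have "sat mm (case_nat y ?e) E (Ex \<theta>) \<longleftrightarrow> (\<exists>x. Q (case_nat x (case_nat y (\<lambda>i. 0))))"
      unfolding case_nat_extend by (simp add: sat_extend_Suc[OF \<theta>])
    also have "\<dots> \<longleftrightarrow> p y" using fun_cong[OF Q(2), of "case_nat y (\<lambda>i. 0)"] by simp
    finally show ?thesis .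
  qed
  moreover have "sat mm ?e E (induction_ax (Ex \<theta>))"
  proof -
    have "Sigma1 (Ex \<theta>)" using \<theta> unfolding represents_def Sigma1_def by blast
    then have "closure (induction_ax (Ex \<theta>)) \<in> RCA0" unfolding RCA0_def by blast
    then show ?thesis using MM_RCA0 models_closure models_mm E(2) by blast
  qed
  ultimately show "p x" using assms(2,3) unfolding sat_induction_ax by simp
qed

lemma Del_lift: "Del P \<Longrightarrow> Del (\<lambda>\<rho>. P (\<lambda>n. \<rho> (Suc n)))"
  by (erule Del_subst) (rule Tm_var)

lemma SIG_Del: "Del P \<Longrightarrow> SIG P"
  unfolding SIG_def by (rule exI[of _ "\<lambda>\<rho>. P (\<lambda>n. \<rho> (Suc n))"]) (simp add: Del_lift)

lemma SIG_exDel: "Del (\<lambda>\<rho>. Q (\<rho> 0) (\<lambda>n. \<rho> (Suc n))) \<Longrightarrow> SIG (\<lambda>\<rho>. \<exists>x. Q x \<rho>)"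
  unfolding SIG_def by (rule exI[of _ "\<lambda>\<rho>. Q (\<rho> 0) (\<lambda>n. \<rho> (Suc n))"]) simp

lemmas Tm_intros = Tm_var Tm_const Tm_plus Tm_times
lemmas Del_intros = Del_eq Del_less Del_mem Del_False Del_True Del_not Del_conj Del_disj Del_imp
    Del_all Del_ex

section \<open>Arithmetic in the model\<close>

lemma basic_axiom_mm: "\<gamma> \<in> basic_axioms \<Longrightarrow> sat mm e (\<lambda>_. SOME X. X \<in> SS) \<gamma>"
proof -
  assume "\<gamma> \<in> basic_axioms"
  then have "models MM \<gamma>" by (intro MM_RCA0) (simp add: RCA0_def)
  moreover have "range (\<lambda>_::nat. SOME X. X \<in> SS) \<subseteq> SS" using SS_nonempty by (auto intro: someI)
  ultimately show ?thesis unfolding models_mm by blast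
qed

lemma mnum_basic:
  fixes m n :: mnum
  shows m_Suc_neq: "n + 1 \<noteq> 0"
    and m_Suc_inj: "m + 1 = n + 1 \<Longrightarrow> m = n"
    and m_add_0: "m + 0 = m"
    and m_add_Suc: "m + (n + 1) = (m + n) + 1"
    and m_mult_0: "m * 0 = 0"
    and m_mult_Suc: "m * (n + 1) = m * n + m"
    and m_less_0: "\<not> m < 0"
    and m_less_Suc: "m < n + 1 \<longleftrightarrow> m < n \<or> m = n"
proof -
  have "\<forall>\<gamma>\<in>basic_axioms. sat mm (\<lambda>_. 0) (\<lambda>_. SOME X. X \<in> SS) \<gamma>"
    using basic_axiom_mm by blast
  then have *: "(\<forall>n::mnum. n + 1 \<noteq> 0) \<and> (\<forall>m n::mnum. m + 1 = n + 1 \<longrightarrow> m = n) \<and> (\<forall>m::mnum. m + 0 = m) \<and>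
    (\<forall>m n::mnum. m + (n + 1) = (m + n) + 1) \<and> (\<forall>m::mnum. m * 0 = 0) \<and>
    (\<forall>m n::mnum. m * (n + 1) = m * n + m) \<and> (\<forall>m::mnum. \<not> m < 0) \<and>
    (\<forall>m n::mnum. (m < n + 1 \<longrightarrow> m < n \<or> m = n) \<and> (m < n \<or> m = n \<longrightarrow> m < n + 1))"
    unfolding basic_axioms_def ball_simps by (simp only: form_defs sat.simps ev.simps mm_simps ball_UNIV
      nat.case diff_Suc_Suc minus_nat.diff_0 diff_0_eq_0 diff_self_eq_0 One_nat_def) simp
  note c1 = * [THEN conjunct2] note c2 = c1[THEN conjunct2] note c3 = c2[THEN conjunct2]
  note c4 = c3[THEN conjunct2] note c5 = c4[THEN conjunct2] note c6 = c5[THEN conjunct2]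
  show "n + 1 \<noteq> 0" by (rule *[THEN conjunct1, rule_format])
  show "m + 1 = n + 1 \<Longrightarrow> m = n" by (rule c1[THEN conjunct1, rule_format])
  show "m + 0 = m" by (rule c2[THEN conjunct1, rule_format])
  show "m + (n + 1) = (m + n) + 1" by (rule c3[THEN conjunct1, rule_format])
  show "m * 0 = 0" by (rule c4[THEN conjunct1, rule_format])
  show "m * (n + 1) = m * n + m" by (rule c5[THEN conjunct1, rule_format])
  show "\<not> m < 0" by (rule c6[THEN conjunct1, rule_format])
  show "m < n + 1 \<longleftrightarrow> m < n \<or> m = n"
    using c6[THEN conjunct2, THEN spec, THEN spec, of m n] by (simp only: iff_conv_conj_imp)
qed

lemma delta_induct:
  assumes "Del (\<lambda>\<rho>. p (\<rho> 0))" "p 0" "\<And>x. p x \<Longrightarrow> p (x + 1)"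
  shows "p x"
  using sigma_induct[of p x, OF SIG_Del[OF assms(1)] assms(2,3)] .

lemma m_add_assoc: "(a + b) + c = a + (b + (c :: mnum))"
proof (rule delta_induct[where p = "\<lambda>c. (a + b) + c = a + (b + c)"])
  show "Del (\<lambda>\<rho>. a + b + \<rho> 0 = a + (b + \<rho> 0))" by (intro Del_intros Tm_intros)
qed (simp_all add: m_add_0 m_add_Suc)

lemma m_0_add: "0 + a = (a :: mnum)"
proof (rule delta_induct[where p = "\<lambda>a. 0 + a = a"])
  show "Del (\<lambda>\<rho>. 0 + \<rho> 0 = \<rho> 0)" by (intro Del_intros Tm_intros)
qed (simp_all add: m_add_0 m_add_Suc)

lemma m_1_add: "1 + a = a + (1 :: mnum)"
proof (rule delta_induct[where p = "\<lambda>a. 1 + a = a + 1"])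
  show "Del (\<lambda>\<rho>. 1 + \<rho> 0 = \<rho> 0 + 1)" by (intro Del_intros Tm_intros)
qed (simp_all add: m_add_0 m_0_add m_add_Suc)

lemma m_add_comm: "a + b = b + (a :: mnum)"
proof (rule delta_induct[where p = "\<lambda>b. a + b = b + a"])
  show "Del (\<lambda>\<rho>. a + \<rho> 0 = \<rho> 0 + a)" by (intro Del_intros Tm_intros)
  show "a + (x + 1) = x + 1 + a" if "a + x = x + a" for x
  proof -
    have "a + (x + 1) = x + (a + 1)" using that by (simp add: m_add_Suc)
    also have "\<dots> = x + 1 + a" by (simp only: m_add_assoc m_1_add[of a])
    finally show ?thesis .
  qed
qed (simp_all add: m_add_0 m_0_add)

lemma m_add_left_comm: "a + (b + c) = b + (a + (c :: mnum))"
  by (metis m_add_assoc m_add_comm)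

lemmas m_add_ac = m_add_assoc m_add_comm m_add_left_comm

lemma m_distrib: "a * (b + c) = a * b + a * (c :: mnum)"
proof (rule delta_induct[where p = "\<lambda>c. a * (b + c) = a * b + a * c"])
  show "Del (\<lambda>\<rho>. a * (b + \<rho> 0) = a * b + a * \<rho> 0)" by (intro Del_intros Tm_intros)
  show "a * (b + (x + 1)) = a * b + a * (x + 1)" if "a * (b + x) = a * b + a * x" for x
    by (simp only: m_add_Suc m_mult_Suc that) (simp only: m_add_assoc)
qed (simp add: m_add_0 m_mult_0)

lemma m_mult_1: "a * 1 = (a :: mnum)"
  using m_mult_Suc[of a 0] by (simp add: m_mult_0 m_0_add)

lemma m_mult_assoc: "(a * b) * c = a * (b * (c :: mnum))"
proof (rule delta_induct[where p = "\<lambda>c. (a * b) * c = a * (b * c)"])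
  show "Del (\<lambda>\<rho>. a * b * \<rho> 0 = a * (b * \<rho> 0))" by (intro Del_intros Tm_intros)
qed (simp_all add: m_mult_0 m_distrib m_mult_1)

lemma m_0_mult: "0 * a = (0 :: mnum)"
proof (rule delta_induct[where p = "\<lambda>a. 0 * a = 0"])
  show "Del (\<lambda>\<rho>. 0 * \<rho> 0 = 0)" by (intro Del_intros Tm_intros)
qed (simp_all add: m_add_0 m_mult_0 m_mult_Suc)

lemma m_1_mult: "1 * a = (a :: mnum)"
proof (rule delta_induct[where p = "\<lambda>a. 1 * a = a"])
  show "Del (\<lambda>\<rho>. 1 * \<rho> 0 = \<rho> 0)" by (intro Del_intros Tm_intros)
qed (simp_all add: m_mult_0 m_mult_Suc)

lemma m_Suc_mult: "(a + 1) * b = a * b + (b :: mnum)"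
proof (rule delta_induct[where p = "\<lambda>b. (a + 1) * b = a * b + b"])
  show "Del (\<lambda>\<rho>. (a + 1) * \<rho> 0 = a * \<rho> 0 + \<rho> 0)" by (intro Del_intros Tm_intros)
qed (simp_all add: m_mult_0 m_mult_Suc m_add_0 m_add_ac)

lemma m_mult_comm: "a * b = b * (a :: mnum)"
proof (rule delta_induct[where p = "\<lambda>b. a * b = b * a"])
  show "Del (\<lambda>\<rho>. a * \<rho> 0 = \<rho> 0 * a)" by (intro Del_intros Tm_intros)
qed (simp_all add: m_mult_0 m_0_mult m_mult_Suc m_Suc_mult)

lemma m_add_cancel:
  assumes "a + c = b + c"
  shows "a = (b :: mnum)"
proof -
  have "a + c = b + c \<longrightarrow> a = b"
  proof (rule delta_induct[where p = "\<lambda>c. a + c = b + c \<longrightarrow> a = b"])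
    show "Del (\<lambda>\<rho>. a + \<rho> 0 = b + \<rho> 0 \<longrightarrow> a = b)" by (intro Del_intros Tm_intros)
    show "a + (x + 1) = b + (x + 1) \<longrightarrow> a = b" if "a + x = b + x \<longrightarrow> a = b" for x
      unfolding m_add_Suc using that m_Suc_inj by blast
  qed (simp add: m_add_0)
  with assms show ?thesis by blast
qed

lemma m_zero_or_Suc: "a = 0 \<or> (\<exists>b. a = b + (1 :: mnum))"
proof -
  have "\<exists>b. a = 0 \<or> a = b + 1"
  proof (rule sigma_induct[where p = "\<lambda>a. \<exists>b. a = 0 \<or> a = b + 1"])
    show "SIG (\<lambda>\<rho>. \<exists>b. \<rho> 0 = 0 \<or> \<rho> 0 = b + 1)" by (intro SIG_exDel Del_intros Tm_intros)
  qed blast+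
  then show ?thesis by blast
qed

lemma m_less_add: "a < a + z + (1 :: mnum)"
proof (rule delta_induct[where p = "\<lambda>z. a < a + z + 1"])
  show "Del (\<lambda>\<rho>. a < a + \<rho> 0 + 1)" by (intro Del_intros Tm_intros)
  show "a < a + (x + 1) + 1" if "a < a + x + 1" for x
    using that m_less_Suc[of a "a + x + 1"] by (simp add: m_add_assoc)
qed (simp add: m_add_0 m_less_Suc)

lemma m_less_iff: "a < b \<longleftrightarrow> (\<exists>z. b = a + z + (1 :: mnum))"
proof
  \<comment> \<open>The implication is written as a disjunction under the quantifier, which makes it
    visibly Sigma-1.\<close>
  have "\<exists>z. \<not> a < b \<or> b = a + z + 1"
  proof (rule sigma_induct[where p = "\<lambda>b. \<exists>z. \<not> a < b \<or> b = a + z + 1"])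
    show "SIG (\<lambda>\<rho>. \<exists>z. \<not> a < \<rho> 0 \<or> \<rho> 0 = a + z + 1)" by (intro SIG_exDel Del_intros Tm_intros)
    show "\<exists>z. \<not> a < 0 \<or> 0 = a + z + 1" using m_less_0 by blast
    show "\<exists>z. \<not> a < x + 1 \<or> x + 1 = a + z + 1" if "\<exists>z. \<not> a < x \<or> x = a + z + 1" for x
      using that m_less_Suc[of a x] m_add_0[of x] m_add_assoc by metis
  qed
  then show "a < b \<Longrightarrow> \<exists>z. b = a + z + 1" by blast
qed (use m_less_add in blast)

lemma m_irrefl: "\<not> a < (a :: mnum)"
proof
  assume "a < a"
  then obtain z where "a = a + z + 1" unfolding m_less_iff by blast
  then have "0 + a = (z + 1) + a" by (simp add: m_0_add m_add_ac)
  then show False using m_add_cancel m_Suc_neq by metis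
qed

lemma m_trans: "a < b \<Longrightarrow> b < c \<Longrightarrow> a < (c :: mnum)"
proof -
  assume "a < b" "b < c"
  then obtain x y where "b = a + x + 1" "c = b + y + 1" unfolding m_less_iff by blast
  then have "c = a + (x + 1 + y) + 1" by (simp add: m_add_assoc)
  then show ?thesis unfolding m_less_iff by blast
qed

lemma m_linear: "a < b \<or> a = b \<or> b < (a :: mnum)"
proof (rule delta_induct[where p = "\<lambda>b. a < b \<or> a = b \<or> b < a"])
  show "Del (\<lambda>\<rho>. a < \<rho> 0 \<or> a = \<rho> 0 \<or> \<rho> 0 < a)" by (intro Del_intros Tm_intros)
  show "a < 0 \<or> a = 0 \<or> 0 < a"
    using m_zero_or_Suc[of a] m_less_iff[of 0 a] by (auto simp: m_0_add)
  show "a < x + 1 \<or> a = x + 1 \<or> x + 1 < a" if "a < x \<or> a = x \<or> x < a" for x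
  proof -
    consider "a < x \<or> a = x" | "x < a" using \<open>a < x \<or> a = x \<or> x < a\<close> by blast
    then show ?thesis
    proof cases
      case 2
      then obtain z where z: "a = x + z + 1" unfolding m_less_iff by blast
      show ?thesis
      proof (cases "z = 0")
        case True then show ?thesis using z by (simp add: m_add_0)
      next
        case False
        then obtain w where "z = w + 1" using m_zero_or_Suc by blast
        then have "a = (x + 1) + w + 1" using z by (simp add: m_add_ac)
        then show ?thesis unfolding m_less_iff by blast
      qed
    qed (simp add: m_less_Suc)
  qed
qed

section \<open>Order and truncated subtraction in the model\<close>

instance mnum :: linorder
proof
  fix x y z :: mnum
  show "(x < y) = (x \<le> y \<and> \<not> y \<le> x)"
    unfolding less_eq_mnum_def using m_irrefl m_trans by metis
  show "x \<le> x" unfolding less_eq_mnum_def by simp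
  show "x \<le> y \<Longrightarrow> y \<le> z \<Longrightarrow> x \<le> z" unfolding less_eq_mnum_def using m_trans by metis
  show "x \<le> y \<Longrightarrow> y \<le> x \<Longrightarrow> x = y" unfolding less_eq_mnum_def using m_trans m_irrefl by metis
  show "x \<le> y \<or> y \<le> x" unfolding less_eq_mnum_def using m_linear by metis
qed

instantiation mnum :: minus
begin

definition "x - y = (if y \<le> x then THE z. y + z = x else (0 :: mnum))"

instance ..

end

lemma m_le_iff: "a \<le> b \<longleftrightarrow> (\<exists>z. b = a + (z :: mnum))"
proof
  assume "a \<le> b"
  then consider "a = b" | "a < b" by (auto simp: less_eq_mnum_def)
  then show "\<exists>z. b = a + z"
  proof cases
    case 1 then show ?thesis using m_add_0 by metis
  next
    case 2 then show ?thesis unfolding m_less_iff using m_add_assoc by metis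
  qed
next
  assume "\<exists>z. b = a + z"
  then obtain z where z: "b = a + z" by blast
  show "a \<le> b"
  proof (cases "z = 0")
    case True then show ?thesis using z by (simp add: m_add_0)
  next
    case False
    then obtain w where "z = w + 1" using m_zero_or_Suc by blast
    then have "b = a + w + 1" using z by (simp add: m_add_assoc)
    then show ?thesis unfolding less_eq_mnum_def m_less_iff by blast
  qed
qed

lemma m_add_diff: "a + b - a = (b :: mnum)"
proof -
  have "a \<le> a + b" unfolding m_le_iff by blast
  moreover have "z = b" if "a + z = a + b" for z using that m_add_cancel m_add_comm by metis
  ultimately show ?thesis unfolding minus_mnum_def by (auto intro: the_equality)
qed

lemma m_diff_0: "\<not> b \<le> a \<Longrightarrow> a - b = (0 :: mnum)"
  by (simp add: minus_mnum_def)

lemma m_add_le_mono: "a \<le> b \<Longrightarrow> c + a \<le> c + (b :: mnum)"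
  unfolding m_le_iff using m_add_assoc by metis

lemma m_mult_le_mono: "a \<le> b \<Longrightarrow> c * a \<le> c * (b :: mnum)"
  unfolding m_le_iff using m_distrib by metis

lemma m_no_zero_div: "a * b = 0 \<Longrightarrow> a = 0 \<or> b = (0 :: mnum)"
proof (rule ccontr)
  assume *: "a * b = 0" "\<not> (a = 0 \<or> b = 0)"
  then obtain c d where "a = c + 1" "b = d + 1" using m_zero_or_Suc by metis
  then have "a * b = (a * d + c) + 1" by (metis m_mult_Suc m_add_assoc)
  with * m_Suc_neq show False by metis
qed

lemma m_0_le: "0 \<le> (a :: mnum)"
  using m_le_iff[of 0 a] m_0_add by metis

text \<open>From here on the library's simplification for ordered semidomains works on the possibly
  nonstandard numbers.\<close>

instance mnum :: linordered_semidom
proof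
  fix a b c :: mnum
  show "a + b + c = a + (b + c)" by (rule m_add_assoc)
  show "a + b = b + a" by (rule m_add_comm)
  show "0 + a = a" by (rule m_0_add)
  show "a + b - a = b" by (rule m_add_diff)
  show "a - b - c = a - (b + c)"
  proof (cases "b \<le> a")
    case True
    then obtain w where w: "a = b + w" unfolding m_le_iff by blast
    show ?thesis
    proof (cases "c \<le> w")
      case True
      then obtain v where "w = c + v" unfolding m_le_iff by blast
      then have "a = (b + c) + v" using w by (simp add: m_add_assoc)
      then show ?thesis using w \<open>w = c + v\<close> m_add_diff by metis
    next
      case False
      have "\<not> b + c \<le> a"
      proof
        assume "b + c \<le> a"
        then obtain v where "b + w = b + (c + v)" using w m_add_assoc unfolding m_le_iff by metis
        then have "w = c + v" using m_add_cancel m_add_comm by metis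
        then show False using False unfolding m_le_iff by blast
      qed
      then show ?thesis using w m_add_diff m_diff_0 False by metis
    qed
  next
    case False
    have "\<not> b + c \<le> a"
    proof
      assume "b + c \<le> a"
      then obtain v where "a = b + (c + v)" using m_add_assoc unfolding m_le_iff by metis
      then show False using False unfolding m_le_iff by blast
    qed
    moreover have "0 - c = 0"
    proof (cases "c \<le> 0")
      case True
      then have "c = 0" using m_0_le by (metis antisym)
      then show ?thesis using m_add_diff[of 0 0] by (simp add: m_add_0)
    qed (rule m_diff_0)
    ultimately show ?thesis using False m_diff_0 by metis
  qed
  show "a * b * c = a * (b * c)" by (rule m_mult_assoc)
  show "a * b = b * a" by (rule m_mult_comm)
  show "1 * a = a" by (rule m_1_mult)
  show "a * (b + c) = a * b + a * c" by (rule m_distrib)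
  show "(a + b) * c = a * c + b * c" using m_distrib m_mult_comm by metis
  show "0 * a = 0" by (rule m_0_mult)
  show "a * 0 = 0" by (rule m_mult_0)
  show "(0 :: mnum) \<noteq> 1" using m_Suc_neq[of 0] m_0_add by metis
  show "a * (b - c) = a * b - a * c"
  proof (cases "c \<le> b")
    case True
    then obtain z where "b = c + z" unfolding m_le_iff by blast
    then show ?thesis using m_add_diff m_distrib by metis
  next
    case False
    then have "a * b \<le> a * c" using m_mult_le_mono by (meson linear)
    then have "a * b - a * c = 0" using m_add_diff[of "a * b" 0] m_add_0 m_diff_0 by (metis antisym)
    then show ?thesis using False m_diff_0 m_mult_0 by metis
  qed
  show "a \<noteq> 0 \<Longrightarrow> b \<noteq> 0 \<Longrightarrow> a * b \<noteq> 0" using m_no_zero_div by blast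
  show "a \<le> b \<Longrightarrow> c + a \<le> c + b" by (rule m_add_le_mono)
  show "a < b \<Longrightarrow> 0 < c \<Longrightarrow> c * a < c * b"
  proof -
    assume "a < b" "0 < c"
    then obtain z w where "b = a + (z + 1)" "c = w + 1"
      unfolding m_less_iff m_0_add using m_add_assoc by metis
    then have "c * b = c * a + (c * z + w) + 1" by (simp add: m_distrib m_mult_1 m_add_assoc)
    then show ?thesis unfolding m_less_iff by blast
  qed
  show "0 < (1 :: mnum)" using m_less_add[of 0 0] m_add_0 m_0_add by metis
  show "b \<le> a \<Longrightarrow> a - b + b = a" using m_add_diff m_add_comm unfolding m_le_iff by metis
qed

lemma m_Suc_le: "a < b \<longleftrightarrow> a + 1 \<le> (b :: mnum)"
  unfolding m_less_iff m_le_iff by (metis add.assoc add.commute)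

lemma m_less_Suc_le: "a < b + 1 \<longleftrightarrow> a \<le> (b :: mnum)"
  using m_less_Suc by (auto simp: less_eq_mnum_def)

lemma m_not_less0 [simp]: "\<not> a < (0 :: mnum)" by (rule m_less_0)

lemma m_ge0 [simp]: "0 \<le> (a :: mnum)" by (rule m_0_le)

lemma m_pos_iff: "0 < a \<longleftrightarrow> a \<noteq> (0 :: mnum)"
  using m_0_le by (auto simp: less_eq_mnum_def)

lemma m_cases: obtains "a = 0" | b where "a = b + (1 :: mnum)"
  using m_zero_or_Suc by blast

section \<open>Sigma-1 and decidable predicates\<close>

lemma Del_le: "Tm t \<Longrightarrow> Tm u \<Longrightarrow> Del (\<lambda>\<rho>. t \<rho> \<le> u \<rho>)"
  unfolding less_eq_mnum_def by (intro Del_intros)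

lemma Del_env: "Del P \<Longrightarrow> (\<And>n. Tm (\<lambda>\<rho>. g \<rho> n)) \<Longrightarrow> Del (\<lambda>\<rho>. P (g \<rho>))"
  using Del_subst[of P "\<lambda>n \<rho>. g \<rho> n"] by simp

lemma Tm_case_nat: "Tm t \<Longrightarrow> Tm (\<lambda>\<rho>. g \<rho> (n - 1)) \<Longrightarrow> Tm (\<lambda>\<rho>. case_nat (t \<rho>) (g \<rho>) n)"
  by (cases n) auto

lemmas env_intros = Tm_case_nat Tm_intros

lemma SIG_cong: "SIG P \<Longrightarrow> (\<And>\<rho>. P \<rho> = Q \<rho>) \<Longrightarrow> SIG Q"
  by (simp add: ext[of P Q])

lemma SIG_E:
  assumes "SIG P"
  obtains D where "Del D" "\<And>\<rho>. P \<rho> \<longleftrightarrow> (\<exists>x. D (case_nat x \<rho>))"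
  using assms unfolding SIG_def by auto

lemma common_bound: "\<exists>z. a < z \<and> b < (z :: mnum)"
  by (metis less_add_one max.strict_coboundedI1 max.strict_coboundedI2)

text \<open>Two unbounded witnesses are replaced by one unbounded \<open>z\<close> with both
  witnesses searched below it, which restores the single leading quantifier.\<close>

lemma SIG_ex:
  assumes "SIG (\<lambda>\<rho>. Q (\<rho> 0) (\<lambda>n. \<rho> (Suc n)))"
  shows "SIG (\<lambda>\<rho>. \<exists>x. Q x \<rho>)"
proof -
  obtain D where D: "Del D" "\<And>\<rho>. Q (\<rho> 0) (\<lambda>n. \<rho> (Suc n)) \<longleftrightarrow> (\<exists>y. D (case_nat y \<rho>))"
    using assms by (rule SIG_E) blast
  have Q: "Q x \<rho> \<longleftrightarrow> (\<exists>y. D (case_nat y (case_nat x \<rho>)))" for x \<rho>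
    using D(2)[of "case_nat x \<rho>"] by simp
  have "SIG (\<lambda>\<rho>. \<exists>z. \<exists>x<z. \<exists>y<z. D (case_nat y (case_nat x \<rho>)))"
    by (intro SIG_exDel Del_ex env_intros Del_env[OF D(1)])
  then show ?thesis
  proof (rule SIG_cong)
    fix \<rho>
    show "(\<exists>z. \<exists>x<z. \<exists>y<z. D (case_nat y (case_nat x \<rho>))) \<longleftrightarrow> (\<exists>x. Q x \<rho>)"
      unfolding Q using common_bound by blast
  qed
qed

lemma SIG_conj:
  assumes "SIG P" "SIG Q"
  shows "SIG (\<lambda>\<rho>. P \<rho> \<and> Q \<rho>)"
proof -
  obtain D D' where D: "Del D" "\<And>\<rho>. P \<rho> \<longleftrightarrow> (\<exists>x. D (case_nat x \<rho>))"
    "Del D'" "\<And>\<rho>. Q \<rho> \<longleftrightarrow> (\<exists>x. D' (case_nat x \<rho>))"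
    using assms by (elim SIG_E) blast
  have "SIG (\<lambda>\<rho>. \<exists>z. (\<exists>x<z. D (case_nat x \<rho>)) \<and> (\<exists>x<z. D' (case_nat x \<rho>)))"
    by (intro SIG_exDel Del_conj Del_ex env_intros Del_env[OF D(1)] Del_env[OF D(3)])
  then show ?thesis by (rule SIG_cong) (unfold D(2,4), use common_bound in blast)
qed

lemma SIG_disj:
  assumes "SIG P" "SIG Q"
  shows "SIG (\<lambda>\<rho>. P \<rho> \<or> Q \<rho>)"
proof -
  obtain D D' where D: "Del D" "\<And>\<rho>. P \<rho> \<longleftrightarrow> (\<exists>x. D (case_nat x \<rho>))"
    "Del D'" "\<And>\<rho>. Q \<rho> \<longleftrightarrow> (\<exists>x. D' (case_nat x \<rho>))"
    using assms by (elim SIG_E) blast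
  have "SIG (\<lambda>\<rho>. \<exists>z. D (case_nat z \<rho>) \<or> D' (case_nat z \<rho>))"
    by (intro SIG_exDel Del_disj env_intros Del_env[OF D(1)] Del_env[OF D(3)])
  then show ?thesis by (rule SIG_cong) (unfold D(2,4), blast)
qed

text \<open>Sigma-1 induction on the initial segment \<open>u\<close>, keeping one common bound for
  the witnesses found so far. It is the reason why bounded universal quantifiers preserve
  \<open>SIG\<close>.\<close>

lemma collection:
  assumes "Del D" "\<And>x. x < a \<Longrightarrow> \<exists>y. D (case_nat y (case_nat x \<rho>))"
  shows "\<exists>z. \<forall>x<a. \<exists>y<z. D (case_nat y (case_nat x \<rho>))"
proof -
  have "\<exists>z. \<forall>x<u. x < a \<longrightarrow> (\<exists>y<z. D (case_nat y (case_nat x \<rho>)))" for u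
  proof (rule sigma_induct[where p = "\<lambda>u. \<exists>z. \<forall>x<u. x < a \<longrightarrow> (\<exists>y<z. D (case_nat y (case_nat x \<rho>)))"])
    show "SIG (\<lambda>\<rho>'. \<exists>z. \<forall>x<\<rho>' 0. x < a \<longrightarrow> (\<exists>y<z. D (case_nat y (case_nat x \<rho>))))"
      by (intro SIG_exDel Del_all Del_imp Del_less Del_ex env_intros Del_env[OF assms(1)])
    show "\<exists>z. \<forall>x<0. x < a \<longrightarrow> (\<exists>y<z. D (case_nat y (case_nat x \<rho>)))" by simp
    fix u assume "\<exists>z. \<forall>x<u. x < a \<longrightarrow> (\<exists>y<z. D (case_nat y (case_nat x \<rho>)))"
    then obtain z where z: "\<And>x. x < u \<Longrightarrow> x < a \<Longrightarrow> \<exists>y<z. D (case_nat y (case_nat x \<rho>))" by blast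
    obtain y where y: "u < a \<Longrightarrow> D (case_nat y (case_nat u \<rho>))" using assms(2) by blast
    obtain w where w: "z < w" "y < w" using common_bound by blast
    have "\<exists>y<w. D (case_nat y (case_nat x \<rho>))" if "x < u + 1" "x < a" for x
      using that z[of x] y w less_trans unfolding m_less_Suc by blast
    then show "\<exists>z. \<forall>x<u + 1. x < a \<longrightarrow> (\<exists>y<z. D (case_nat y (case_nat x \<rho>)))" by blast
  qed
  from this[of a] show ?thesis by blast
qed

lemma SIG_all_Tm:
  assumes "SIG (\<lambda>\<rho>. Q (\<rho> 0) (\<lambda>n. \<rho> (Suc n)))" and t: "Tm t"
  shows "SIG (\<lambda>\<rho>. \<forall>x<t \<rho>. Q x \<rho>)"
proof -
  obtain D where D: "Del D" "\<And>\<rho>. Q (\<rho> 0) (\<lambda>n. \<rho> (Suc n)) \<longleftrightarrow> (\<exists>y. D (case_nat y \<rho>))"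
    using assms(1) by (rule SIG_E) blast
  have Q: "Q x \<rho> \<longleftrightarrow> (\<exists>y. D (case_nat y (case_nat x \<rho>)))" for x \<rho>
    using D(2)[of "case_nat x \<rho>"] by simp
  have "SIG (\<lambda>\<rho>. \<exists>z. \<forall>x<t \<rho>. \<exists>y<z. D (case_nat y (case_nat x \<rho>)))"
    by (intro SIG_exDel Del_ex Del_all env_intros Del_env[OF D(1)] Tm_lift[OF t])
  then show ?thesis
  proof (rule SIG_cong)
    fix \<rho>
    show "(\<exists>z. \<forall>x<t \<rho>. \<exists>y<z. D (case_nat y (case_nat x \<rho>))) \<longleftrightarrow> (\<forall>x<t \<rho>. Q x \<rho>)"
      unfolding Q using collection[OF D(1), of "t \<rho>" \<rho>] by blast
  qed
qed

text \<open>The recursive functions of the model. As \<open>f\<close> is total, a Sigma-1 graph is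
  already Delta-1: \<open>y\<close> is not the value exactly if some other number is.\<close>

definition rec :: "(env \<Rightarrow> mnum) \<Rightarrow> bool" where
  "rec f \<longleftrightarrow> SIG (\<lambda>\<rho>. \<rho> 0 = f (\<lambda>n. \<rho> (Suc n)))"

definition dec :: "(env \<Rightarrow> bool) \<Rightarrow> bool" where
  "dec P \<longleftrightarrow> SIG P \<and> SIG (\<lambda>\<rho>. \<not> P \<rho>)"

lemma SIG_env:
  assumes "SIG P" "\<And>n. Tm (\<lambda>\<rho>. g \<rho> n)"
  shows "SIG (\<lambda>\<rho>. P (g \<rho>))"
proof -
  obtain D where D: "Del D" "\<And>\<rho>. P \<rho> \<longleftrightarrow> (\<exists>y. D (case_nat y \<rho>))" using assms(1) by (rule SIG_E) blast
  have "SIG (\<lambda>\<rho>. \<exists>y. D (case_nat y (g \<rho>)))"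
    by (intro SIG_exDel env_intros Del_env[OF D(1)] Tm_lift[OF assms(2)])
  then show ?thesis unfolding D(2) .
qed

lemma dec_env: "dec P \<Longrightarrow> (\<And>n. Tm (\<lambda>\<rho>. g \<rho> n)) \<Longrightarrow> dec (\<lambda>\<rho>. P (g \<rho>))"
  unfolding dec_def using SIG_env[of P g] SIG_env[of "\<lambda>\<rho>. \<not> P \<rho>" g] by blast

lemma dec_lift: "dec P \<Longrightarrow> dec (\<lambda>\<rho>. P (\<lambda>n. \<rho> (Suc n)))"
  by (erule dec_env) (rule Tm_var)

lemma dec_Del: "Del P \<Longrightarrow> dec P"
  unfolding dec_def by (intro conjI SIG_Del Del_not)

lemma rec_Tm: "Tm t \<Longrightarrow> rec t"
  unfolding rec_def by (intro SIG_Del Del_eq Tm_var Tm_lift)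

lemma SIG_rec:
  assumes "SIG (\<lambda>\<rho>. Q (\<rho> 0) (\<lambda>n. \<rho> (Suc n)))" "rec f"
  shows "SIG (\<lambda>\<rho>. Q (f \<rho>) \<rho>)"
proof -
  have "SIG (\<lambda>\<rho>. \<exists>y. y = f \<rho> \<and> Q y \<rho>)"
    using assms unfolding rec_def by (intro SIG_ex SIG_conj)
  then show ?thesis by simp
qed

text \<open>Both \<open>Q\<close> and its negation are evaluated at the value of \<open>f\<close> by
  an existential quantifier over that value, so Delta-1 is preserved.\<close>

lemma dec_rec:
  assumes "dec (\<lambda>\<rho>. Q (\<rho> 0) (\<lambda>n. \<rho> (Suc n)))" "rec f"
  shows "dec (\<lambda>\<rho>. Q (f \<rho>) \<rho>)"
  using assms SIG_rec[of Q f] SIG_rec[of "\<lambda>x \<rho>. \<not> Q x \<rho>" f] unfolding dec_def by blast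

lemma rec_env:
  assumes "rec f" "\<And>n. Tm (\<lambda>\<rho>. g \<rho> n)"
  shows "rec (\<lambda>\<rho>. f (g \<rho>))"
  unfolding rec_def
proof -
  let ?g = "\<lambda>\<rho>. case_nat (\<rho> 0) (g (\<lambda>n. \<rho> (Suc n))) :: env"
  have "SIG (\<lambda>\<rho>. (\<lambda>\<rho>. \<rho> 0 = f (\<lambda>n. \<rho> (Suc n))) (?g \<rho>))"
    by (rule SIG_env[OF assms(1)[unfolded rec_def]]) (intro Tm_case_nat Tm_var Tm_lift[OF assms(2)])
  then show "SIG (\<lambda>\<rho>. \<rho> 0 = f (g (\<lambda>n. \<rho> (Suc n))))" by simp
qed

lemma rec_lift: "rec f \<Longrightarrow> rec (\<lambda>\<rho>. f (\<lambda>n. \<rho> (Suc n)))"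
  by (erule rec_env) (rule Tm_var)

lemma rec_rec:
  assumes "rec (\<lambda>\<rho>. h (\<rho> 0) (\<lambda>n. \<rho> (Suc n)))" "rec f"
  shows "rec (\<lambda>\<rho>. h (f \<rho>) \<rho>)"
  unfolding rec_def
proof (rule SIG_rec[where Q = "\<lambda>y \<rho>. \<rho> 0 = h y (\<lambda>n. \<rho> (Suc n))"])
  let ?g = "\<lambda>\<rho>. case_nat (\<rho> (Suc 0)) (case_nat (\<rho> 0) (\<lambda>n. \<rho> (Suc (Suc n)))) :: env"
  have "SIG (\<lambda>\<rho>. (\<lambda>\<rho>. \<rho> 0 = h (\<rho> (Suc 0)) (\<lambda>n. \<rho> (Suc (Suc n)))) (?g \<rho>))"
    by (rule SIG_env[OF assms(1)[unfolded rec_def]]) (intro Tm_case_nat Tm_var)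
  then show "SIG (\<lambda>\<rho>. \<rho> (Suc 0) = h (\<rho> 0) (\<lambda>n. \<rho> (Suc (Suc n))))" by simp
qed (rule rec_lift[OF assms(2)])

section \<open>Closure rules for recursive functions and decidable predicates\<close>

named_theorems def_intros

lemma rec_var [def_intros]: "rec (\<lambda>\<rho>. \<rho> i)" and rec_const [def_intros]: "rec (\<lambda>\<rho>. c)"
  by (intro rec_Tm Tm_intros)+

lemma dec_comp1: "dec (\<lambda>\<rho>. P (\<rho> 0)) \<Longrightarrow> rec f \<Longrightarrow> dec (\<lambda>\<rho>. P (f \<rho>))"
  by (rule dec_rec)

lemma SIG_comp1: "SIG (\<lambda>\<rho>. P (\<rho> 0)) \<Longrightarrow> rec f \<Longrightarrow> SIG (\<lambda>\<rho>. P (f \<rho>))"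
  by (rule SIG_rec)

lemma rec_comp1: "rec (\<lambda>\<rho>. h (\<rho> 0)) \<Longrightarrow> rec f \<Longrightarrow> rec (\<lambda>\<rho>. h (f \<rho>))"
  by (rule rec_rec)

lemma dec_comp2:
  assumes "dec (\<lambda>\<rho>. P (\<rho> 0) (\<rho> (Suc 0)))" "rec f" "rec g"
  shows "dec (\<lambda>\<rho>. P (f \<rho>) (g \<rho>))"
proof -
  have "dec (\<lambda>\<rho>. P (\<rho> (Suc 0)) (\<rho> 0))"
    using dec_env[OF assms(1), of "\<lambda>\<rho>. case_nat (\<rho> (Suc 0)) \<rho>"] by (simp add: Tm_case_nat Tm_var)
  from dec_rec[where Q = "\<lambda>x \<rho>. P (\<rho> 0) x", OF this rec_lift[OF assms(3)]]
  have "dec (\<lambda>\<rho>. P (\<rho> 0) (g (\<lambda>n. \<rho> (Suc n))))" .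
  from dec_rec[where Q = "\<lambda>x \<rho>. P x (g \<rho>)", OF this assms(2)] show ?thesis .
qed

lemma rec_comp2:
  assumes "rec (\<lambda>\<rho>. h (\<rho> 0) (\<rho> (Suc 0)))" "rec f" "rec g"
  shows "rec (\<lambda>\<rho>. h (f \<rho>) (g \<rho>))"
proof -
  have "rec (\<lambda>\<rho>. h (\<rho> (Suc 0)) (\<rho> 0))"
    using rec_env[OF assms(1), of "\<lambda>\<rho>. case_nat (\<rho> (Suc 0)) \<rho>"] by (simp add: Tm_case_nat Tm_var)
  from rec_rec[where h = "\<lambda>x \<rho>. h (\<rho> 0) x", OF this rec_lift[OF assms(3)]]
  have "rec (\<lambda>\<rho>. h (\<rho> 0) (g (\<lambda>n. \<rho> (Suc n))))" .
  from rec_rec[where h = "\<lambda>x \<rho>. h x (g \<rho>)", OF this assms(2)] show ?thesis .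
qed

lemma rec_comp3:
  assumes "rec (\<lambda>\<rho>. h (\<rho> 0) (\<rho> (Suc 0)) (\<rho> (Suc (Suc 0))))" "rec f" "rec g" "rec k"
  shows "rec (\<lambda>\<rho>. h (f \<rho>) (g \<rho>) (k \<rho>))"
proof -
  have "rec (\<lambda>\<rho>. h (\<rho> (Suc 0)) (\<rho> (Suc (Suc 0))) (\<rho> 0))"
    using rec_env[OF assms(1), of "\<lambda>\<rho>. case_nat (\<rho> (Suc 0)) (case_nat (\<rho> (Suc (Suc 0))) \<rho>)"]
    by (simp add: Tm_case_nat Tm_var)
  from rec_rec[where h = "\<lambda>x \<rho>. h (\<rho> 0) (\<rho> (Suc 0)) x", OF this rec_lift[OF rec_lift[OF assms(4)]]]
  have 1: "rec (\<lambda>\<rho>. h (\<rho> 0) (\<rho> (Suc 0)) (k (\<lambda>n. \<rho> (Suc (Suc n)))))" .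
  have "rec (\<lambda>\<rho>. h (\<rho> (Suc 0)) (\<rho> 0) (k (\<lambda>n. \<rho> (Suc (Suc n)))))"
    using rec_env[OF 1, of "\<lambda>\<rho>. case_nat (\<rho> (Suc 0)) (case_nat (\<rho> 0) (\<lambda>n. \<rho> (Suc (Suc n))))"]
    by (simp add: Tm_case_nat Tm_var)
  from rec_rec[where h = "\<lambda>x \<rho>. h (\<rho> 0) x (k (\<lambda>n. \<rho> (Suc n)))", OF this rec_lift[OF assms(3)]]
  have "rec (\<lambda>\<rho>. h (\<rho> 0) (g (\<lambda>n. \<rho> (Suc n))) (k (\<lambda>n. \<rho> (Suc n))))" .
  from rec_rec[where h = "\<lambda>x \<rho>. h x (g \<rho>) (k \<rho>)", OF this assms(2)] show ?thesis .
qed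

lemma SIG_dec: "dec P \<Longrightarrow> SIG P"
  by (simp add: dec_def)

lemma dec_const [def_intros]: "dec (\<lambda>\<rho>. c)"
  using dec_Del[OF Del_True] dec_Del[OF Del_False] by (cases c) auto

lemma dec_eq [def_intros]: "rec f \<Longrightarrow> rec g \<Longrightarrow> dec (\<lambda>\<rho>. f \<rho> = g \<rho>)"
  by (rule dec_comp2[where P = "(=)"]) (intro dec_Del Del_eq Tm_intros)

lemma dec_less [def_intros]: "rec f \<Longrightarrow> rec g \<Longrightarrow> dec (\<lambda>\<rho>. f \<rho> < g \<rho>)"
  by (rule dec_comp2[where P = "(<)"]) (intro dec_Del Del_less Tm_intros)

lemma dec_le [def_intros]: "rec f \<Longrightarrow> rec g \<Longrightarrow> dec (\<lambda>\<rho>. f \<rho> \<le> g \<rho>)"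
  by (rule dec_comp2[where P = "(\<le>)"]) (intro dec_Del Del_le Tm_intros)

lemma dec_mem: "X \<in> SS \<Longrightarrow> rec f \<Longrightarrow> dec (\<lambda>\<rho>. f \<rho> \<in> X)"
  by (rule dec_comp1[where P = "\<lambda>x. x \<in> X"]) (intro dec_Del Del_mem Tm_intros)

lemma dec_not [def_intros]: "dec P \<Longrightarrow> dec (\<lambda>\<rho>. \<not> P \<rho>)"
  by (simp add: dec_def)

lemma dec_conj [def_intros]: "dec P \<Longrightarrow> dec Q \<Longrightarrow> dec (\<lambda>\<rho>. P \<rho> \<and> Q \<rho>)"
  using SIG_conj[of P Q] SIG_disj[of "\<lambda>\<rho>. \<not> P \<rho>" "\<lambda>\<rho>. \<not> Q \<rho>"] by (simp add: dec_def)

lemma dec_disj [def_intros]: "dec P \<Longrightarrow> dec Q \<Longrightarrow> dec (\<lambda>\<rho>. P \<rho> \<or> Q \<rho>)"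
  using SIG_disj[of P Q] SIG_conj[of "\<lambda>\<rho>. \<not> P \<rho>" "\<lambda>\<rho>. \<not> Q \<rho>"] by (simp add: dec_def)

lemma dec_imp [def_intros]: "dec P \<Longrightarrow> dec Q \<Longrightarrow> dec (\<lambda>\<rho>. P \<rho> \<longrightarrow> Q \<rho>)"
  unfolding imp_conv_disj by (intro dec_disj dec_not)

lemma dec_iff [def_intros]: "dec P \<Longrightarrow> dec Q \<Longrightarrow> dec (\<lambda>\<rho>. P \<rho> \<longleftrightarrow> Q \<rho>)"
  unfolding iff_conv_conj_imp by (intro dec_conj dec_imp)

lemma SIG_all:
  assumes "SIG (\<lambda>\<rho>. Q (\<rho> 0) (\<lambda>n. \<rho> (Suc n)))" "rec f"
  shows "SIG (\<lambda>\<rho>. \<forall>x<f \<rho>. Q x \<rho>)"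
proof (rule SIG_rec[where Q = "\<lambda>a \<rho>. \<forall>x<a. Q x \<rho>", OF _ assms(2)])
  have "SIG (\<lambda>\<rho>. Q (\<rho> 0) (\<lambda>n. \<rho> (Suc (Suc n))))"
    using SIG_env[OF assms(1), of "\<lambda>\<rho>. case_nat (\<rho> 0) (\<lambda>n. \<rho> (Suc (Suc n)))"]
    by (simp add: Tm_case_nat Tm_var)
  from SIG_all_Tm[where Q = "\<lambda>x \<rho>. Q x (\<lambda>n. \<rho> (Suc n))", OF this Tm_var]
  show "SIG (\<lambda>\<rho>. \<forall>x<\<rho> 0. Q x (\<lambda>n. \<rho> (Suc n)))" .
qed

lemma SIG_bex:
  assumes "SIG (\<lambda>\<rho>. Q (\<rho> 0) (\<lambda>n. \<rho> (Suc n)))" "rec f"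
  shows "SIG (\<lambda>\<rho>. \<exists>x<f \<rho>. Q x \<rho>)"
  by (intro SIG_ex SIG_conj assms(1) SIG_dec[OF dec_less] rec_var rec_lift[OF assms(2)])

lemma dec_all [def_intros]:
  "dec (\<lambda>\<rho>. Q (\<rho> 0) (\<lambda>n. \<rho> (Suc n))) \<Longrightarrow> rec f \<Longrightarrow> dec (\<lambda>\<rho>. \<forall>x<f \<rho>. Q x \<rho>)"
  using SIG_all[of Q f] SIG_bex[of "\<lambda>x \<rho>. \<not> Q x \<rho>" f] by (simp add: dec_def)

lemma dec_ex [def_intros]:
  "dec (\<lambda>\<rho>. Q (\<rho> 0) (\<lambda>n. \<rho> (Suc n))) \<Longrightarrow> rec f \<Longrightarrow> dec (\<lambda>\<rho>. \<exists>x<f \<rho>. Q x \<rho>)"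
  using SIG_bex[of Q f] SIG_all[of "\<lambda>x \<rho>. \<not> Q x \<rho>" f] by (simp add: dec_def)

lemma rec_plus [def_intros]: "rec f \<Longrightarrow> rec g \<Longrightarrow> rec (\<lambda>\<rho>. f \<rho> + g \<rho>)"
  by (rule rec_comp2[where h = "(+)"]) (intro rec_Tm Tm_intros)

lemma rec_times [def_intros]: "rec f \<Longrightarrow> rec g \<Longrightarrow> rec (\<lambda>\<rho>. f \<rho> * g \<rho>)"
  by (rule rec_comp2[where h = "(*)"]) (intro rec_Tm Tm_intros)

lemma rec_graph:
  assumes "SIG (\<lambda>\<rho>. G (\<rho> 0) (\<lambda>n. \<rho> (Suc n)))" "\<And>y \<rho>. G y \<rho> \<longleftrightarrow> y = f \<rho>"
  shows "rec f"
  using assms unfolding rec_def by simp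

lemma minus_graph: "y = a - b \<longleftrightarrow> (b \<le> a \<and> y + b = a) \<or> (\<not> b \<le> a \<and> y = (0 :: mnum))"
  by (cases "b \<le> a") (auto simp: m_diff_0 le_add_diff_inverse2)

lemma rec_minus [def_intros]: "rec f \<Longrightarrow> rec g \<Longrightarrow> rec (\<lambda>\<rho>. f \<rho> - g \<rho>)"
  by (rule rec_comp2[where h = "(-)"], unfold rec_def minus_graph)
    (intro SIG_dec def_intros)

lemma rec_if [def_intros]:
  assumes "dec P" "rec f" "rec g"
  shows "rec (\<lambda>\<rho>. if P \<rho> then f \<rho> else g \<rho>)"
proof (rule rec_graph)
  show "SIG (\<lambda>\<rho>. (\<lambda>y \<rho>. (P \<rho> \<and> y = f \<rho>) \<or> (\<not> P \<rho> \<and> y = g \<rho>)) (\<rho> 0) (\<lambda>n. \<rho> (Suc n)))"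
    by (intro SIG_dec dec_disj dec_conj dec_not dec_eq rec_var rec_lift[OF assms(2)]
        rec_lift[OF assms(3)] dec_lift[OF assms(1)])
qed auto

lemma dec_if [def_intros]:
  "dec P \<Longrightarrow> dec Q \<Longrightarrow> dec R \<Longrightarrow> dec (\<lambda>\<rho>. if P \<rho> then Q \<rho> else R \<rho>)"
  unfolding if_bool_eq_conj by (intro def_intros)

section \<open>Induction and least number principles\<close>

lemma dec_induct:
  assumes "dec (\<lambda>\<rho>. p (\<rho> 0))" "p 0" "\<And>x. p x \<Longrightarrow> p (x + 1)"
  shows "p x"
  using sigma_induct[of p x, OF SIG_dec[OF assms(1)] assms(2,3)] .

text \<open>A failure of \<open>p\<close> at \<open>x\<close> is carried down to
  \<open>x - y\<close> by Sigma-1 induction on \<open>y\<close>, until it contradicts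
  \<open>p 0\<close>.\<close>

lemma pi_induct:
  assumes "SIG (\<lambda>\<rho>. \<not> p (\<rho> 0))" "p 0" "\<And>x. p x \<Longrightarrow> p (x + 1)"
  shows "p x"
proof (rule ccontr)
  assume x: "\<not> p x"
  have "x \<le> x \<longrightarrow> \<not> p (x - x)"
  proof (rule sigma_induct[where p = "\<lambda>y. y \<le> x \<longrightarrow> \<not> p (x - y)"])
    show "SIG (\<lambda>\<rho>. \<rho> 0 \<le> x \<longrightarrow> \<not> p (x - \<rho> 0))"
      unfolding imp_conv_disj
      by (intro SIG_disj SIG_comp1[OF assms(1)] SIG_dec def_intros)
    show "0 \<le> x \<longrightarrow> \<not> p (x - 0)" using x by simp
    fix y assume y: "y \<le> x \<longrightarrow> \<not> p (x - y)"
    show "y + 1 \<le> x \<longrightarrow> \<not> p (x - (y + 1))"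
    proof
      assume le: "y + 1 \<le> x"
      then obtain z where "x = y + 1 + z" unfolding m_le_iff by blast
      then have "x = y + (z + 1)" "x - (y + 1) = z" by (simp_all add: add.commute add.left_commute)
      then have "x - (y + 1) + 1 = x - y" by simp
      moreover have "y \<le> x" using le unfolding m_Suc_le[symmetric] by simp
      ultimately show "\<not> p (x - (y + 1))" using y assms(3)[of "x - (y + 1)"] by auto
    qed
  qed
  then show False using assms(2) by simp
qed

lemma strong_dec_induct:
  assumes "dec (\<lambda>\<rho>. p (\<rho> 0))" "\<And>x. (\<And>y. y < x \<Longrightarrow> p y) \<Longrightarrow> p x"
  shows "p x"
proof -
  have "\<forall>y<x + 1. p y"
  proof (rule dec_induct[where p = "\<lambda>x. \<forall>y<x + 1. p y"])
    show "dec (\<lambda>\<rho>. \<forall>y<\<rho> 0 + 1. p y)" by (intro def_intros dec_comp1[OF assms(1)])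
    show "\<forall>y<0 + 1. p y" unfolding m_less_Suc using assms(2)[of 0] by simp
    show "\<forall>y<x + 1 + 1. p y" if "\<forall>y<x + 1. p y" for x
      using that assms(2)[of "x + 1"] by (auto simp: m_less_Suc)
  qed
  then show ?thesis by (simp add: m_less_Suc_le)
qed

lemma least_exists:
  assumes "dec (\<lambda>\<rho>. p (\<rho> 0))" "p a"
  shows "\<exists>x\<le>a. p x \<and> (\<forall>y<x. \<not> p y)"
proof (rule ccontr)
  assume *: "\<not> ?thesis"
  have "x \<le> a \<longrightarrow> \<not> p x" for x
  proof (rule strong_dec_induct[where p = "\<lambda>x. x \<le> a \<longrightarrow> \<not> p x"])
    show "dec (\<lambda>\<rho>. \<rho> 0 \<le> a \<longrightarrow> \<not> p (\<rho> 0))" by (intro def_intros dec_comp1[OF assms(1)])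
    fix x assume IH: "\<And>y. y < x \<Longrightarrow> y \<le> a \<longrightarrow> \<not> p y"
    show "x \<le> a \<longrightarrow> \<not> p x"
    proof (intro impI notI)
      assume "x \<le> a" "p x"
      then have "\<forall>y<x. \<not> p y" by (metis IH less_le_trans less_imp_le)
      with * \<open>x \<le> a\<close> \<open>p x\<close> show False by blast
    qed
  qed
  then show False using assms(2) by blast
qed

lemma dec_dvd [def_intros]:
  assumes "rec f" "rec g"
  shows "dec (\<lambda>\<rho>. f \<rho> dvd g \<rho>)"
proof -
  \<comment> \<open>The quotient can be taken at most \<open>n\<close>; if \<open>a\<close> is 0
    then so is \<open>n\<close>, and the quotient 0 works.\<close>
  have *: "a dvd n \<longleftrightarrow> (\<exists>q<n + 1. n = a * q)" for a n :: mnum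
  proof
    assume "a dvd n"
    then obtain q where q: "n = a * q" by (rule dvdE)
    show "\<exists>q<n + 1. n = a * q"
    proof (cases "a = 0")
      case True then show ?thesis using q by (intro exI[of _ 0]) (simp add: m_less_Suc_le)
    next
      case False
      then obtain b where "a = b + 1" using m_cases by blast
      then have "q \<le> n" using q by (simp add: distrib_right)
      then show ?thesis using q m_less_Suc_le by blast
    qed
  qed auto
  show ?thesis unfolding * by (intro def_intros assms rec_lift)
qed

section \<open>Pairs, finite sets and sequences\<close>

definition pr :: "mnum \<Rightarrow> mnum \<Rightarrow> mnum" where
  "pr x y = (x + y) * (x + y) + x"

lemma m_mult_mono: "a \<le> b \<Longrightarrow> c \<le> d \<Longrightarrow> a * c \<le> b * (d :: mnum)"
  by (rule mult_mono) simp_all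

lemma m_le_square: "a \<le> a * (a :: mnum)"
proof (cases a rule: m_cases)
  case (2 b)
  have "a * 1 \<le> a * a" by (rule m_mult_mono) (simp_all add: 2)
  then show ?thesis by simp
qed simp

lemma pr_less: "pr x y < (x + y + 1) * (x + y + 1)"
proof -
  have "(x + y + 1) * (x + y + 1) = pr x y + (y + (x + y)) + 1"
    unfolding pr_def by (simp add: algebra_simps)
  then show ?thesis unfolding m_less_iff by blast
qed

text \<open>\<open>pr x y\<close> lies between the squares of \<open>x + y\<close> and
  \<open>x + y + 1\<close>, so it determines \<open>x + y\<close> and then \<open>x\<close>.\<close>

lemma pr_inj: "pr x y = pr x' y' \<longleftrightarrow> x = x' \<and> y = y'"
proof
  have "\<not> a + b < c + d" if e: "pr a b = pr c d" for a b c d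
  proof
    assume "a + b < c + d"
    then have "a + b + 1 \<le> c + d" by (simp add: m_Suc_le)
    then have "(a + b + 1) * (a + b + 1) \<le> (c + d) * (c + d)" by (intro m_mult_mono)
    also have "\<dots> \<le> pr c d" by (simp add: pr_def)
    finally show False using pr_less[of a b] e by (metis leD)
  qed
  moreover assume "pr x y = pr x' y'"
  ultimately have "x + y = x' + y'" by (metis linorder_neqE)
  moreover from this \<open>pr x y = pr x' y'\<close> have "x = x'" unfolding pr_def by simp
  ultimately show "x = x' \<and> y = y'" by simp
qed simp

lemma le_pr: "x \<le> pr x y" "y \<le> pr x y"
proof -
  show "x \<le> pr x y" by (simp add: pr_def)
  have "y \<le> x + y" by simp
  also have "\<dots> \<le> (x + y) * (x + y)" by (rule m_le_square)
  also have "\<dots> \<le> pr x y" by (simp add: pr_def)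
  finally show "y \<le> pr x y" .
qed

lemma pr_mono: "x \<le> x' \<Longrightarrow> y \<le> y' \<Longrightarrow> pr x y \<le> pr x' y'"
  unfolding pr_def by (intro add_mono m_mult_mono)

lemma rec_pr [def_intros]: "rec f \<Longrightarrow> rec g \<Longrightarrow> rec (\<lambda>\<rho>. pr (f \<rho>) (g \<rho>))"
  unfolding pr_def by (intro def_intros)

section \<open>Coded finite sets and Goedel's beta function\<close>

definition eps :: "mnum \<Rightarrow> mnum \<Rightarrow> bool" where
  "eps i c \<longleftrightarrow> (\<exists>k m n q. c = pr k (pr m n) \<and> i < k \<and> n = (m * (i + 1) + 1) * q)"

lemma eps_iff: "eps i (pr k (pr m n)) \<longleftrightarrow> i < k \<and> (m * (i + 1) + 1) dvd n"
  unfolding eps_def pr_inj by (auto simp: dvd_def)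

lemma eps_dec: "eps i c \<longleftrightarrow>
  (\<exists>k<c + 1. \<exists>m<c + 1. \<exists>n<c + 1. c = pr k (pr m n) \<and> i < k \<and> (m * (i + 1) + 1) dvd n)"
proof
  assume "eps i c"
  then obtain k m n where *: "c = pr k (pr m n)" "i < k" "(m * (i + 1) + 1) dvd n"
    unfolding eps_def by auto
  then have "k \<le> c" "m \<le> c" "n \<le> c" using le_pr order_trans by metis+
  then show "\<exists>k<c + 1. \<exists>m<c + 1. \<exists>n<c + 1. c = pr k (pr m n) \<and> i < k \<and> (m * (i + 1) + 1) dvd n"
    using * unfolding m_less_Suc_le by blast
qed (auto simp: eps_iff)

lemma dec_eps [def_intros]: "rec f \<Longrightarrow> rec g \<Longrightarrow> dec (\<lambda>\<rho>. eps (f \<rho>) (g \<rho>))"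
  by (rule dec_comp2[where P = eps]) (unfold eps_dec, intro def_intros)

lemma eps_less: "eps i c \<Longrightarrow> i < c"
  unfolding eps_def using le_pr(1) less_le_trans by blast

text \<open>Takes the place of the factorial in Goedel's construction: the differences of indices
  below \<open>k\<close> will divide \<open>m\<close>.\<close>

lemma common_multiple: "\<exists>m. m \<noteq> 0 \<and> (\<forall>i<k. (i + 1) dvd (m :: mnum))"
proof (rule sigma_induct[where p = "\<lambda>k. \<exists>m. m \<noteq> 0 \<and> (\<forall>i<k. (i + 1) dvd m)"])
  show "SIG (\<lambda>\<rho>. \<exists>m. m \<noteq> 0 \<and> (\<forall>i<\<rho> 0. (i + 1) dvd m))"
    by (rule SIG_ex, rule SIG_dec) (intro def_intros)
  show "\<exists>m. m \<noteq> 0 \<and> (\<forall>i<(0::mnum). (i + 1) dvd m)" by (rule exI[of _ 1]) simp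
  fix k assume "\<exists>m. m \<noteq> 0 \<and> (\<forall>i<k. (i + 1) dvd (m :: mnum))"
  then obtain m where m: "m \<noteq> 0" "\<And>i. i < k \<Longrightarrow> (i + 1) dvd m" by blast
  have "m * (k + 1) \<noteq> 0" using m(1) m_Suc_neq by simp
  moreover have "(i + 1) dvd m * (k + 1)" if "i < k + 1" for i
    using that m(2)[of i] unfolding m_less_Suc by (auto intro: dvd_mult2)
  ultimately show "\<exists>m. m \<noteq> 0 \<and> (\<forall>i<k + 1. (i + 1) dvd m)" by blast
qed

text \<open>The moduli of Goedel's beta function are pairwise coprime; only the following cancellation
  property is needed, which avoids a theory of greatest common divisors.\<close>

lemma modulus_cancel1:
  assumes "(m * (i + 1) + 1) dvd n * (m :: mnum)"
  shows "(m * (i + 1) + 1) dvd n"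
proof -
  let ?q = "m * (i + 1) + 1"
  have "?q dvd n * m * (i + 1)" using assms by (rule dvd_mult2)
  \<comment> \<open>The sum is \<open>n\<close> times the modulus, so the modulus divides the
    remaining summand \<open>n\<close>.\<close>
  moreover have "?q dvd n * m * (i + 1) + n"
    using dvd_triv_right[of ?q n] by (simp add: algebra_simps)
  ultimately show ?thesis using dvd_add_right_iff by blast
qed

text \<open>A divisor \<open>d\<close> of \<open>m\<close> is cancelled by multiplying it up to
  \<open>m\<close> and cancelling \<open>m\<close>.\<close>

lemma modulus_cancel2:
  assumes "(m * (i + 1) + 1) dvd n * m * d" "d dvd (m :: mnum)"
  shows "(m * (i + 1) + 1) dvd n"
proof -
  let ?q = "m * (i + 1) + 1"
  from assms(1) have "?q dvd n * d * m" by (simp add: ac_simps)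
  then have "?q dvd n * d" by (rule modulus_cancel1)
  moreover obtain e where "m = d * e" using assms(2) by (rule dvdE)
  ultimately have "?q dvd n * m" using dvd_mult2[of ?q "n * d" e] by (simp add: mult.assoc)
  then show ?thesis by (rule modulus_cancel1)
qed

text \<open>The moduli of \<open>i\<close> and \<open>j\<close> differ by \<open>m\<close> times the
  distance of \<open>i\<close> and \<open>j\<close>. What remains to be cancelled is
  \<open>m\<close> and that distance, which divides \<open>m\<close>.\<close>

lemma modulus_cancel:
  assumes "i \<noteq> j" "i < k" "j < k" "\<And>d. d < k \<Longrightarrow> (d + 1) dvd m"
    "(m * (i + 1) + 1) dvd n * (m * (j + 1) + 1)"
  shows "(m * (i + 1) + 1) dvd (n :: mnum)"
proof (cases "i < j")
  case True
  then obtain d where d: "j = i + d + 1" unfolding m_less_iff by blast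
  then have "d < k" using assms(3)
      by (metis add.commute add.left_commute le_add_same_cancel1 less_trans m_ge0 m_less_Suc_le
          le_less_trans)
  let ?q = "m * (i + 1) + 1"
  have "n * (m * (j + 1) + 1) = n * ?q + n * m * (d + 1)" using d by (simp add: algebra_simps)
  then have "?q dvd n * m * (d + 1)"
    using assms(5) dvd_add_right_iff[of ?q "n * ?q"] by simp
  then show ?thesis using modulus_cancel2 assms(4)[OF \<open>d < k\<close>] by blast
next
  case False
  then obtain d where d: "i = j + d + 1" using assms(1) unfolding m_less_iff[symmetric]
      by (metis linorder_neqE m_less_iff)
  then have "d < k" using assms(2)
      by (metis add.commute add.left_commute le_add_same_cancel1 less_trans m_ge0 m_less_Suc_le
          le_less_trans)
  let ?q = "m * (i + 1) + 1"
  have "n * (m * (j + 1) + 1) + n * m * (d + 1) = n * ?q" using d by (simp add: algebra_simps)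
  then have "?q dvd n * (m * (j + 1) + 1) + n * m * (d + 1)" by simp
  then have "?q dvd n * m * (d + 1)" using assms(5) dvd_add_right_iff by blast
  then show ?thesis using modulus_cancel2 assms(4)[OF \<open>d < k\<close>] by blast
qed

text \<open>The code is the product of the moduli of the indices in \<open>P\<close>, built by
  induction on \<open>u\<close>. The invariant \<open>B\<close> travels along so that a caller can
  also bound the product.\<close>

lemma code_exists_with:
  assumes P: "dec (\<lambda>\<rho>. P (\<rho> 0))" and m: "m \<noteq> 0" "\<And>i. i < k \<Longrightarrow> (i + 1) dvd m"
    and B: "dec (\<lambda>\<rho>. B (\<rho> 0) (\<rho> (Suc 0)))" "B 1 0" "\<And>n u. B n u \<Longrightarrow> B n (u + 1)"
      "\<And>n u. B n u \<Longrightarrow> B (n * (m * (u + 1) + 1)) (u + 1)"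
  shows "\<exists>n. B n k \<and> (\<forall>i<k. (m * (i + 1) + 1) dvd n \<longleftrightarrow> P i)"
proof -
  have "\<exists>n. B n u \<and> (\<forall>i<k. (m * (i + 1) + 1) dvd n \<longleftrightarrow> i < u \<and> P i)" for u
  proof (rule sigma_induct[where p = "\<lambda>u. \<exists>n. B n u \<and> (\<forall>i<k. (m * (i + 1) + 1) dvd n \<longleftrightarrow> i < u \<and> P i)"])
    show "SIG (\<lambda>\<rho>. \<exists>n. B n (\<rho> 0) \<and> (\<forall>i<k. (m * (i + 1) + 1) dvd n \<longleftrightarrow> i < \<rho> 0 \<and> P i))"
      by (rule SIG_ex, rule SIG_dec) (intro def_intros dec_comp1[OF P] dec_comp2[OF B(1)])
    \<comment> \<open>The empty product must code the empty set, which needs moduli greater than 1,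
      hence \<open>m \<noteq> 0\<close>.\<close>
    have "\<not> (m * (i + 1) + 1) dvd 1" for i
    proof
      assume "(m * (i + 1) + 1) dvd 1"
      then have "(m * (i + 1) + 1) dvd 0 + 1 * (m * (i + 1) + 1)" "(m * (i + 1) + 1) dvd 1" by auto
      then obtain q where q: "1 = (m * (i + 1) + 1) * q" by (elim dvdE)
      then have "q \<noteq> 0" by auto
      then obtain r where "q = r + 1" using m_cases by blast
      with q have "0 + 1 = (m * (i + 1) * (r + 1) + r) + 1" by (simp add: algebra_simps)
      then have "0 = m * (i + 1) * (r + 1) + r" by (rule m_Suc_inj)
      then have "m * (i + 1) * (r + 1) = 0" by (metis add_nonneg_eq_0_iff m_ge0)
      then show False using m(1) m_Suc_neq by auto
    qed
    then show "\<exists>n. B n 0 \<and> (\<forall>i<k. (m * (i + 1) + 1) dvd n \<longleftrightarrow> i < 0 \<and> P i)"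
      using B(2) by (intro exI[of _ 1]) simp
    fix u assume "\<exists>n. B n u \<and> (\<forall>i<k. (m * (i + 1) + 1) dvd n \<longleftrightarrow> i < u \<and> P i)"
    then obtain n where Bn: "B n u" and n: "\<And>i. i < k \<Longrightarrow> (m * (i + 1) + 1) dvd n \<longleftrightarrow> i < u \<and> P i" by blast
    show "\<exists>n. B n (u + 1) \<and> (\<forall>i<k. (m * (i + 1) + 1) dvd n \<longleftrightarrow> i < u + 1 \<and> P i)"
    proof (cases "P u \<and> u < k")
      case True
      have "(m * (i + 1) + 1) dvd n * (m * (u + 1) + 1) \<longleftrightarrow> i < u + 1 \<and> P i" if "i < k" for i
      proof (cases "i = u")
        case False
        have "(m * (i + 1) + 1) dvd n * (m * (u + 1) + 1) \<longleftrightarrow> (m * (i + 1) + 1) dvd n"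
          by (rule iffI, rule modulus_cancel[OF False that _ m(2)]) (use True in \<open>auto intro:
              dvd_mult2\<close>)
        with n[OF that] False show ?thesis by (simp add: m_less_Suc)
      qed (use True in \<open>simp add: m_less_Suc\<close>)
      then show ?thesis using B(4)[OF Bn] by (intro exI[of _ "n * (m * (u + 1) + 1)"] conjI allI impI)
    next
      case False
      then show ?thesis using n B(3)[OF Bn] unfolding m_less_Suc by (intro exI[of _ n]) auto
    qed
  qed
  from this[of k] show ?thesis by auto
qed

text \<open>Finite comprehension that yields a number. Because such sets are numbers, Sigma-1
  formulas can quantify over them.\<close>

lemma code_exists:
  assumes "dec (\<lambda>\<rho>. P (\<rho> 0))"
  shows "\<exists>c. \<forall>i. eps i c \<longleftrightarrow> i < k \<and> P i"
proof -
  obtain m where m: "m \<noteq> 0" "\<And>i. i < k \<Longrightarrow> (i + 1) dvd m" using common_multiple by blast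
  from code_exists_with[OF assms m, of k "\<lambda>_ _. True"]
  obtain n where "\<forall>i<k. (m * (i + 1) + 1) dvd n \<longleftrightarrow> P i" by (auto intro: dec_const)
  then have "\<forall>i. eps i (pr k (pr m n)) \<longleftrightarrow> i < k \<and> P i" unfolding eps_iff by blast
  then show ?thesis by blast
qed

section \<open>Sequences as finite sets of pairs\<close>

lemma rec_bounded:
  assumes "rec (\<lambda>\<rho>. f (\<rho> 0))"
  shows "\<exists>b. \<forall>i<k. f i < b"
proof (rule sigma_induct[where p = "\<lambda>k. \<exists>b. \<forall>i<k. f i < b"])
  show "SIG (\<lambda>\<rho>. \<exists>b. \<forall>i<\<rho> 0. f i < b)"
    by (rule SIG_ex, rule SIG_dec) (intro def_intros rec_comp1[OF assms])
  fix k assume "\<exists>b. \<forall>i<k. f i < b"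
  then obtain b where b: "\<And>i. i < k \<Longrightarrow> f i < b" by blast
  obtain c where "b < c" "f k < c" using common_bound by blast
  then have "\<forall>i<k + 1. f i < c" using b less_trans unfolding m_less_Suc by blast
  then show "\<exists>b. \<forall>i<k + 1. f i < b" by blast
qed simp

text \<open>\<open>app s i\<close> is the entry of the sequence \<open>s\<close> (a finite set of pairs) at \<open>i\<close>, or 0 if there is none.\<close>

definition is_app :: "mnum \<Rightarrow> mnum \<Rightarrow> mnum \<Rightarrow> bool" where
  "is_app y s i \<longleftrightarrow> (eps (pr i y) s \<and> (\<forall>x<y. \<not> eps (pr i x) s)) \<or> (y = 0 \<and> (\<forall>x<s. \<not> eps (pr i x) s))"

definition app :: "mnum \<Rightarrow> mnum \<Rightarrow> mnum" where
  "app s i = (THE y. is_app y s i)"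

lemma is_app_unique: "\<exists>!y. is_app y s i"
proof (cases "\<exists>x. eps (pr i x) s")
  case True
  then obtain x where "eps (pr i x) s" by blast
  moreover have "dec (\<lambda>\<rho>. eps (pr i (\<rho> 0)) s)" by (intro def_intros)
  ultimately obtain y where y: "eps (pr i y) s" "\<forall>x<y. \<not> eps (pr i x) s"
    using least_exists[of "\<lambda>x. eps (pr i x) s" x] by blast
  have "y < s" using eps_less[OF y(1)] le_pr(2)[of y i] by simp
  show ?thesis
  proof (rule ex1I[of _ y])
    show "is_app y s i" using y by (simp add: is_app_def)
    show "y' = y" if "is_app y' s i" for y'
      using that y \<open>y < s\<close> unfolding is_app_def by (metis linorder_neqE)
  qed
next
  case False
  then show ?thesis by (intro ex1I[of _ 0]) (auto simp: is_app_def)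
qed

lemma is_app_iff: "is_app y s i \<longleftrightarrow> y = app s i"
  using is_app_unique[of s i] theI'[OF is_app_unique[of s i]] unfolding app_def by blast

lemma rec_app [def_intros]: "rec f \<Longrightarrow> rec g \<Longrightarrow> rec (\<lambda>\<rho>. app (f \<rho>) (g \<rho>))"
  by (rule rec_comp2[where h = app], unfold rec_def is_app_iff[symmetric] is_app_def)
    (intro SIG_dec def_intros)

lemma app_eqI:
  assumes "\<And>x. eps (pr i x) s \<longleftrightarrow> x = y"
  shows "app s i = y"
  using assms is_app_iff[of y s i] unfolding is_app_def by auto

lemma seq_exists:
  assumes "rec (\<lambda>\<rho>. f (\<rho> 0))"
  shows "\<exists>s. \<forall>i<k. app s i = f i"
proof -
  obtain b where b: "\<And>i. i < k \<Longrightarrow> f i < b" using rec_bounded[OF assms] by blast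
  have "dec (\<lambda>\<rho>. \<exists>i<k. \<rho> 0 = pr i (f i))" by (intro def_intros rec_comp1[OF assms])
  \<comment> \<open>Pairing is monotone, so \<open>pr k b\<close> bounds all the pairs to be
    collected.\<close>
  from code_exists[of "\<lambda>p. \<exists>i<k. p = pr i (f i)", OF this] obtain s
    where s: "\<And>p. eps p s \<longleftrightarrow> p < pr k b + 1 \<and> (\<exists>i<k. p = pr i (f i))" by blast
  have "app s i = f i" if "i < k" for i
  proof (rule app_eqI)
    have "pr i (f i) < pr k b + 1" unfolding m_less_Suc_le using that b[OF that] by (intro pr_mono) auto
    then show "eps (pr i x) s \<longleftrightarrow> x = f i" for x unfolding s pr_inj using that by auto
  qed
  then show ?thesis by blast
qed

section \<open>Primitive recursion\<close>

definition is_run :: "(mnum \<Rightarrow> mnum) \<Rightarrow> (mnum \<Rightarrow> mnum \<Rightarrow> mnum \<Rightarrow> mnum) \<Rightarrow> mnum \<Rightarrow> mnum \<Rightarrow> mnum \<Rightarrow> bool" where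
  "is_run g h p n s \<longleftrightarrow> app s 0 = g p \<and> (\<forall>i<n. app s (i + 1) = h p i (app s i))"

text \<open>The choice of a run does not matter: any two runs agree as far as both reach.\<close>

definition prim_rec :: "(mnum \<Rightarrow> mnum) \<Rightarrow> (mnum \<Rightarrow> mnum \<Rightarrow> mnum \<Rightarrow> mnum) \<Rightarrow> mnum \<Rightarrow> mnum \<Rightarrow> mnum" where
  "prim_rec g h p n = app (SOME s. is_run g h p n s) n"

context
  fixes g :: "mnum \<Rightarrow> mnum" and h :: "mnum \<Rightarrow> mnum \<Rightarrow> mnum \<Rightarrow> mnum"
  assumes g: "rec (\<lambda>\<rho>. g (\<rho> 0))" and h: "rec (\<lambda>\<rho>. h (\<rho> 0) (\<rho> (Suc 0)) (\<rho> (Suc (Suc 0))))"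
begin

lemma dec_is_run: "rec p \<Longrightarrow> rec n \<Longrightarrow> rec s \<Longrightarrow> dec (\<lambda>\<rho>. is_run g h (p \<rho>) (n \<rho>) (s \<rho>))"
  unfolding is_run_def by (intro def_intros rec_comp1[OF g] rec_comp3[OF h] rec_lift[of p]
      rec_lift[of n] rec_lift[of s])

lemma run_extend:
  assumes "is_run g h p n s"
  shows "\<exists>s'. is_run g h p (n + 1) s'"
proof -
  let ?f = "\<lambda>i. if i \<le> n then app s i else h p n (app s n)"
  have "rec (\<lambda>\<rho>. ?f (\<rho> 0))" by (intro def_intros rec_comp3[OF h])
  then obtain s' where s': "\<And>i. i < n + 1 + 1 \<Longrightarrow> app s' i = ?f i" using seq_exists[of ?f] by blast
  have "app s' (i + 1) = h p i (app s' i)" if "i < n + 1" for i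
  proof -
    have "i < n + 1 + 1" "i + 1 < n + 1 + 1" using that by (simp_all add: m_less_Suc[of i "n + 1"])
    moreover have "i \<le> n" using that unfolding m_less_Suc_le .
    moreover have "i + 1 \<le> n \<longleftrightarrow> i < n" by (rule m_Suc_le[symmetric])
    ultimately show ?thesis using s' assms unfolding is_run_def by (auto simp: less_eq_mnum_def)
  qed
  moreover have "app s' 0 = g p" using s'[of 0] assms by (simp add: is_run_def m_less_Suc_le)
  ultimately show ?thesis unfolding is_run_def by blast
qed

lemma run_exists: "\<exists>s. is_run g h p n s"
proof (rule sigma_induct[where p = "\<lambda>n. \<exists>s. is_run g h p n s"])
  show "SIG (\<lambda>\<rho>. \<exists>s. is_run g h p (\<rho> 0) s)"
    by (rule SIG_ex, rule SIG_dec) (intro def_intros dec_is_run)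
  have "rec (\<lambda>\<rho>. (\<lambda>i. g p) (\<rho> 0))" by (intro def_intros)
  from seq_exists[OF this, of 1] obtain s where "app s 0 = g p" using zero_less_one by blast
  then show "\<exists>s. is_run g h p 0 s" by (auto simp: is_run_def)
qed (use run_extend in blast)

lemma run_unique:
  assumes "is_run g h p n s" "is_run g h p m t"
  shows "i \<le> n \<longrightarrow> i \<le> m \<longrightarrow> app s i = app t i"
proof (rule dec_induct[where p = "\<lambda>i. i \<le> n \<longrightarrow> i \<le> m \<longrightarrow> app s i = app t i"])
  show "dec (\<lambda>\<rho>. \<rho> 0 \<le> n \<longrightarrow> \<rho> 0 \<le> m \<longrightarrow> app s (\<rho> 0) = app t (\<rho> 0))" by (intro def_intros)
qed (use assms in \<open>auto simp: is_run_def m_Suc_le[symmetric]\<close>)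

lemma is_run_prim_rec: "is_run g h p n s \<Longrightarrow> i \<le> n \<Longrightarrow> app s i = prim_rec g h p i"
  unfolding prim_rec_def using run_unique[OF _ someI_ex[OF run_exists[of p i]]] by blast

lemma prim_rec_0: "prim_rec g h p 0 = g p"
  using run_exists[of p 0] is_run_prim_rec[of p 0 _ 0] unfolding is_run_def by auto

lemma prim_rec_Suc: "prim_rec g h p (n + 1) = h p n (prim_rec g h p n)"
proof -
  obtain s where s: "is_run g h p (n + 1) s" using run_exists by blast
  then have "app s (n + 1) = h p n (app s n)" unfolding is_run_def by (simp add: m_less_Suc_le)
  then show ?thesis using is_run_prim_rec[OF s] by simp
qed

lemma rec_prim_rec: "rec p \<Longrightarrow> rec n \<Longrightarrow> rec (\<lambda>\<rho>. prim_rec g h (p \<rho>) (n \<rho>))"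
proof (rule rec_comp2[where h = "prim_rec g h"])
  show "rec (\<lambda>\<rho>. prim_rec g h (\<rho> 0) (\<rho> (Suc 0)))"
  proof (rule rec_graph)
    show "SIG (\<lambda>\<rho>. (\<lambda>y \<rho>. \<exists>s. is_run g h (\<rho> 0) (\<rho> (Suc 0)) s \<and>
        app s (\<rho> (Suc 0)) = y) (\<rho> 0) (\<lambda>n. \<rho> (Suc n)))"
      by (rule SIG_ex, rule SIG_dec) (intro def_intros dec_is_run)
    show "(\<exists>s. is_run g h (\<rho> 0) (\<rho> (Suc 0)) s \<and> app s (\<rho> (Suc 0)) = y) \<longleftrightarrow>
        y = prim_rec g h (\<rho> 0) (\<rho> (Suc 0))" for y \<rho>
      using is_run_prim_rec[OF _ order_refl] run_exists by metis
  qed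
qed

end

text \<open>The bound is the code that belongs to the product of all the moduli.\<close>

lemma code_bound: "\<exists>b. \<forall>P. dec (\<lambda>\<rho>. P (\<rho> 0)) \<longrightarrow> (\<exists>c<b. \<forall>i. eps i c \<longleftrightarrow> i < N \<and> P i)"
proof -
  obtain m where m: "m \<noteq> 0" "\<And>i. i < N \<Longrightarrow> (i + 1) dvd m" using common_multiple by blast
  let ?W = "prim_rec (\<lambda>p. 1) (\<lambda>p i y. y * (p * (i + 1) + 1))"
  have g: "rec (\<lambda>\<rho>. 1)" and h: "rec (\<lambda>\<rho>. \<rho> (Suc (Suc 0)) * (\<rho> 0 * (\<rho> (Suc 0) + 1) + 1))"
    by (intro def_intros)+
  note W0 = prim_rec_0[OF g h] and WS = prim_rec_Suc[OF g h]
  have "\<exists>c<pr N (pr m (?W m N)) + 1. \<forall>i. eps i c \<longleftrightarrow> i < N \<and> P i" if "dec (\<lambda>\<rho>. P (\<rho> 0))" for P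
  proof -
    have "\<exists>n. n \<le> ?W m N \<and> (\<forall>i<N. (m * (i + 1) + 1) dvd n \<longleftrightarrow> P i)"
    proof (rule code_exists_with[OF that m, where B = "\<lambda>n u. n \<le> ?W m u"])
      show "dec (\<lambda>\<rho>. \<rho> 0 \<le> ?W m (\<rho> (Suc 0)))" by (intro def_intros rec_prim_rec[OF g h])
      show "1 \<le> ?W m 0" unfolding W0 by simp
      show "n * (m * (u + 1) + 1) \<le> ?W m (u + 1)" if "n \<le> ?W m u" for n u
        unfolding WS using that by (intro m_mult_mono order_refl)
      show "n \<le> ?W m (u + 1)" if "n \<le> ?W m u" for n u
      proof -
        have "n * 1 \<le> ?W m u * (m * (u + 1) + 1)" using that by (intro m_mult_mono) simp_all
        then show ?thesis unfolding WS by simp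
      qed
    qed
    then obtain n where "n \<le> ?W m N" "\<forall>i<N. (m * (i + 1) + 1) dvd n \<longleftrightarrow> P i" by blast
    then have "pr N (pr m n) < pr N (pr m (?W m N)) + 1" "\<forall>i. eps i (pr N (pr m n)) \<longleftrightarrow> i < N \<and> P i"
      unfolding eps_iff m_less_Suc_le by (auto intro!: pr_mono)
    then show ?thesis by blast
  qed
  then show ?thesis by blast
qed

text \<open>Minimization makes a selection definable: the least solution is unique, so its graph is
  decidable.\<close>

lemma rec_least:
  assumes P: "dec (\<lambda>\<rho>. P (\<rho> 0) (\<rho> (Suc 0)))" and ex: "\<And>x. \<exists>y. P x y"
  shows "\<exists>f. rec (\<lambda>\<rho>. f (\<rho> 0)) \<and> (\<forall>x. P x (f x) \<and> (\<forall>y<f x. \<not> P x y))"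
proof -
  define Q where "Q x y \<longleftrightarrow> P x y \<and> (\<forall>z<y. \<not> P x z)" for x y
  have "\<exists>y. Q x y" for x
  proof -
    obtain a where "P x a" using ex by blast
    moreover have "dec (\<lambda>\<rho>. P x (\<rho> 0))" by (intro dec_comp2[OF P] def_intros)
    ultimately show ?thesis using least_exists[of "P x" a] unfolding Q_def by blast
  qed
  then obtain f where f: "\<And>x. Q x (f x)" by metis
  have u: "y = f x" if "Q x y" for x y
    using that f[of x] unfolding Q_def by (metis linorder_neqE)
  have "SIG (\<lambda>\<rho>. (\<lambda>y \<rho>. Q (\<rho> 0) y) (\<rho> 0) (\<lambda>n. \<rho> (Suc n)))"
    unfolding Q_def by (intro SIG_dec def_intros dec_comp2[OF P])
  then have "rec (\<lambda>\<rho>. f (\<rho> 0))" by (rule rec_graph) (use f u in blast)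
  then show ?thesis using f unfolding Q_def by blast
qed

section \<open>Counting\<close>

text \<open>Cardinality as a number of the model. A coded set may be infinite from outside, so the
  counting facts below are proved by induction in the model.\<close>

definition cnt :: "mnum \<Rightarrow> mnum \<Rightarrow> mnum" where
  "cnt = prim_rec (\<lambda>c. 0) (\<lambda>c i y. if eps i c then y + 1 else y)"

lemma cnt_rec_aux:
  "rec (\<lambda>\<rho>. 0)" "rec (\<lambda>\<rho>. if eps (\<rho> (Suc 0)) (\<rho> 0) then \<rho> (Suc (Suc 0)) + 1 else \<rho> (Suc (Suc 0)))"
  by (intro def_intros)+

lemma cnt_0 [simp]: "cnt c 0 = 0"
  unfolding cnt_def by (rule prim_rec_0[OF cnt_rec_aux])

lemma cnt_Suc: "cnt c (j + 1) = (if eps j c then cnt c j + 1 else cnt c j)"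
  unfolding cnt_def by (rule prim_rec_Suc[OF cnt_rec_aux])

lemma rec_cnt [def_intros]: "rec f \<Longrightarrow> rec g \<Longrightarrow> rec (\<lambda>\<rho>. cnt (f \<rho>) (g \<rho>))"
  unfolding cnt_def by (rule rec_prim_rec[OF cnt_rec_aux])

lemma cnt_union:
  assumes "\<And>i. i < j \<Longrightarrow> eps i c \<Longrightarrow> eps i c' \<or> eps i c''"
  shows "cnt c j \<le> cnt c' j + cnt c'' j"
proof -
  have "k \<le> j \<longrightarrow> cnt c k \<le> cnt c' k + cnt c'' k" for k
  proof (rule dec_induct[where p = "\<lambda>k. k \<le> j \<longrightarrow> cnt c k \<le> cnt c' k + cnt c'' k"])
    show "dec (\<lambda>\<rho>. \<rho> 0 \<le> j \<longrightarrow> cnt c (\<rho> 0) \<le> cnt c' (\<rho> 0) + cnt c'' (\<rho> 0))" by (intro def_intros)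
    fix k assume IH: "k \<le> j \<longrightarrow> cnt c k \<le> cnt c' k + cnt c'' k"
    show "k + 1 \<le> j \<longrightarrow> cnt c (k + 1) \<le> cnt c' (k + 1) + cnt c'' (k + 1)"
    proof
      assume "k + 1 \<le> j"
      then have k: "k < j" by (simp add: m_Suc_le)
      then have *: "cnt c k \<le> cnt c' k + cnt c'' k" using IH by simp
      have "cnt c (k + 1) \<le> (cnt c' k + cnt c'' k) + (if eps k c then 1 else 0)"
        using * by (simp add: cnt_Suc)
      also have "\<dots> \<le> cnt c' (k + 1) + cnt c'' (k + 1)"
        using assms[OF k] unfolding cnt_Suc by (auto simp: ac_simps intro: add_increasing)
      finally show "cnt c (k + 1) \<le> cnt c' (k + 1) + cnt c'' (k + 1)" .
    qed
  qed simp
  then show ?thesis by blast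
qed

lemma cnt_empty: "(\<And>i. i < j \<Longrightarrow> \<not> eps i c) \<Longrightarrow> cnt c j = 0"
proof -
  assume *: "\<And>i. i < j \<Longrightarrow> \<not> eps i c"
  have "k \<le> j \<longrightarrow> cnt c k = 0" for k
  proof (rule dec_induct[where p = "\<lambda>k. k \<le> j \<longrightarrow> cnt c k = 0"])
    show "dec (\<lambda>\<rho>. \<rho> 0 \<le> j \<longrightarrow> cnt c (\<rho> 0) = 0)" by (intro def_intros)
  qed (use * in \<open>simp_all add: cnt_Suc m_Suc_le[symmetric]\<close>)
  then show ?thesis by blast
qed

lemma cnt_full: "(\<And>i. i < j \<Longrightarrow> eps i c) \<Longrightarrow> cnt c j = j"
proof -
  assume *: "\<And>i. i < j \<Longrightarrow> eps i c"
  have "k \<le> j \<longrightarrow> cnt c k = k" for k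
  proof (rule dec_induct[where p = "\<lambda>k. k \<le> j \<longrightarrow> cnt c k = k"])
    show "dec (\<lambda>\<rho>. \<rho> 0 \<le> j \<longrightarrow> cnt c (\<rho> 0) = \<rho> 0)" by (intro def_intros)
  qed (use * in \<open>simp_all add: cnt_Suc m_Suc_le[symmetric]\<close>)
  then show ?thesis by blast
qed

lemma cnt_le_1:
  assumes "\<And>i k. i < j \<Longrightarrow> k < i \<Longrightarrow> eps i c \<Longrightarrow> eps k c \<Longrightarrow> False"
  shows "cnt c j \<le> 1"
proof -
  have "k \<le> j \<longrightarrow> cnt c k \<le> 1" for k
  proof (rule dec_induct[where p = "\<lambda>k. k \<le> j \<longrightarrow> cnt c k \<le> 1"])
    show "dec (\<lambda>\<rho>. \<rho> 0 \<le> j \<longrightarrow> cnt c (\<rho> 0) \<le> 1)" by (intro def_intros)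
    fix k assume IH: "k \<le> j \<longrightarrow> cnt c k \<le> 1"
    show "k + 1 \<le> j \<longrightarrow> cnt c (k + 1) \<le> 1"
    proof
      assume "k + 1 \<le> j"
      then have k: "k < j" by (simp add: m_Suc_le)
      show "cnt c (k + 1) \<le> 1"
      proof (cases "eps k c")
        case True
        then have "cnt c k = 0" using assms[OF k] by (intro cnt_empty) blast
        then show ?thesis by (simp add: cnt_Suc)
      qed (use IH k in \<open>simp add: cnt_Suc\<close>)
    qed
  qed simp
  then show ?thesis by blast
qed

lemma cnt_insert:
  assumes "x < j" "\<not> eps x c" "\<And>i. i < j \<Longrightarrow> eps i c' \<longleftrightarrow> eps i c \<or> i = x"
  shows "cnt c' j = cnt c j + 1"
proof -
  have "k \<le> j \<longrightarrow> cnt c' k = cnt c k + (if x < k then 1 else 0)" for k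
  proof (rule dec_induct[where p = "\<lambda>k. k \<le> j \<longrightarrow> cnt c' k = cnt c k + (if x < k then 1 else 0)"])
    show "dec (\<lambda>\<rho>. \<rho> 0 \<le> j \<longrightarrow> cnt c' (\<rho> 0) = cnt c (\<rho> 0) + (if x < \<rho> 0 then 1 else 0))"
      by (intro def_intros)
    fix k assume IH: "k \<le> j \<longrightarrow> cnt c' k = cnt c k + (if x < k then 1 else 0)"
    show "k + 1 \<le> j \<longrightarrow> cnt c' (k + 1) = cnt c (k + 1) + (if x < k + 1 then 1 else 0)"
    proof
      assume "k + 1 \<le> j"
      then have k: "k < j" by (simp add: m_Suc_le)
      show "cnt c' (k + 1) = cnt c (k + 1) + (if x < k + 1 then 1 else 0)"
        using IH k assms(2) assms(3)[OF k] unfolding cnt_Suc m_less_Suc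
        by (cases "k = x") (auto simp: ac_simps)
    qed
  qed simp
  from this[of j] assms(1) show ?thesis by simp
qed

text \<open>The union of the first \<open>u\<close> fibres is bounded by induction on
  \<open>u\<close>. The induction hypothesis speaks of all codes of subsets of this union, so it is
  Pi-1.\<close>

lemma cnt_fibres:
  assumes f: "rec (\<lambda>\<rho>. f (\<rho> 0))" and a: "\<And>i. i < j \<Longrightarrow> eps i c \<Longrightarrow> f i < a"
    and b: "\<And>v c'. v < a \<Longrightarrow> (\<And>i. eps i c' \<longleftrightarrow> i < j \<and> eps i c \<and> f i = v) \<Longrightarrow> cnt c' j \<le> b"
  shows "cnt c j \<le> a * b"
proof -
  define p where "p u \<longleftrightarrow> (\<forall>c'. u \<le> a \<and> (\<forall>i<j. eps i c' \<longrightarrow> eps i c \<and> f i < u) \<longrightarrow> cnt c' j \<le> u * b)" for u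
  have "p u" for u
  proof (rule pi_induct[where p = p])
    show "SIG (\<lambda>\<rho>. \<not> p (\<rho> 0))" unfolding p_def not_all
      by (rule SIG_ex, rule SIG_dec) (intro def_intros rec_comp1[OF f])
    show "p 0" unfolding p_def by (auto simp: cnt_empty)
    fix u assume IH: "p u"
    show "p (u + 1)" unfolding p_def
    proof (intro allI impI, elim conjE)
      fix c' assume c': "u + 1 \<le> a" "\<forall>i<j. eps i c' \<longrightarrow> eps i c \<and> f i < u + 1"
      then have u: "u < a" by (simp add: m_Suc_le)
      have "dec (\<lambda>\<rho>. eps (\<rho> 0) c' \<and> f (\<rho> 0) < u)" "dec (\<lambda>\<rho>. eps (\<rho> 0) c \<and> f (\<rho> 0) = u)"
        by (intro def_intros rec_comp1[OF f])+
      from code_exists[of "\<lambda>i. eps i c' \<and> f i < u", OF this(1)] code_exists[of "\<lambda>i. eps i c \<and>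
          f i = u", OF this(2)]
      obtain c1 c2 where c1: "\<And>i. eps i c1 \<longleftrightarrow> i < j \<and> eps i c' \<and> f i < u"
        and c2: "\<And>i. eps i c2 \<longleftrightarrow> i < j \<and> eps i c \<and> f i = u" by blast
      have "cnt c' j \<le> cnt c1 j + cnt c2 j"
        using c'(2) unfolding m_less_Suc by (intro cnt_union) (auto simp: c1 c2)
      also have "\<dots> \<le> u * b + b"
      proof (rule add_mono)
        show "cnt c1 j \<le> u * b" using IH c'(2) u unfolding p_def by (auto simp: c1)
        show "cnt c2 j \<le> b" using b[OF u] c2 by blast
      qed
      finally show "cnt c' j \<le> (u + 1) * b" by (simp add: distrib_right)
    qed
  qed
  then have "p a" .
  then show ?thesis unfolding p_def using a by auto
qed

text \<open>Without a collision every fibre would have at most one element, and \<open>a + 1\<close>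
  arguments would be counted by \<open>a\<close>.\<close>

lemma pigeonhole:
  assumes f: "rec (\<lambda>\<rho>. f (\<rho> 0))" and a: "\<And>i. i < a + 1 \<Longrightarrow> f i < a"
  shows "\<exists>i k. k < i \<and> i < a + 1 \<and> f i = f k"
proof (rule ccontr)
  assume *: "\<not> ?thesis"
  have "dec (\<lambda>\<rho>. True)" by (intro def_intros)
  from code_exists[of "\<lambda>_. True" "a + 1", OF this] obtain c where c: "\<And>i. eps i c \<longleftrightarrow> i < a + 1" by auto
  have "cnt c (a + 1) \<le> a * 1"
  proof (rule cnt_fibres[OF f])
    show "f i < a" if "i < a + 1" "eps i c" for i using a that by blast
    fix v c' assume v: "v < a" "\<And>i. eps i c' \<longleftrightarrow> i < a + 1 \<and> eps i c \<and> f i = v"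
    show "cnt c' (a + 1) \<le> 1" by (rule cnt_le_1) (use * v(2) in metis)
  qed
  moreover have "cnt c (a + 1) = a + 1" by (rule cnt_full) (simp add: c)
  ultimately show False by (simp add: m_Suc_le[symmetric])
qed

lemma cnt_nonempty: "cnt c j \<noteq> 0 \<Longrightarrow> \<exists>i<j. eps i c"
  using cnt_empty by blast

lemma cnt_another:
  assumes "1 < cnt c j"
  shows "\<exists>i<j. eps i c \<and> i \<noteq> x"
proof (rule ccontr)
  assume *: "\<not> ?thesis"
  have "cnt c j \<le> 1" by (rule cnt_le_1) (use * less_trans in blast)
  with assms show False by simp
qed

text \<open>Taking the least element rather than any element keeps it outside all segments between
  the remaining ones.\<close>

lemma remove_min:
  assumes "n + 1 \<le> cnt c j"
  shows "\<exists>x c'. x < j \<and> eps x c \<and> (\<forall>i. eps i c' \<longleftrightarrow> i < j \<and> eps i c \<and> i \<noteq> x) \<and>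
    (\<forall>i<j. eps i c' \<longrightarrow> x < i) \<and> n \<le> cnt c' j"
proof -
  have "cnt c j \<noteq> 0" using assms m_Suc_le[of n "cnt c j"] by auto
  then obtain i where i: "i < j" "eps i c" using cnt_nonempty by blast
  have "dec (\<lambda>\<rho>. eps (\<rho> 0) c)" by (intro def_intros)
  from least_exists[of "\<lambda>x. eps x c", OF this i(2)]
  obtain x where x: "x \<le> i" "eps x c" "\<forall>y<x. \<not> eps y c" by blast
  then have xj: "x < j" using i by auto
  have "dec (\<lambda>\<rho>. eps (\<rho> 0) c \<and> \<rho> 0 \<noteq> x)" by (intro def_intros)
  from code_exists[of "\<lambda>i. eps i c \<and> i \<noteq> x", OF this]
  obtain c' where c': "\<And>i. eps i c' \<longleftrightarrow> i < j \<and> eps i c \<and> i \<noteq> x" by blast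
  have "cnt c j = cnt c' j + 1" by (rule cnt_insert[OF xj]) (use x xj c' in auto)
  then have "n \<le> cnt c' j" using assms by simp
  moreover have "\<forall>i<j. eps i c' \<longrightarrow> x < i" using x(3) c' by (metis linorder_neqE)
  ultimately show ?thesis using x xj c' by blast
qed

text \<open>It is applied below only to a fixed \<open>N\<close>, where it acts as a parameter; the
  choice need not be a recursive function of \<open>N\<close>.\<close>

definition bnd :: "mnum \<Rightarrow> mnum" where
  "bnd N = (SOME b. \<forall>P. dec (\<lambda>\<rho>. P (\<rho> 0)) \<longrightarrow> (\<exists>c<b. \<forall>i. eps i c \<longleftrightarrow> i < N \<and> P i))"

lemma bnd: "dec (\<lambda>\<rho>. P (\<rho> 0)) \<Longrightarrow> \<exists>c<bnd N. \<forall>i. eps i c \<longleftrightarrow> i < N \<and> P i"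
  using someI_ex[OF code_bound[of N]] unfolding bnd_def by blast

text \<open>A Mirsky argument: the height of a point is the size of the longest chain that ends there, and
  points of equal height form an antichain.\<close>

lemma chain_or_antichain:
  assumes R: "dec (\<lambda>\<rho>. R (\<rho> 0) (\<rho> (Suc 0)))"
    and trans: "\<And>x y z. x < y \<Longrightarrow> y < z \<Longrightarrow> z < N \<Longrightarrow> eps x I \<Longrightarrow> eps y I \<Longrightarrow> eps z I \<Longrightarrow> R x y \<Longrightarrow> R y z \<Longrightarrow> R x z"
    and card: "(n + 1) * (n + 1) \<le> cnt I N"
  shows "\<exists>I'. (\<forall>i. eps i I' \<longrightarrow> i < N \<and> eps i I) \<and> n + 1 \<le> cnt I' N \<and>
    ((\<forall>x y. x < y \<longrightarrow> eps x I' \<longrightarrow> eps y I' \<longrightarrow> R x y) \<or> (\<forall>x y. x < y \<longrightarrow> eps x I' \<longrightarrow> eps y I' \<longrightarrow> \<not> R x y))"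
proof (rule ccontr)
  assume neg: "\<not> ?thesis"
  \<comment> \<open>\<open>C\<close> is a chain with largest element \<open>c\<close> and at least
    \<open>s\<close> elements. Elements of a code are smaller than the code, so the clause over
    \<open>x < C\<close> says that \<open>C\<close> has no elements from \<open>N\<close> on, and
    \<open>Q\<close> is decidable.\<close>
  define Q where "Q c s \<longleftrightarrow> (\<exists>C<bnd N. eps c C \<and> (\<forall>x<N. eps x C \<longrightarrow> eps x I \<and> x \<le> c) \<and>
    (\<forall>x<N. \<forall>y<N. x < y \<longrightarrow> eps x C \<longrightarrow> eps y C \<longrightarrow> R x y) \<and> (\<forall>x<C. eps x C \<longrightarrow> x < N) \<and> s \<le> cnt C N)" for c s
  have dQ: "dec (\<lambda>\<rho>. Q (\<rho> 0) (\<rho> (Suc 0)))"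
    unfolding Q_def by (intro def_intros dec_comp2[OF R])
  have QI: "Q c s" if "dec (\<lambda>\<rho>. P (\<rho> 0))" "P c" "c < N" "\<And>x. x < N \<Longrightarrow> P x \<Longrightarrow> eps x I \<and> x \<le> c"
    "\<And>x y. x < y \<Longrightarrow> y < N \<Longrightarrow> P x \<Longrightarrow> P y \<Longrightarrow> R x y" "\<And>C. (\<And>i. eps i C \<longleftrightarrow> i < N \<and> P i) \<Longrightarrow> s \<le> cnt C N" for P c s
  proof -
    note a = that
    obtain C where "C < bnd N" "\<And>i. eps i C \<longleftrightarrow> i < N \<and> P i" using bnd[OF a(1)] by blast
    then show ?thesis unfolding Q_def using a by (intro exI[of _ C]) auto
  qed
  have nQ: "\<not> Q c (n + 1)" for c
  proof
    assume "Q c (n + 1)"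
    then obtain C where "\<forall>x<N. eps x C \<longrightarrow> eps x I \<and> x \<le> c" "\<forall>x<C. eps x C \<longrightarrow> x < N"
      "\<forall>x<N. \<forall>y<N. x < y \<longrightarrow> eps x C \<longrightarrow> eps y C \<longrightarrow> R x y" "n + 1 \<le> cnt C N" unfolding Q_def by blast
    then show False using neg eps_less by metis
  qed
  have "dec (\<lambda>\<rho>. \<not> Q (\<rho> 0) (\<rho> (Suc 0) + 1))" by (intro def_intros dec_comp2[OF dQ])
  \<comment> \<open>The least \<open>s\<close> such that no chain of \<open>s + 1\<close> elements
    ends at \<open>c\<close>: for \<open>c\<close> in \<open>I\<close> this is the height of
    \<open>c\<close>.\<close>
  from rec_least[of "\<lambda>c s. \<not> Q c (s + 1)", OF this] nQ
  obtain f where f: "rec (\<lambda>\<rho>. f (\<rho> 0))" "\<And>c. \<not> Q c (f c + 1)" "\<And>c s. s < f c \<Longrightarrow> Q c (s + 1)" by blast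
  have fn: "f c < n + 1" for c
    using f(3)[of n c] nQ[of c] by (metis linorder_not_less m_less_Suc_le)
  have Qf: "Q c (f c)" if "eps c I" "c < N" for c
  proof (cases "f c" rule: m_cases)
    case 1
    have "dec (\<lambda>\<rho>. \<rho> 0 = c)" by (intro def_intros)
    then have "Q c 0" by (rule QI[of "\<lambda>x. x = c"]) (use that in auto)
    with 1 show ?thesis by simp
  next
    case (2 s) then show ?thesis using f(3)[of s c] by simp
  qed
  \<comment> \<open>Appending \<open>c'\<close> to a longest chain that ends at \<open>c\<close>
    shows that \<open>c'\<close> has greater height.\<close>
  have neq: "f c \<noteq> f c'" if c: "c < c'" "c' < N" "eps c I" "eps c' I" "R c c'" for c c'
  proof
    assume eq: "f c = f c'"
    have cN: "c < N" using c by simp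
    from Qf[OF c(3) cN] obtain C where C: "eps c C" "\<forall>x<N. eps x C \<longrightarrow> eps x I \<and> x \<le> c"
      "\<forall>x<N. \<forall>y<N. x < y \<longrightarrow> eps x C \<longrightarrow> eps y C \<longrightarrow> R x y" "f c \<le> cnt C N" unfolding Q_def by blast
    have "Q c' (f c + 1)"
    proof (rule QI[of "\<lambda>x. eps x C \<or> x = c'"])
      show "dec (\<lambda>\<rho>. eps (\<rho> 0) C \<or> \<rho> 0 = c')" by (intro def_intros)
      show "eps x I \<and> x \<le> c'" if "x < N" "eps x C \<or> x = c'" for x
        using that C(2) c by (auto dest: order_trans[of _ c c'])
      have le: "x \<le> c" if "x < N" "eps x C" for x using that C(2) by blast
      show "R x y" if xy: "x < y" "y < N" "eps x C \<or> x = c'" "eps y C \<or> y = c'" for x y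
      proof -
        have "x < N" using xy by simp
        have "x \<noteq> c'" using xy le[of y] c(1) by (auto dest: less_trans)
        then have xC: "eps x C" using xy by blast
        show ?thesis
        proof (cases "eps y C")
          case True then show ?thesis using C(3) xC xy \<open>x < N\<close> by blast
        next
          case False
          then have y: "y = c'" using xy by blast
          show ?thesis
          proof (cases "x = c")
            case False
            then have "x < c" using le[OF \<open>x < N\<close> xC] by simp
            moreover have "R x c" using C(1,3) xC \<open>x < N\<close> cN \<open>x < c\<close> by blast
            ultimately show ?thesis using trans[of x c c'] c C(2) xC \<open>x < N\<close> y by blast
          qed (use c y in simp)
        qed
      qed
      fix D assume D: "\<And>i. eps i D \<longleftrightarrow> i < N \<and> (eps i C \<or> i = c')"
      have "\<not> eps c' C" using le[of c'] c by auto
      then have "cnt D N = cnt C N + 1" by (intro cnt_insert[OF c(2)]) (auto simp: D)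
      then show "f c + 1 \<le> cnt D N" using C(4) by simp
    qed (use c in auto)
    with f(2)[of c'] eq show False by simp
  qed
  \<comment> \<open>There are at most \<open>n + 1\<close> heights, and each class of equal height
    is an antichain, of at most \<open>n\<close> elements by \<open>neg\<close>.\<close>
  have "cnt I N \<le> (n + 1) * n"
  proof (rule cnt_fibres[OF f(1)])
    fix v c' assume v: "\<And>i. eps i c' \<longleftrightarrow> i < N \<and> eps i I \<and> f i = v"
    have "\<not> R x y" if "x < y" "eps x c'" "eps y c'" for x y using neq[of x y] that v by auto
    then have "\<not> n + 1 \<le> cnt c' N" using neg v by blast
    then show "cnt c' N \<le> n" by (simp add: not_le m_less_Suc_le)
  qed (rule fn)
  with card have "(n + 1) * (n + 1) \<le> (n + 1) * n" by (rule order_trans)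
  then have "(n + 1) * n + n + 1 \<le> (n + 1) * n" by (simp add: algebra_simps)
  then show False using m_less_add[of "(n + 1) * n" n] by (simp add: leD)
qed

section \<open>Induced paths in graphs without four-cycles\<close>

locale fgraph =
  fixes N :: mnum and E :: "mnum \<Rightarrow> mnum \<Rightarrow> bool"
  assumes E_dec: "dec (\<lambda>\<rho>. E (\<rho> 0) (\<rho> (Suc 0)))"
    and E_sym: "E i j \<Longrightarrow> E j i"
begin

lemmas dec_E [def_intros] = dec_comp2[OF E_dec]

text \<open>\<open>con W c d\<close>: \<open>c\<close> and \<open>d\<close> are connected in the subgraph induced on \<open>W\<close>. Every definable subset of
  \<open>{i. i < N}\<close> has a code below \<open>bnd N\<close>, so the quantifier over sets can be bounded.\<close>

definition con :: "(mnum \<Rightarrow> bool) \<Rightarrow> mnum \<Rightarrow> mnum \<Rightarrow> bool" where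
  "con W c d \<longleftrightarrow> c < N \<and> d < N \<and> W c \<and> W d \<and> (\<forall>X<bnd N. eps c X \<longrightarrow>
     (\<forall>i<N. \<forall>j<N. eps i X \<longrightarrow> W i \<longrightarrow> W j \<longrightarrow> E i j \<longrightarrow> eps j X) \<longrightarrow> eps d X)"

lemma dec_con [def_intros]:
  assumes W: "dec (\<lambda>\<rho>. W (\<rho> 0) (\<lambda>n. \<rho> (Suc n)))" and c: "rec c" and d: "rec d"
  shows "dec (\<lambda>\<rho>. con (\<lambda>i. W i \<rho>) (c \<rho>) (d \<rho>))"
proof -
  have W0: "dec (\<lambda>\<rho>. W (\<rho> 0) (\<lambda>n. \<rho> (Suc (Suc (Suc n)))))"
    using dec_env[OF W, of "\<lambda>\<rho>. case_nat (\<rho> 0) (\<lambda>n. \<rho> (Suc (Suc (Suc n))))"]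
        by (simp add: Tm_case_nat Tm_var)
  have W1: "dec (\<lambda>\<rho>. W (\<rho> (Suc 0)) (\<lambda>n. \<rho> (Suc (Suc (Suc n)))))"
    using dec_env[OF W, of "\<lambda>\<rho>. case_nat (\<rho> (Suc 0)) (\<lambda>n. \<rho> (Suc (Suc (Suc n))))"]
        by (simp add: Tm_case_nat Tm_var)
  show ?thesis unfolding con_def
    by (intro def_intros c d rec_lift[OF c] rec_lift[OF d] W0 W1 dec_rec[of W, OF W])
qed

text \<open>Although \<open>con\<close> quantifies over codes below \<open>bnd N\<close>, any
  decidable property may serve as invariant, since its part below \<open>N\<close> has such a
  code.\<close>

lemma con_induct:
  assumes "con W c d" "dec (\<lambda>\<rho>. P (\<rho> 0))" "P c"
    and "\<And>i j. i < N \<Longrightarrow> j < N \<Longrightarrow> P i \<Longrightarrow> W i \<Longrightarrow> W j \<Longrightarrow> E i j \<Longrightarrow> P j"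
  shows "P d"
proof -
  obtain X where X: "X < bnd N" "\<And>i. eps i X \<longleftrightarrow> i < N \<and> P i" using bnd[OF assms(2)] by blast
  have "eps c X" using assms(1,3) X(2) unfolding con_def by blast
  moreover have "\<forall>i<N. \<forall>j<N. eps i X \<longrightarrow> W i \<longrightarrow> W j \<longrightarrow> E i j \<longrightarrow> eps j X"
    using assms(4) X(2) by blast
  ultimately have "eps d X" using assms(1) X(1) unfolding con_def by blast
  then show ?thesis using X(2) by blast
qed

lemma con_in: "con W c d \<Longrightarrow> c < N \<and> d < N \<and> W c \<and> W d"
  unfolding con_def by blast

lemma con_I:
  assumes "c < N" "d < N" "W c" "W d"
    and "\<And>P. dec (\<lambda>\<rho>. P (\<rho> 0)) \<Longrightarrow> P c \<Longrightarrow>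
      (\<And>i j. i < N \<Longrightarrow> j < N \<Longrightarrow> P i \<Longrightarrow> W i \<Longrightarrow> W j \<Longrightarrow> E i j \<Longrightarrow> P j) \<Longrightarrow> P d"
  shows "con W c d"
  unfolding con_def
proof (intro conjI assms(1-4) allI impI)
  fix X assume X: "eps c X" "\<forall>i<N. \<forall>j<N. eps i X \<longrightarrow> W i \<longrightarrow> W j \<longrightarrow> E i j \<longrightarrow> eps j X"
  have "dec (\<lambda>\<rho>. eps (\<rho> 0) X)" by (intro def_intros)
  from assms(5)[of "\<lambda>i. eps i X", OF this] X show "eps d X" by blast
qed

lemma con_mono: "con W c d \<Longrightarrow> (\<And>i. i < N \<Longrightarrow> W i \<Longrightarrow> W' i) \<Longrightarrow> con W' c d"
  unfolding con_def by blast

lemma con_refl: "c < N \<Longrightarrow> W c \<Longrightarrow> con W c c"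
  unfolding con_def by blast

lemma con_trans:
  assumes "con W c d" "con W d e"
  shows "con W c e"
proof (rule con_I)
  fix P assume P: "dec (\<lambda>\<rho>. P (\<rho> 0))" "P c" "\<And>i j. i < N \<Longrightarrow> j < N \<Longrightarrow> P i \<Longrightarrow> W i \<Longrightarrow> W j \<Longrightarrow> E i j \<Longrightarrow> P j"
  have "P d" by (rule con_induct[OF assms(1) P])
  then show "P e" by (rule con_induct[OF assms(2) P(1) _ P(3)])
qed (use assms con_in in blast)+

text \<open>Edges are symmetric, so the complement of an invariant set is again invariant.\<close>

lemma con_sym:
  assumes "con W c d"
  shows "con W d c"
proof (rule con_I)
  fix P assume P: "dec (\<lambda>\<rho>. P (\<rho> 0))" "P d" "\<And>i j. i < N \<Longrightarrow> j < N \<Longrightarrow> P i \<Longrightarrow> W i \<Longrightarrow> W j \<Longrightarrow> E i j \<Longrightarrow> P j"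
  show "P c"
  proof (rule ccontr)
    assume nc: "\<not> P c"
    have "dec (\<lambda>\<rho>. \<not> P (\<rho> 0))" by (intro dec_not P(1))
    from con_induct[OF assms, of "\<lambda>i. \<not> P i", OF this nc] have "\<not> P d" using P(3) E_sym by blast
    with P(2) show False by blast
  qed
qed (use assms con_in in blast)+

lemma con_edge: "c < N \<Longrightarrow> d < N \<Longrightarrow> W c \<Longrightarrow> W d \<Longrightarrow> E c d \<Longrightarrow> con W c d"
  by (rule con_I) blast+

text \<open>A connection from \<open>Z\<close> to a point outside leaves \<open>Z\<close> for the
  last time along an edge from \<open>z\<close> to \<open>y\<close>. No path is constructed for
  this.\<close>

lemma last_exit:
  assumes U: "dec (\<lambda>\<rho>. U (\<rho> 0))" and Z: "dec (\<lambda>\<rho>. Z (\<rho> 0))"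
    and con: "con U u d" and "Z u" "\<not> Z d"
  shows "\<exists>z<N. \<exists>y<N. U z \<and> Z z \<and> E z y \<and> con (\<lambda>i. U i \<and> \<not> Z i) y d"
proof (rule ccontr)
  let ?W = "\<lambda>i. U i \<and> \<not> Z i"
  assume neg: "\<not> ?thesis"
  have "con ?W u d"
  \<comment> \<open>Without such an edge, the vertices connected to \<open>d\<close> outside
    \<open>Z\<close> are closed under edges of \<open>U\<close>; they contain \<open>d\<close> and
    therefore \<open>u\<close>, which lies in \<open>Z\<close>.\<close>
  proof (rule con_induct[OF con_sym[OF con], where P = "\<lambda>i. con ?W i d"])
    show "dec (\<lambda>\<rho>. con ?W (\<rho> 0) d)"
      by (intro def_intros dec_comp1[OF U] dec_comp1[OF Z])
    show "con ?W d d" using con_in[OF con] assms(5) by (intro con_refl) auto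
    fix i j assume ij: "i < N" "j < N" "con ?W i d" "U i" "U j" "E i j"
    show "con ?W j d"
    proof (cases "Z j")
      case True then show ?thesis using neg ij E_sym by blast
    next
      case False
      then have "con ?W j i" using ij con_in[OF ij(3)] E_sym by (intro con_edge) auto
      then show ?thesis using con_trans ij(3) by blast
    qed
  qed
  then show False using con_in assms(4) by blast
qed

text \<open>The state of Gyarfas' path argument: \<open>V\<close> is an induced path of \<open>j + 1\<close> vertices outside \<open>U\<close>,
  whose last vertex alone has neighbours in \<open>U\<close>, one of them connected to the target \<open>d\<close> in \<open>U\<close>.\<close>

definition gy :: "mnum \<Rightarrow> mnum \<Rightarrow> mnum \<Rightarrow> mnum \<Rightarrow> bool" where
  "gy U V j d \<longleftrightarrow>
    (\<forall>i<j + 1. app V i < N \<and> \<not> eps (app V i) U) \<and>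
    (\<forall>i<j + 1. \<forall>k<i. app V k \<noteq> app V i \<and> (E (app V k) (app V i) \<longleftrightarrow> i = k + 1)) \<and>
    (\<forall>i<j. \<forall>x<N. eps x U \<longrightarrow> \<not> E (app V i) x) \<and>
    (\<exists>u<N. E (app V j) u \<and> con (\<lambda>i. eps i U) u d)"

lemma dec_eps1 [def_intros]: "dec (\<lambda>\<rho>. eps (\<rho> 0) X)"
  by (intro dec_eps rec_var rec_const)

text \<open>The connection from \<open>u\<close> through \<open>d\<close> to \<open>d'\<close>
  leaves the neighbourhood of the last vertex for the last time at some \<open>z\<close>, which
  becomes the new last vertex. As \<open>z\<close> lies in \<open>U\<close>, no earlier vertex is
  adjacent to it.\<close>

lemma gy_step:
  assumes gy: "gy U V j d" and U': "\<And>i. eps i U' \<longleftrightarrow> i < N \<and> eps i U \<and> \<not> E (app V j) i"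
    and d': "eps d' U'" "con (\<lambda>i. eps i U) d d'"
  shows "\<exists>V'. gy U' V' (j + 1) d' \<and> (\<forall>i<j + 1. app V' i = app V i) \<and> eps (app V' (j + 1)) U"
proof -
  let ?v = "app V j"
  from gy obtain u where u: "u < N" "E ?v u" "con (\<lambda>i. eps i U) u d" unfolding gy_def by blast
  have "\<exists>z<N. \<exists>y<N. eps z U \<and> E ?v z \<and> E z y \<and> con (\<lambda>i. eps i U \<and> \<not> E ?v i) y d'"
    by (rule last_exit[OF _ _ con_trans[OF u(3) d'(2)], of "E ?v"]) (intro def_intros,
        intro def_intros, use u d' U' in auto)
  then obtain z y where zy: "z < N" "y < N" "eps z U" "E ?v z" "E z y" "con (\<lambda>i. eps i U \<and>
      \<not> E ?v i) y d'"
    by blast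
  have "con (\<lambda>i. eps i U') y d'" by (rule con_mono[OF zy(6)]) (simp add: U')
  let ?f = "\<lambda>i. if i \<le> j then app V i else z"
  have "rec (\<lambda>\<rho>. ?f (\<rho> 0))" by (intro def_intros)
  from seq_exists[of ?f, OF this, of "j + 1 + 1"] obtain V' where V': "\<And>i. i < j + 1 + 1 \<Longrightarrow>
      app V' i = ?f i" by blast
  have old: "app V' i = app V i" if "i < j + 1" for i
    using that V'[of i] less_trans[OF that less_add_one] by (simp add: m_less_Suc_le)
  have new: "app V' (j + 1) = z" using V'[of "j + 1"] by (simp add: m_Suc_le[symmetric])
  have g1: "app V i < N" "\<not> eps (app V i) U" if "i < j + 1" for i using gy that unfolding gy_def
      by blast+
  have g2: "app V k \<noteq> app V i" "E (app V k) (app V i) \<longleftrightarrow> i = k + 1" if "i < j + 1" "k < i" for i k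
    using gy that unfolding gy_def by blast+
  have g3: "\<not> E (app V i) x" if "i < j" "x < N" "eps x U" for i x using gy that unfolding gy_def
      by blast
  have "gy U' V' (j + 1) d'" unfolding gy_def
  proof (intro conjI allI impI)
    fix i assume i: "i < j + 1 + 1"
    then consider "i < j + 1" | "i = j + 1" unfolding m_less_Suc[of i "j + 1"] by blast
    note cas = this
    from cas show "app V' i < N" by cases (simp_all add: g1 old new zy)
    from cas show "\<not> eps (app V' i) U'" by cases (simp_all add: g1 old new zy U')
    fix k assume k: "k < i"
    from cas have kj: "k < j + 1" by cases (use k in \<open>blast intro: less_trans\<close>, use k in simp)
    from cas show "app V' k \<noteq> app V' i"
    proof cases
      case 1 then show ?thesis using g2(1)[OF 1 k] by (simp add: old kj)
    next
      case 2 then show ?thesis using g1(2)[OF kj] zy(3) old[OF kj] new by auto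
    qed
    from cas show "E (app V' k) (app V' i) \<longleftrightarrow> i = k + 1"
    proof cases
      case 1 then show ?thesis using g2(2)[OF 1 k] by (simp add: old kj)
    next
      case 2
      show ?thesis
      proof (cases "k = j")
        case True then show ?thesis using 2 old[OF kj] new zy by simp
      next
        case False
        then have "k < j" using kj by (simp add: m_less_Suc)
        then show ?thesis using 2 old[OF kj] new g3[of k z] zy False by simp
      qed
    qed
  next
    fix i x assume i: "i < j + 1" "x < N" "eps x U'"
    from i(1) consider "i < j" | "i = j" unfolding m_less_Suc by blast
    then show "\<not> E (app V' i) x" by cases (use old[OF i(1)] g3[of i x] i U' in auto)
  next
    show "\<exists>u<N. E (app V' (j + 1)) u \<and> con (\<lambda>i. eps i U') u d'"
      using new zy \<open>con (\<lambda>i. eps i U') y d'\<close> by blast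
  qed
  with old new zy show ?thesis by auto
qed

text \<open>The last exit from the single vertex \<open>c\<close> supplies a neighbour that stays
  connected to the target without \<open>c\<close>.\<close>

lemma gy_start:
  assumes c: "con W c d" "c \<noteq> d" and W: "dec (\<lambda>\<rho>. W (\<rho> 0))"
    and U: "\<And>i. i < N \<Longrightarrow> W i \<Longrightarrow> i \<noteq> c \<Longrightarrow> eps i U" "\<not> eps c U"
  shows "\<exists>V. app V 0 = c \<and> gy U V 0 d"
proof -
  have "\<exists>z<N. \<exists>y<N. W z \<and> z = c \<and> E z y \<and> con (\<lambda>i. W i \<and> \<not> i = c) y d"
    by (rule last_exit[OF W _ c(1), of "\<lambda>z. z = c"]) (use c in \<open>auto intro!: def_intros\<close>)
  then obtain y where y: "y < N" "E c y" "con (\<lambda>i. W i \<and> \<not> i = c) y d" by blast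
  have "con (\<lambda>i. eps i U) y d" by (rule con_mono[OF y(3)]) (use U in blast)
  moreover have "rec (\<lambda>\<rho>. (\<lambda>i. c) (\<rho> 0))" by (intro def_intros)
  from seq_exists[OF this, of 1] obtain V where "app V 0 = c" using zero_less_one by blast
  moreover have "i < 0 + 1 \<longleftrightarrow> i = 0" for i :: mnum unfolding m_less_Suc by simp
  ultimately show ?thesis using y U(2) con_in[OF c(1)] unfolding gy_def by (intro exI[of _ V]) auto
qed

section \<open>Short connections in the absence of long induced paths\<close>

definition induced_path :: "mnum \<Rightarrow> mnum \<Rightarrow> bool" where
  "induced_path V K \<longleftrightarrow> (\<forall>i<K. app V i < N) \<and>
    (\<forall>i<K. \<forall>k<i. app V k \<noteq> app V i \<and> (E (app V k) (app V i) \<longleftrightarrow> i = k + 1))"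

end

text \<open>The setting of a proof by contradiction. Vertices are numbered along the long path, so
  intervals of numbers are connected segments.\<close>

locale long_fgraph = fgraph +
  fixes K :: mnum
  assumes C4: "E i j \<Longrightarrow> E i j' \<Longrightarrow> E i' j \<Longrightarrow> E i' j' \<Longrightarrow> i = i' \<or> j = j'"
    and path: "i + 1 < N \<Longrightarrow> E i (i + 1)"
    and no_path: "\<not> induced_path V K"
begin

text \<open>Otherwise the first \<open>K\<close> vertices of the state would be an induced
  path.\<close>

lemma gy_bound:
  assumes "gy U V j d"
  shows "j + 1 < K"
proof (rule ccontr)
  assume "\<not> j + 1 < K"
  then have "i < j + 1" if "i < K" for i using that by simp
  then have "induced_path V K" using assms unfolding gy_def induced_path_def by blast
  with no_path show False by blast
qed

text \<open>The Gyarfas path is grown towards the fixed target \<open>d\<close>, which survives the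
  deletions as long as the last vertex is not adjacent to it. By \<open>gy_bound\<close> the growth
  cannot reach \<open>K\<close>, so adjacency occurs and \<open>d\<close> is appended.\<close>

lemma short_path:
  assumes con: "con (\<lambda>i. eps i W) c d"
  shows "\<exists>V j. j < K \<and> app V 0 = c \<and> app V j = d \<and> (\<forall>i<j + 1. app V i < N \<and> eps (app V i) W) \<and>
    (\<forall>i<j. E (app V i) (app V (i + 1)))"
proof (cases "c = d")
  case True
  have "rec (\<lambda>\<rho>. (\<lambda>i. c) (\<rho> 0))" by (intro def_intros)
  from seq_exists[OF this, of 1] obtain V where V: "app V 0 = c" using zero_less_one by blast
  have "\<not> induced_path V 0 \<Longrightarrow> False" unfolding induced_path_def by simp
  then have "K \<noteq> 0" using no_path by blast
  then have "0 < K" by (simp add: m_pos_iff)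
  moreover have "\<forall>i<0 + 1. app V i < N \<and> eps (app V i) W"
    unfolding m_less_Suc using V con_in[OF con] by simp
  ultimately show ?thesis using V True by (intro exI[of _ V] exI[of _ 0]) simp
next
  case False
  define S where "S j \<longleftrightarrow> (\<exists>U V. gy U V j d \<and> app V 0 = c \<and> eps d U \<and> (\<forall>x<N. eps x U \<longrightarrow> eps x W) \<and>
    (\<forall>i<j + 1. eps (app V i) W))" for j
  have step: "S (j + 1)" if "gy U V j d" "app V 0 = c" "eps d U" "\<forall>x<N. eps x U \<longrightarrow> eps x W"
    "\<forall>i<j + 1. eps (app V i) W" "\<not> E (app V j) d" for U V j
  proof -
    note a = that
    have "dec (\<lambda>\<rho>. eps (\<rho> 0) U \<and> \<not> E (app V j) (\<rho> 0))" by (intro def_intros)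
    from code_exists[of "\<lambda>i. eps i U \<and> \<not> E (app V j) i", OF this]
    obtain U' where U': "\<And>i. eps i U' \<longleftrightarrow> i < N \<and> eps i U \<and> \<not> E (app V j) i" by blast
    have dN: "d < N" using con_in[OF con] by blast
    have "eps d U'" using U' a(3,6) dN by blast
    moreover have "con (\<lambda>i. eps i U) d d" using dN a(3) by (intro con_refl)
    ultimately obtain V' where V': "gy U' V' (j + 1) d" "\<And>i. i < j + 1 \<Longrightarrow> app V' i = app V i"
        "eps (app V' (j + 1)) U"
      using gy_step[OF a(1) U', of d] by blast
    have "app V' (j + 1) < N" using V'(1) unfolding gy_def by simp
    then have "eps (app V' i) W" if "i < j + 1 + 1" for i
      using that a(4,5) V'(2)[of i] V'(3) unfolding m_less_Suc[of i "j + 1"] by auto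
    moreover have "app V' 0 = c" using V'(2)[of 0] a(2) by (simp add: m_less_Suc_le)
    ultimately show ?thesis unfolding S_def using V'(1) \<open>eps d U'\<close> U' a(4) by blast
  qed
  have "\<exists>U V j. gy U V j d \<and> app V 0 = c \<and> eps d U \<and> (\<forall>x<N. eps x U \<longrightarrow> eps x W) \<and>
    (\<forall>i<j + 1. eps (app V i) W) \<and> E (app V j) d"
  proof (rule ccontr)
    assume neg: "\<not> ?thesis"
    have "S j" for j
    proof (rule sigma_induct[where p = S])
      show "SIG (\<lambda>\<rho>. S (\<rho> 0))" unfolding S_def gy_def
        by (rule SIG_ex, rule SIG_ex, rule SIG_dec) (intro def_intros)
      have "dec (\<lambda>\<rho>. eps (\<rho> 0) W \<and> \<rho> 0 \<noteq> c)" by (intro def_intros)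
      from code_exists[of "\<lambda>i. eps i W \<and> i \<noteq> c", OF this]
      obtain U where U: "\<And>i. eps i U \<longleftrightarrow> i < N \<and> eps i W \<and> i \<noteq> c" by blast
      then obtain V where V: "app V 0 = c" "gy U V 0 d" using gy_start[OF con False dec_eps1, of U]
          by blast
      have "\<forall>i<0 + 1. eps (app V i) W" unfolding m_less_Suc using V con_in[OF con] by simp
      moreover have "eps d U" using U con_in[OF con] False by blast
      ultimately show "S 0" unfolding S_def using V U by blast
      show "S (x + 1)" if "S x" for x
        using that neg step unfolding S_def[of x] by blast
    qed
    then have "S K" .
    then obtain U V where "gy U V K d" unfolding S_def by blast
    from gy_bound[OF this] show False by (simp add: m_less_Suc_le not_less)
  qed
  then obtain U V j where V: "gy U V j d" "app V 0 = c" "eps d U" "\<forall>x<N. eps x U \<longrightarrow> eps x W"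
    "\<forall>i<j + 1. eps (app V i) W" "E (app V j) d" by blast
  let ?f = "\<lambda>i. if i \<le> j then app V i else d"
  have "rec (\<lambda>\<rho>. ?f (\<rho> 0))" by (intro def_intros)
  from seq_exists[of ?f, OF this, of "j + 1 + 1"] obtain V' where V': "\<And>i. i < j + 1 + 1 \<Longrightarrow>
      app V' i = ?f i" by blast
  have old: "app V' i = app V i" if "i < j + 1" for i
    using that V'[of i] less_trans[OF that less_add_one] by (simp add: m_less_Suc_le)
  have new: "app V' (j + 1) = d" using V'[of "j + 1"] by (simp add: m_Suc_le[symmetric])
  have "app V' i < N \<and> eps (app V' i) W" if i: "i < j + 1 + 1" for i
    using i V(1,5) old new con_in[OF con] unfolding m_less_Suc[of i "j + 1"] gy_def by auto
  moreover have "E (app V' i) (app V' (i + 1))" if i: "i < j + 1" for i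
  proof (cases "i = j")
    case True then show ?thesis using old[OF i] new V(6) by simp
  next
    case False
    then have "i < j" using i by (simp add: m_less_Suc)
    then have "i + 1 < j + 1" by simp
    then show ?thesis using old[of i] old[of "i + 1"] i V(1) unfolding gy_def by auto
  qed
  moreover have "app V' 0 = c" using old[of 0] V(2) by (simp add: m_less_Suc_le)
  ultimately show ?thesis using gy_bound[OF V(1)] new by (intro exI[of _ V'] exI[of _ "j + 1"]) blast
qed

text \<open>A path that avoided the neighbours of \<open>h\<close> would keep \<open>c\<close> and
  \<open>d\<close> connected. \<open>V\<close> is chosen before \<open>h\<close>, so the same short
  list serves for all hubs.\<close>

lemma short_hit:
  assumes con: "con (\<lambda>i. eps i W) c d"
  shows "\<exists>V. (\<forall>h. \<not> con (\<lambda>i. eps i W \<and> \<not> E h i) c d \<longrightarrow>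
    (\<exists>p<K. app V p < N \<and> eps (app V p) W \<and> E h (app V p)))"
proof -
  from short_path[OF con] obtain V j where V: "j < K" "app V 0 = c" "app V j = d"
    "\<forall>i<j + 1. app V i < N \<and> eps (app V i) W" "\<forall>i<j. E (app V i) (app V (i + 1))" by blast
  have "\<exists>p<j + 1. E h (app V p)" if h: "\<not> con (\<lambda>i. eps i W \<and> \<not> E h i) c d" for h
  proof (rule ccontr)
    let ?W = "\<lambda>i. eps i W \<and> \<not> E h i"
    assume neg: "\<not> ?thesis"
    have W: "?W (app V i) \<and> app V i < N" if "i < j + 1" for i using V(4) neg that by blast
    have "i \<le> j \<longrightarrow> con ?W c (app V i)" for i
    proof (rule dec_induct[where p = "\<lambda>i. i \<le> j \<longrightarrow> con ?W c (app V i)"])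
      show "dec (\<lambda>\<rho>. \<rho> 0 \<le> j \<longrightarrow> con ?W c (app V (\<rho> 0)))" by (intro def_intros)
      show "0 \<le> j \<longrightarrow> con ?W c (app V 0)" using W[of 0] V(2) by (simp add: m_less_Suc_le con_refl)
      fix i assume IH: "i \<le> j \<longrightarrow> con ?W c (app V i)"
      show "i + 1 \<le> j \<longrightarrow> con ?W c (app V (i + 1))"
      proof
        assume "i + 1 \<le> j"
        then have i: "i < j" "i < j + 1" "i + 1 < j + 1"
            by (simp_all add: m_Suc_le[symmetric] m_less_Suc[of i])
        then have "con ?W (app V i) (app V (i + 1))" using W V(5) by (intro con_edge) auto
        moreover have "con ?W c (app V i)" using IH i by simp
        ultimately show "con ?W c (app V (i + 1))" using con_trans by blast
      qed
    qed
    from this[of j] h V(3) show False by simp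
  qed
  moreover have "p < K" if "p < j + 1" for p using that V(1) by (simp add: m_less_Suc_le)
  ultimately show ?thesis using V(4) by (intro exI[of _ V]) blast
qed

end

text \<open>Four breakpoints bound two disjoint segments. Working backwards, a round that must leave
  \<open>y\<close> of them needs \<open>y + 1\<close> squared: Mirsky's argument returns
  \<open>y + 1\<close>, and a restart spends one as its new starting vertex.\<close>

definition size_bound :: "mnum \<Rightarrow> mnum" where
  "size_bound = prim_rec (\<lambda>_. 1 + 1 + 1 + 1) (\<lambda>_ _ y. (y + 1) * (y + 1)) 0"

lemma size_bound_aux:
  "rec (\<lambda>\<rho>. 1 + 1 + 1 + 1)" "rec (\<lambda>\<rho>. (\<rho> (Suc (Suc 0)) + 1) * (\<rho> (Suc (Suc 0)) + 1))"
  by (intro def_intros)+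

lemma size_bound_0: "size_bound 0 = 1 + 1 + 1 + 1"
  unfolding size_bound_def by (rule prim_rec_0[OF size_bound_aux])

lemma size_bound_Suc: "size_bound (n + 1) = (size_bound n + 1) * (size_bound n + 1)"
  unfolding size_bound_def by (rule prim_rec_Suc[OF size_bound_aux])

lemma rec_size_bound [def_intros]: "rec f \<Longrightarrow> rec (\<lambda>\<rho>. size_bound (f \<rho>))"
  unfolding size_bound_def by (rule rec_prim_rec[OF size_bound_aux rec_const])

lemma size_bound_ge: "1 + 1 + 1 + 1 \<le> size_bound n"
proof (rule dec_induct[where p = "\<lambda>n. 1 + 1 + 1 + 1 \<le> size_bound n"])
  show "dec (\<lambda>\<rho>. 1 + 1 + 1 + 1 \<le> size_bound (\<rho> 0))" by (intro def_intros)
  fix n assume "1 + 1 + 1 + 1 \<le> size_bound n"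
  also have "size_bound n \<le> size_bound n + 1" by simp
  also have "\<dots> \<le> (size_bound n + 1) * (size_bound n + 1)" by (rule m_le_square)
  finally show "1 + 1 + 1 + 1 \<le> size_bound (n + 1)" unfolding size_bound_Suc .
qed (simp add: size_bound_0)

section \<open>The iteration over hubs\<close>

context long_fgraph
begin

text \<open>\<open>I\<close> is a set of breakpoints of the long path: any two of them are connected in \<open>U\<close> within the
  segment that they bound. The \<open>h\<close> hubs listed by \<open>H\<close> lie outside \<open>U\<close>, and every connection between
  two breakpoints within their segment meets the neighbourhood of each hub.\<close>

definition hub_state :: "mnum \<Rightarrow> mnum \<Rightarrow> mnum \<Rightarrow> mnum \<Rightarrow> mnum \<Rightarrow> mnum \<Rightarrow> mnum \<Rightarrow> bool" where
  "hub_state U I V H j h d \<longleftrightarrow>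
    (\<forall>x<N. eps x I \<longrightarrow> eps x U) \<and>
    (\<forall>x<N. \<forall>y<N. x < y \<longrightarrow> eps x I \<longrightarrow> eps y I \<longrightarrow> con (\<lambda>z. eps z U \<and> x \<le> z \<and> z \<le> y) x y) \<and>
    (\<forall>i<h. \<forall>x<N. \<forall>y<N. x < y \<longrightarrow> eps x I \<longrightarrow> eps y I \<longrightarrow>
      \<not> con (\<lambda>z. (eps z U \<and> x \<le> z \<and> z \<le> y) \<and> \<not> E (app H i) z) x y) \<and>
    (\<forall>i<h. \<not> eps (app H i) U \<and> (\<forall>k<i. app H k \<noteq> app H i) \<and> (\<forall>k<j + 1. app V k \<noteq> app H i)) \<and>
    d < N \<and> eps d I \<and> gy U V j d"

lemma hub_stateD:
  assumes "hub_state U I V H j h d"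
  shows "\<And>x. x < N \<Longrightarrow> eps x I \<Longrightarrow> eps x U"
    and "\<And>x y. x < N \<Longrightarrow> y < N \<Longrightarrow> x < y \<Longrightarrow> eps x I \<Longrightarrow> eps y I \<Longrightarrow> con (\<lambda>z. eps z U \<and> x \<le> z \<and> z \<le> y) x y"
    and "\<And>i x y. i < h \<Longrightarrow> x < N \<Longrightarrow> y < N \<Longrightarrow> x < y \<Longrightarrow> eps x I \<Longrightarrow> eps y I \<Longrightarrow>
      \<not> con (\<lambda>z. (eps z U \<and> x \<le> z \<and> z \<le> y) \<and> \<not> E (app H i) z) x y"
    and "\<And>i. i < h \<Longrightarrow> \<not> eps (app H i) U"
    and "\<And>i k. i < h \<Longrightarrow> k < i \<Longrightarrow> app H k \<noteq> app H i"
    and "\<And>i k. i < h \<Longrightarrow> k < j + 1 \<Longrightarrow> app V k \<noteq> app H i"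
    and "d < N" "eps d I" "gy U V j d"
  using assms unfolding hub_state_def by blast+

lemma hub_stateI:
  assumes "\<And>x. x < N \<Longrightarrow> eps x I \<Longrightarrow> eps x U"
    and "\<And>x y. x < N \<Longrightarrow> y < N \<Longrightarrow> x < y \<Longrightarrow> eps x I \<Longrightarrow> eps y I \<Longrightarrow> con (\<lambda>z. eps z U \<and> x \<le> z \<and> z \<le> y) x y"
    and "\<And>i x y. i < h \<Longrightarrow> x < N \<Longrightarrow> y < N \<Longrightarrow> x < y \<Longrightarrow> eps x I \<Longrightarrow> eps y I \<Longrightarrow>
      \<not> con (\<lambda>z. (eps z U \<and> x \<le> z \<and> z \<le> y) \<and> \<not> E (app H i) z) x y"
    and "\<And>i. i < h \<Longrightarrow> \<not> eps (app H i) U"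
    and "\<And>i k. i < h \<Longrightarrow> k < i \<Longrightarrow> app H k \<noteq> app H i"
    and "\<And>i k. i < h \<Longrightarrow> k < j + 1 \<Longrightarrow> app V k \<noteq> app H i"
    and "d < N" "eps d I" "gy U V j d"
  shows "hub_state U I V H j h d"
  unfolding hub_state_def by (intro conjI allI impI assms)

text \<open>The chain case: the breakpoints in \<open>I'\<close> remain connected within their
  segments after the neighbours of the last vertex are deleted, so the path grows towards one of
  them and the hubs are kept. Deleting vertices cannot create a connection that avoids a
  hub.\<close>

lemma hub_state_continue:
  assumes st: "hub_state U I V H j h d"
    and I': "\<And>i. eps i I' \<Longrightarrow> i < N \<and> eps i I" "1 < cnt I' N"
    and R: "\<And>x y. x < y \<Longrightarrow> eps x I' \<Longrightarrow> eps y I' \<Longrightarrow>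
      con (\<lambda>z. (eps z U \<and> x \<le> z \<and> z \<le> y) \<and> \<not> E (app V j) z) x y"
  shows "\<exists>U' V' d'. hub_state U' I' V' H (j + 1) h d'"
proof -
  note s = hub_stateD[OF st]
  have "dec (\<lambda>\<rho>. eps (\<rho> 0) U \<and> \<not> E (app V j) (\<rho> 0))" by (intro def_intros)
  from code_exists[of "\<lambda>i. eps i U \<and> \<not> E (app V j) i", OF this]
  obtain U' where U': "\<And>i. eps i U' \<longleftrightarrow> i < N \<and> eps i U \<and> \<not> E (app V j) i" by blast
  \<comment> \<open>A second breakpoint is needed here: being related to it shows that
    \<open>x\<close> itself is not adjacent to the last vertex.\<close>
  have IU: "eps x U'" if "eps x I'" for x
  proof -
    obtain y where "y < N" "eps y I'" "y \<noteq> x" using cnt_another[OF I'(2)] by blast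
    from \<open>y \<noteq> x\<close> consider "x < y" | "y < x" by (metis linorder_neqE)
    then have "x < N \<and> eps x U \<and> \<not> E (app V j) x"
    proof cases
      case 1 from con_in[OF R[OF 1 that \<open>eps y I'\<close>]] show ?thesis by simp
    next
      case 2 from con_in[OF R[OF 2 \<open>eps y I'\<close> that]] show ?thesis by simp
    qed
    then show ?thesis using U' by blast
  qed
  obtain d' where d': "d' < N" "eps d' I'" using cnt_another[OF I'(2)] by blast
  have "con (\<lambda>i. eps i U) d d'"
  proof (cases "d = d'")
    case True then show ?thesis using con_refl[of d "\<lambda>i. eps i U"] s(1)[OF s(7,8)] s(7) by simp
  next
    case False
    then consider "d < d'" | "d' < d" by (metis linorder_neqE)
    then show ?thesis
    proof cases
      case 1
      have "con (\<lambda>z. eps z U \<and> d \<le> z \<and> z \<le> d') d d'" using s(2)[OF s(7) d'(1) 1 s(8)] I'(1) d'(2)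
          by blast
      then show ?thesis by (rule con_mono) blast
    next
      case 2
      have "con (\<lambda>z. eps z U \<and> d' \<le> z \<and> z \<le> d) d' d" using s(2)[OF d'(1) s(7) 2 _ s(8)] I'(1) d'(2)
          by blast
      then have "con (\<lambda>z. eps z U) d' d" by (rule con_mono) blast
      then show ?thesis by (rule con_sym)
    qed
  qed
  from gy_step[OF s(9) U' IU[OF d'(2)] this] obtain V' where V': "gy U' V' (j + 1) d'"
    "\<And>i. i < j + 1 \<Longrightarrow> app V' i = app V i" "eps (app V' (j + 1)) U" by blast
  have "hub_state U' I' V' H (j + 1) h d'"
  proof (rule hub_stateI)
    show "eps x U'" if "eps x I'" for x using IU that .
    show "con (\<lambda>z. eps z U' \<and> x \<le> z \<and> z \<le> y) x y" if "x < y" "eps x I'" "eps y I'" for x y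
      by (rule con_mono[OF R[OF that]]) (simp add: U')
    show "\<not> con (\<lambda>z. (eps z U' \<and> x \<le> z \<and> z \<le> y) \<and> \<not> E (app H i) z) x y"
      if a: "i < h" "x < N" "y < N" "x < y" "eps x I'" "eps y I'" for i x y
    proof
      assume "con (\<lambda>z. (eps z U' \<and> x \<le> z \<and> z \<le> y) \<and> \<not> E (app H i) z) x y"
      then have "con (\<lambda>z. (eps z U \<and> x \<le> z \<and> z \<le> y) \<and> \<not> E (app H i) z) x y"
        by (rule con_mono) (simp add: U')
      with s(3)[OF a(1-4)] I'(1) a(5,6) show False by blast
    qed
    show "\<not> eps (app H i) U'" if "i < h" for i using s(4)[OF that] U' by blast
    show "app H k \<noteq> app H i" if "i < h" "k < i" for i k using s(5)[OF that] .
    show "app V' k \<noteq> app H i" if "i < h" "k < j + 1 + 1" for i k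
    proof (cases "k = j + 1")
      case True then show ?thesis using V'(3) s(4)[OF that(1)] by metis
    next
      case False
      then have "k < j + 1" using that(2) unfolding m_less_Suc[of k "j + 1"] by blast
      then show ?thesis using V'(2) s(6)[OF that(1)] by simp
    qed
  qed (use d' V'(1) in simp_all)
  then show ?thesis by blast
qed

text \<open>The antichain case: the last vertex of the path becomes hub number \<open>h\<close>, and
  a new path starts at the least breakpoint \<open>c\<close>. Removing \<open>c\<close> from
  \<open>U\<close> does not affect the segments of the others, which lie to its right. The new hub
  differs from the old ones because path vertices always do.\<close>

lemma hub_state_restart:
  assumes st: "hub_state U I V H j h d"
    and I': "\<And>i. eps i I' \<Longrightarrow> i < N \<and> eps i I" "n + 1 \<le> cnt I' N" "1 \<le> n"
    and R: "\<And>x y. x < y \<Longrightarrow> eps x I' \<Longrightarrow> eps y I' \<Longrightarrow>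
      \<not> con (\<lambda>z. (eps z U \<and> x \<le> z \<and> z \<le> y) \<and> \<not> E (app V j) z) x y"
  shows "\<exists>U' I'' V' H' d'. hub_state U' I'' V' H' 0 (h + 1) d' \<and> n \<le> cnt I'' N"
proof -
  note s = hub_stateD[OF st]
  from remove_min[OF I'(2)] obtain c I'' where c: "c < N" "eps c I'"
    and I'': "\<And>i. eps i I'' \<longleftrightarrow> i < N \<and> eps i I' \<and> i \<noteq> c" "\<And>i. i < N \<Longrightarrow> eps i I'' \<Longrightarrow> c < i" "n \<le> cnt I'' N"
    by blast
  have "cnt I'' N \<noteq> 0" using order_trans[OF I'(3) I''(3)] by auto
  then obtain d' where d': "d' < N" "eps d' I''" using cnt_nonempty by blast
  have cI: "eps c I" "eps c U" using c I'(1) s(1) by blast+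
  have sub: "eps x I" "eps x U" if "eps x I''" for x using that I''(1) I'(1) s(1) by blast+
  have "dec (\<lambda>\<rho>. eps (\<rho> 0) U \<and> \<rho> 0 \<noteq> c)" by (intro def_intros)
  from code_exists[of "\<lambda>i. eps i U \<and> i \<noteq> c", OF this]
  obtain U' where U': "\<And>i. eps i U' \<longleftrightarrow> i < N \<and> eps i U \<and> i \<noteq> c" by blast
  let ?f = "\<lambda>i. if i < h then app H i else app V j"
  have "rec (\<lambda>\<rho>. ?f (\<rho> 0))" by (intro def_intros)
  from seq_exists[of ?f, OF this, of "h + 1"] obtain H' where H': "\<And>i. i < h + 1 \<Longrightarrow>
      app H' i = ?f i" by blast
  have Hold: "app H' i = app H i" if "i < h" for i
      using H'[of i] that less_trans[OF that less_add_one] by simp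
  have Hnew: "app H' h = app V j" using H'[of h] by simp
  have cd: "c < d'" using I''(2) d' by blast
  have "con (\<lambda>z. eps z U \<and> c \<le> z \<and> z \<le> d') c d'" using s(2) c d' cd cI sub by blast
  moreover have "dec (\<lambda>\<rho>. eps (\<rho> 0) U \<and> c \<le> \<rho> 0 \<and> \<rho> 0 \<le> d')" by (intro def_intros)
  ultimately obtain V' where V': "app V' 0 = c" "gy U' V' 0 d'"
    using gy_start[of "\<lambda>z. eps z U \<and> c \<le> z \<and> z \<le> d'" c d' U'] cd U' by blast
  have vU: "\<not> eps (app V j) U" using s(9) unfolding gy_def by simp
  have mono: "con (\<lambda>z. (eps z U \<and> x \<le> z \<and> z \<le> y) \<and> P z) x y"
    if "con (\<lambda>z. (eps z U' \<and> x \<le> z \<and> z \<le> y) \<and> P z) x y" for x y P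
    using that by (rule con_mono) (simp add: U')
  have less_h: "i < h \<or> i = h" if "i < h + 1" for i using that unfolding m_less_Suc .
  have "hub_state U' I'' V' H' 0 (h + 1) d'"
  proof (rule hub_stateI)
    show "eps x U'" if "x < N" "eps x I''" for x using U' I''(1) sub that by blast
    show "con (\<lambda>z. eps z U' \<and> x \<le> z \<and> z \<le> y) x y" if a: "x < N" "y < N" "x < y" "eps x I''"
        "eps y I''" for x y
    proof (rule con_mono)
      show "con (\<lambda>z. eps z U \<and> x \<le> z \<and> z \<le> y) x y" using s(2) a sub by blast
      have cx: "c < x" using I''(2) a by blast
      show "eps i U' \<and> x \<le> i \<and> i \<le> y" if b: "i < N" "eps i U \<and> x \<le> i \<and> i \<le> y" for i
      proof -
        have "c < i" using cx b(2) by (meson less_le_trans)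
        then show ?thesis using b by (simp add: U')
      qed
    qed
    show "\<not> con (\<lambda>z. (eps z U' \<and> x \<le> z \<and> z \<le> y) \<and> \<not> E (app H' i) z) x y"
      if a: "i < h + 1" "x < N" "y < N" "x < y" "eps x I''" "eps y I''" for i x y
      using less_h[OF a(1)]
    proof
      assume i: "i < h"
      then show ?thesis using s(3)[OF i a(2-4) sub(1)[OF a(5)] sub(1)[OF a(6)]] mono Hold[OF i] by auto
    next
      assume i: "i = h"
      then show ?thesis using R[OF a(4)] a(5,6) I''(1) mono Hnew by auto
    qed
    show "\<not> eps (app H' i) U'" if "i < h + 1" for i
      using less_h[OF that] Hold Hnew s(4) vU U' by metis
    show "app H' k \<noteq> app H' i" if "i < h + 1" "k < i" for i k
      using less_h[OF that(1)]
    proof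
      assume "i < h"
      moreover from this that have "k < h" by simp
      ultimately show ?thesis using Hold s(5) that by metis
    next
      assume "i = h"
      then show ?thesis using Hold Hnew s(6)[of k j] that by simp
    qed
    show "app V' k \<noteq> app H' i" if "i < h + 1" "k < 0 + 1" for i k
    proof -
      have "k = 0" using that(2) unfolding m_less_Suc by simp
      then show ?thesis using V'(1) cI(2) less_h[OF that(1)] Hold Hnew s(4) vU by metis
    qed
  qed (use d' V'(2) in simp_all)
  then show ?thesis using I''(3) by blast
qed

text \<open>A continuation raises \<open>j\<close> by one. A restart gives up \<open>j\<close> for a
  gain of \<open>K\<close>, which is enough since \<open>j < K\<close>.\<close>

lemma hub_state_step:
  assumes st: "hub_state U I V H j h d" and card: "(n + 1) * (n + 1) \<le> cnt I N" and n: "1 \<le> n"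
  shows "\<exists>U' I' V' H' j' h' d'. hub_state U' I' V' H' j' h' d' \<and> n \<le> cnt I' N \<and>
      h * K + j + 1 \<le> h' * K + j'"
proof -
  note s = hub_stateD[OF st]
  let ?R = "\<lambda>x y. con (\<lambda>z. (eps z U \<and> x \<le> z \<and> z \<le> y) \<and> \<not> E (app V j) z) x y"
  have dR: "dec (\<lambda>\<rho>. ?R (\<rho> 0) (\<rho> (Suc 0)))" by (intro def_intros)
  \<comment> \<open>The two smaller segments both lie in the segment from \<open>x\<close> to
    \<open>z\<close>.\<close>
  have trans: "?R x z" if "x < y" "y < z" "z < N" "eps x I" "eps y I" "eps z I" "?R x y" "?R y z"
      for x y z
  proof (rule con_trans)
    show "con (\<lambda>w. (eps w U \<and> x \<le> w \<and> w \<le> z) \<and> \<not> E (app V j) w) x y"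
      by (rule con_mono[OF that(7)]) (use that(2) in auto)
    show "con (\<lambda>w. (eps w U \<and> x \<le> w \<and> w \<le> z) \<and> \<not> E (app V j) w) y z"
      by (rule con_mono[OF that(8)]) (use that(1) in auto)
  qed
  have "\<exists>I'. (\<forall>i. eps i I' \<longrightarrow> i < N \<and> eps i I) \<and> n + 1 \<le> cnt I' N \<and>
    ((\<forall>x y. x < y \<longrightarrow> eps x I' \<longrightarrow> eps y I' \<longrightarrow> ?R x y) \<or> (\<forall>x y. x < y \<longrightarrow> eps x I' \<longrightarrow> eps y I' \<longrightarrow> \<not> ?R x y))"
    by (rule chain_or_antichain[OF dR _ card]) (erule trans, assumption+)
  then obtain I' where
    I0: "\<forall>i. eps i I' \<longrightarrow> i < N \<and> eps i I" "n + 1 \<le> cnt I' N" and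
    R: "(\<forall>x y. x < y \<longrightarrow> eps x I' \<longrightarrow> eps y I' \<longrightarrow> ?R x y) \<or> (\<forall>x y. x < y \<longrightarrow> eps x I' \<longrightarrow> eps y I' \<longrightarrow> \<not> ?R x y)"
    by (elim exE conjE)
  then have I': "\<And>i. eps i I' \<Longrightarrow> i < N \<and> eps i I" "n + 1 \<le> cnt I' N" by simp_all
  from R show ?thesis
  proof
    assume R: "\<forall>x y. x < y \<longrightarrow> eps x I' \<longrightarrow> eps y I' \<longrightarrow> ?R x y"
    have "n < cnt I' N" using I'(2) by (simp add: m_Suc_le)
    then have "1 < cnt I' N" "n \<le> cnt I' N" using n by auto
    with hub_state_continue[OF st I'(1), of I'] R
    obtain U' V' d' where "hub_state U' I' V' H (j + 1) h d'" by blast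
    moreover have "h * K + j + 1 \<le> h * K + (j + 1)" by (simp add: add.assoc)
    ultimately show ?thesis using \<open>n \<le> cnt I' N\<close> by blast
  next
    assume R: "\<forall>x y. x < y \<longrightarrow> eps x I' \<longrightarrow> eps y I' \<longrightarrow> \<not> ?R x y"
    with hub_state_restart[OF st I'(1) I'(2) n] obtain U' I'' V' H' d' where
      "hub_state U' I'' V' H' 0 (h + 1) d'" "n \<le> cnt I'' N" by blast
    moreover have "h * K + j + 1 \<le> (h + 1) * K + 0"
    proof -
      have "j + 1 \<le> K" using gy_bound[OF s(9)] by simp
      then have "h * K + (j + 1) \<le> h * K + K" by (rule add_left_mono)
      then show ?thesis by (simp add: distrib_right add.assoc)
    qed
    ultimately show ?thesis by blast
  qed
qed

text \<open>With more hubs than pairs of positions, two hubs hit two disjoint short paths in the same pair of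
  positions, which gives a four-cycle.\<close>

lemma hub_state_bound:
  assumes st: "hub_state U I V H j h d" and card: "1 + 1 + 1 + 1 \<le> cnt I N"
  shows "h \<le> pr K K + 1"
proof (rule ccontr)
  assume h: "\<not> h \<le> pr K K + 1"
  note s = hub_stateD[OF st]
  \<comment> \<open>Four breakpoints in increasing order; the segments from \<open>x1\<close> to
    \<open>x2\<close> and from \<open>x3\<close> to \<open>x4\<close> are disjoint.\<close>
  from remove_min[OF card] obtain x1 I1 where x1: "x1 < N" "eps x1 I"
    and I1: "\<And>i. eps i I1 \<longleftrightarrow> i < N \<and> eps i I \<and> i \<noteq> x1" "\<And>i. i < N \<Longrightarrow> eps i I1 \<Longrightarrow>
        x1 < i" "1 + 1 + 1 \<le> cnt I1 N" by blast
  from remove_min[OF I1(3)] obtain x2 I2 where x2: "x2 < N" "eps x2 I1"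
    and I2: "\<And>i. eps i I2 \<longleftrightarrow> i < N \<and> eps i I1 \<and> i \<noteq> x2" "\<And>i. i < N \<Longrightarrow> eps i I2 \<Longrightarrow>
        x2 < i" "1 + 1 \<le> cnt I2 N" by blast
  from remove_min[OF I2(3)] obtain x3 I3 where x3: "x3 < N" "eps x3 I2"
    and I3: "\<And>i. eps i I3 \<longleftrightarrow> i < N \<and> eps i I2 \<and> i \<noteq> x3" "\<And>i. i < N \<Longrightarrow> eps i I3 \<Longrightarrow>
        x3 < i" "1 \<le> cnt I3 N" by blast
  have "cnt I3 N \<noteq> 0" using I3(3) by auto
  then obtain x4 where x4: "x4 < N" "eps x4 I3" using cnt_nonempty by blast
  have xs: "eps x2 I" "eps x3 I" "eps x4 I" "x1 < x2" "x2 < x3" "x3 < x4"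
    using x2 x3 x4 I1(2)[OF x2] I2(2)[OF x3] I3(2)[OF x4] unfolding I1(1) I2(1) I3(1) by simp_all
  have seg: "\<exists>W. con (\<lambda>i. eps i W) x y \<and> (\<forall>i. eps i W \<longrightarrow> x \<le> i \<and> i \<le> y) \<and>
      (\<forall>k<h. \<not> con (\<lambda>i. eps i W \<and> \<not> E (app H k) i) x y)"
    if a: "x < N" "y < N" "x < y" "eps x I" "eps y I" for x y
  proof -
    have "dec (\<lambda>\<rho>. eps (\<rho> 0) U \<and> x \<le> \<rho> 0 \<and> \<rho> 0 \<le> y)" by (intro def_intros)
    from code_exists[of "\<lambda>i. eps i U \<and> x \<le> i \<and> i \<le> y", OF this]
    obtain W where W: "\<And>i. eps i W \<longleftrightarrow> i < N \<and> eps i U \<and> x \<le> i \<and> i \<le> y" by blast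
    have "con (\<lambda>i. eps i W) x y" by (rule con_mono[OF s(2)[OF a]]) (simp add: W)
    moreover have "\<not> con (\<lambda>i. eps i W \<and> \<not> E (app H k) i) x y" if "k < h" for k
    proof
      assume "con (\<lambda>i. eps i W \<and> \<not> E (app H k) i) x y"
      then have "con (\<lambda>z. (eps z U \<and> x \<le> z \<and> z \<le> y) \<and> \<not> E (app H k) z) x y"
          by (rule con_mono) (simp add: W)
      with s(3)[OF that a] show False by blast
    qed
    ultimately show ?thesis using W by blast
  qed
  have hit: "\<exists>f V. rec (\<lambda>\<rho>. f (\<rho> 0)) \<and> (\<forall>i. f i \<le> K) \<and>
      (\<forall>k<h. E (app H k) (app V (f k)) \<and> x \<le> app V (f k) \<and> app V (f k) \<le> y)"
    if a: "x < N" "y < N" "x < y" "eps x I" "eps y I" for x y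
  proof -
    from seg[OF a] obtain W where W: "con (\<lambda>i. eps i W) x y" "\<And>i. eps i W \<Longrightarrow> x \<le> i \<and> i \<le> y"
      "\<And>k. k < h \<Longrightarrow> \<not> con (\<lambda>i. eps i W \<and> \<not> E (app H k) i) x y" by blast
    from short_hit[OF W(1)] obtain V where V: "\<And>h. \<not> con (\<lambda>i. eps i W \<and> \<not> E h i) x y \<Longrightarrow>
      \<exists>p<K. app V p < N \<and> eps (app V p) W \<and> E h (app V p)" by blast
    \<comment> \<open>The alternative \<open>p = K\<close> makes the search for a hit total. For an
      actual hub a smaller \<open>p\<close> exists, so the default is not taken.\<close>
    define Q where "Q k p \<longleftrightarrow> (eps (app V p) W \<and> E (app H k) (app V p)) \<or> p = K" for k p
    have dQ: "dec (\<lambda>\<rho>. Q (\<rho> 0) (\<rho> (Suc 0)))" unfolding Q_def by (intro def_intros)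
    have "\<exists>p. Q k p" for k unfolding Q_def by blast
    from rec_least[OF dQ this] obtain f where f: "rec (\<lambda>\<rho>. f (\<rho> 0))" "\<And>k. Q k (f k)"
        "\<And>k p. p < f k \<Longrightarrow> \<not> Q k p" by blast
    have le: "f k \<le> K" for k using f(3)[of K k] unfolding Q_def by (metis linorder_not_less)
    have "E (app H k) (app V (f k)) \<and> x \<le> app V (f k) \<and> app V (f k) \<le> y" if k: "k < h" for k
    proof -
      obtain p where p: "p < K" "eps (app V p) W" "E (app H k) (app V p)" using V[OF W(3)[OF k]]
          by blast
      have "f k \<noteq> K" using f(3)[of p k] p unfolding Q_def by blast
      then show ?thesis using f(2)[of k] W(2) unfolding Q_def by blast
    qed
    then show ?thesis using f(1) le by blast
  qed
  from hit[OF x1(1) x2(1) xs(4) x1(2) xs(1)] obtain f V1 where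
    f0: "rec (\<lambda>\<rho>. f (\<rho> 0))" "\<forall>i. f i \<le> K" "\<forall>k<h. E (app H k) (app V1 (f k)) \<and> x1 \<le> app V1 (f k) \<and>
        app V1 (f k) \<le> x2"
    by (elim exE conjE)
  note f = f0(1) f0(2)[rule_format] f0(3)[rule_format]
  from hit[OF x3(1) x4(1) xs(6) xs(2,3)] obtain g V2 where
    g0: "rec (\<lambda>\<rho>. g (\<rho> 0))" "\<forall>i. g i \<le> K" "\<forall>k<h. E (app H k) (app V2 (g k)) \<and> x3 \<le> app V2 (g k) \<and>
        app V2 (g k) \<le> x4"
    by (elim exE conjE)
  note g = g0(1) g0(2)[rule_format] g0(3)[rule_format]
  \<comment> \<open>Each hub is coloured by its pair of hitting positions. There are at most
    \<open>pr K K + 1\<close> colours and, by assumption, at least one hub more.\<close>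
  have "rec (\<lambda>\<rho>. pr (f (\<rho> 0)) (g (\<rho> 0)))" by (intro def_intros f(1) g(1))
  moreover have "pr (f i) (g i) < pr K K + 1" for i unfolding m_less_Suc_le by (intro pr_mono f(2) g(2))
  ultimately obtain i k where ik: "k < i" "i < pr K K + 1 + 1" "pr (f i) (g i) = pr (f k) (g k)"
    using pigeonhole[of "\<lambda>i. pr (f i) (g i)" "pr K K + 1"] by blast
  have ih: "i < h" using ik(2) h by (simp add: m_less_Suc_le)
  then have kh: "k < h" using ik(1) by simp
  have "E (app H i) (app V1 (f i))" "E (app H i) (app V2 (g i))" "E (app H k) (app V1 (f i))"
      "E (app H k) (app V2 (g i))"
    using f(3)[OF ih] g(3)[OF ih] f(3)[OF kh] g(3)[OF kh] ik(3) unfolding pr_inj by simp_all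
  \<comment> \<open>The two hubs are distinct, so the two common neighbours would have to coincide,
    although they lie in disjoint segments.\<close>
  from C4[OF this] s(5)[OF ih ik(1)] have "app V1 (f i) = app V2 (g i)" by auto
  moreover have "app V1 (f i) \<le> x2" "x3 \<le> app V2 (g i)" using f(3)[OF ih] g(3)[OF ih] by blast+
  ultimately show False using xs(5) by auto
qed

text \<open>The path is the single vertex 0, all other vertices are breakpoints, and the target 1 is
  its neighbour on the long path.\<close>

lemma initial_state:
  assumes N: "1 + 1 < N"
  shows "\<exists>U V. hub_state U U V 0 0 0 1 \<and> N = cnt U N + 1"
proof -
  have "dec (\<lambda>\<rho>. \<rho> 0 \<noteq> 0)" "dec (\<lambda>\<rho>. True)" by (intro def_intros)+
  from code_exists[of "\<lambda>i. i \<noteq> 0" N, OF this(1)] code_exists[of "\<lambda>i. True" N, OF this(2)]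
  obtain U F where U: "\<And>i. eps i U \<longleftrightarrow> i < N \<and> i \<noteq> 0" and F: "\<And>i. eps i F \<longleftrightarrow> i < N" by auto
  have "0 < N" "1 < N" using N by (auto intro: less_trans[of _ "1 + 1"] less_trans[OF less_add_one])
  have "cnt F N = cnt U N + 1" by (rule cnt_insert[OF \<open>0 < N\<close>]) (auto simp: U F)
  moreover have "cnt F N = N" by (rule cnt_full) (simp add: F)
  ultimately have cnt: "N = cnt U N + 1" by simp
  \<comment> \<open>An invariant set containing \<open>x\<close> is followed along consecutive
    numbers up to \<open>y\<close>.\<close>
  have seg: "con (\<lambda>z. W z \<and> x \<le> z \<and> z \<le> y) x y" if a: "y < N" "x < y" "\<And>z. x \<le> z \<Longrightarrow> z \<le> y \<Longrightarrow>
      W z" for W x y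
  proof (rule con_I)
    fix P assume P: "dec (\<lambda>\<rho>. P (\<rho> 0))" "P x"
      "\<And>i j. i < N \<Longrightarrow> j < N \<Longrightarrow> P i \<Longrightarrow> W i \<and> x \<le> i \<and> i \<le> y \<Longrightarrow> W j \<and> x \<le> j \<and> j \<le> y \<Longrightarrow> E i j \<Longrightarrow> P j"
    have "x \<le> z \<longrightarrow> z \<le> y \<longrightarrow> P z" for z
    proof (rule dec_induct[where p = "\<lambda>z. x \<le> z \<longrightarrow> z \<le> y \<longrightarrow> P z"])
      show "dec (\<lambda>\<rho>. x \<le> \<rho> 0 \<longrightarrow> \<rho> 0 \<le> y \<longrightarrow> P (\<rho> 0))" by (intro def_intros P(1))
      show "x \<le> 0 \<longrightarrow> 0 \<le> y \<longrightarrow> P 0" using P(2) by (auto dest: antisym)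
      fix z assume IH: "x \<le> z \<longrightarrow> z \<le> y \<longrightarrow> P z"
      show "x \<le> z + 1 \<longrightarrow> z + 1 \<le> y \<longrightarrow> P (z + 1)"
      proof (intro impI)
        assume z: "x \<le> z + 1" "z + 1 \<le> y"
        show "P (z + 1)"
        proof (cases "x = z + 1")
          case True then show ?thesis using P(2) by simp
        next
          case False
          then have "x \<le> z" using z(1) by (metis le_less m_less_Suc_le)
          moreover have "z < y" using z(2) by (simp add: m_Suc_le)
          moreover have "z + 1 < N" "z < N" using z(2) a(1) \<open>z < y\<close> by (auto intro: le_less_trans)
          ultimately show ?thesis using P(3)[of z "z + 1"] IH z a path by auto
        qed
      qed
    qed
    then show "P y" using a by auto
  qed (use a in auto)
  have "rec (\<lambda>\<rho>. (\<lambda>i. 0) (\<rho> 0))" by (intro def_intros)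
  from seq_exists[OF this, of 1] obtain V where V: "app V 0 = 0" using zero_less_one by blast
  have z: "i < 0 + 1 \<longleftrightarrow> i = 0" for i :: mnum unfolding m_less_Suc by simp
  have "hub_state U U V 0 0 0 1"
  proof (rule hub_stateI)
    show "con (\<lambda>z. eps z U \<and> x \<le> z \<and> z \<le> y) x y" if "x < N" "y < N" "x < y" "eps x U" "eps y U" for x y
      using that by (intro seg) (auto simp: U dest: antisym)
    have "con (\<lambda>i. eps i U) 1 1" using \<open>1 < N\<close> by (intro con_refl) (auto simp: U)
    moreover have "E 0 1" using path[of 0] \<open>1 < N\<close> by simp
    ultimately show "gy U V 0 1" unfolding gy_def z using V \<open>0 < N\<close> \<open>1 < N\<close> by (auto simp: U)
  qed (use \<open>1 < N\<close> in \<open>auto simp: U\<close>)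
  with cnt show ?thesis by blast
qed

text \<open>With this many vertices there are enough breakpoints for \<open>?T\<close> rounds, and
  then either the number of hubs or the length of the path is too large.\<close>

lemma N_bound: "\<not> size_bound ((pr K K + 1 + 1) * K) + 1 \<le> N"
proof
  let ?T = "(pr K K + 1 + 1) * K"
  assume N: "size_bound ?T + 1 \<le> N"
  have four: "1 + 1 < (1 + 1 + 1 + 1 :: mnum)" by (simp add: add.assoc)
  \<comment> \<open>After progress \<open>t\<close> there are still enough breakpoints for the
    remaining \<open>?T - t\<close> rounds. All components are codes and the matrix is decidable, so
    \<open>S\<close> is Sigma-1.\<close>
  define S where "S t \<longleftrightarrow> (\<exists>U I V H j h d. hub_state U I V H j h d \<and> t \<le> h * K + j \<and>
      size_bound (?T - t) \<le> cnt I N)" for t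
  have "\<not> t \<le> ?T \<or> S t" for t
  proof (rule sigma_induct[where p = "\<lambda>t. \<not> t \<le> ?T \<or> S t"])
    have "SIG (\<lambda>\<rho>. S (\<rho> 0))" unfolding S_def hub_state_def gy_def
      by (rule SIG_ex, rule SIG_ex, rule SIG_ex, rule SIG_ex, rule SIG_ex, rule SIG_ex, rule SIG_ex,
          rule SIG_dec)
        (intro def_intros)
    then show "SIG (\<lambda>\<rho>. \<not> \<rho> 0 \<le> ?T \<or> S (\<rho> 0))" by (rule SIG_disj[rotated]) (intro SIG_dec def_intros)
    have "1 + 1 < size_bound ?T" using four size_bound_ge by (rule less_le_trans)
    then have "1 + 1 < N" using N by (metis le_less_trans less_imp_le m_Suc_le less_le_trans)
    from initial_state[OF this] obtain U V where "hub_state U U V 0 0 0 1" "N = cnt U N + 1" by blast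
    moreover from ord_le_eq_trans[OF N this(2)] have "size_bound (?T - 0) \<le> cnt U N" by simp
    moreover have "0 \<le> 0 * K + 0" by simp
    ultimately have "S 0" unfolding S_def by blast
    then show "\<not> 0 \<le> ?T \<or> S 0" by simp
    fix t assume IH: "\<not> t \<le> ?T \<or> S t"
    show "\<not> t + 1 \<le> ?T \<or> S (t + 1)"
    proof (cases "t + 1 \<le> ?T")
      case True
      then obtain w where w: "?T = t + 1 + w" unfolding m_le_iff by blast
      then have sub: "?T - t = w + 1" "?T - (t + 1) = w"
          by (metis add.assoc add.commute add_diff_cancel_left', simp)
      have "t \<le> ?T" using True by (simp add: m_Suc_le[symmetric])
      then obtain U I V H j h d where st: "hub_state U I V H j h d" "t \<le> h * K + j"
          "size_bound (?T - t) \<le> cnt I N"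
        using IH unfolding S_def by blast
      have "1 \<le> size_bound w" using size_bound_ge[of w]
          by (rule order_trans[rotated]) (simp add: add.assoc)
      with hub_state_step[OF st(1), of "size_bound w"] st(3)
      obtain U' I' V' H' j' h' d' where "hub_state U' I' V' H' j' h' d'" "size_bound w \<le> cnt I' N"
          "h * K + j + 1 \<le> h' * K + j'"
        unfolding sub size_bound_Suc by blast
      moreover from this st(2) have "t + 1 \<le> h' * K + j'" by (meson add_right_mono order_trans)
      ultimately have "S (t + 1)" unfolding S_def sub by blast
      then show ?thesis by blast
    qed simp
  qed
  then have "S ?T" by (metis order_refl)
  then obtain U I V H j h d where st: "hub_state U I V H j h d" "?T \<le> h * K + j"
      "size_bound (?T - ?T) \<le> cnt I N"
    unfolding S_def by blast
  have "1 + 1 + 1 + 1 \<le> cnt I N" using st(3) size_bound_ge by (rule order_trans[rotated])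
  from hub_state_bound[OF st(1) this] have "h + 1 \<le> pr K K + 1 + 1" by (rule add_right_mono)
  then have "(h + 1) * K \<le> ?T" by (intro m_mult_mono order_refl)
  \<comment> \<open>The bound on hubs gives \<open>(h + 1) * K \<le> ?T \<le> h * K + j\<close>,
    contrary to \<open>j < K\<close>.\<close>
  from order_trans[OF this st(2)] have le: "h * K + K \<le> h * K + j"
      by (simp only: distrib_right mult_1_left)
  have "j < K" using gy_bound[OF hub_stateD(9)[OF st(1)]] by (metis less_trans less_add_one)
  with le show False by simp
qed

end

theorem (in fgraph) induced_path_exists:
  assumes C4: "\<And>i j i' j'. E i j \<Longrightarrow> E i j' \<Longrightarrow> E i' j \<Longrightarrow> E i' j' \<Longrightarrow> i = i' \<or> j = j'"
    and path: "\<And>i. i + 1 < N \<Longrightarrow> E i (i + 1)"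
    and N: "size_bound ((pr K K + 1 + 1) * K) + 1 \<le> N"
  shows "\<exists>V. induced_path V K"
proof (rule ccontr)
  assume neg: "\<not> ?thesis"
  interpret long_fgraph N E K
  proof
    show "\<And>i j j' i'. E i j \<Longrightarrow> E i j' \<Longrightarrow> E i' j \<Longrightarrow> E i' j' \<Longrightarrow> i = i' \<or> j = j'" by (rule C4)
  qed (use path neg in blast)+
  from N_bound N show False by blast
qed

section \<open>Lattices of length three\<close>

definition sem_partial_order :: "mnum set \<Rightarrow> mnum set \<Rightarrow> bool" where
  "sem_partial_order L R \<longleftrightarrow>
    (\<forall>p. p \<in> R \<longrightarrow> (\<exists>x y. x \<in> L \<and> y \<in> L \<and> p = pr x y)) \<and>
    (\<forall>x. x \<in> L \<longrightarrow> pr x x \<in> R) \<and>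
    (\<forall>x y. pr x y \<in> R \<and> pr y x \<in> R \<longrightarrow> x = y) \<and>
    (\<forall>x y z. pr x y \<in> R \<and> pr y z \<in> R \<longrightarrow> pr x z \<in> R)"

definition sem_binop :: "mnum set \<Rightarrow> mnum set \<Rightarrow> bool" where
  "sem_binop L G \<longleftrightarrow>
    (\<forall>p. p \<in> G \<longrightarrow> (\<exists>x y z. x \<in> L \<and> y \<in> L \<and> z \<in> L \<and> p = pr (pr x y) z)) \<and>
    (\<forall>x y. x \<in> L \<and> y \<in> L \<longrightarrow> (\<exists>z. pr (pr x y) z \<in> G \<and> (\<forall>w. pr (pr x y) w \<in> G \<longrightarrow> w = z)))"

definition sem_lattice :: "mnum set \<Rightarrow> mnum set \<Rightarrow> mnum set \<Rightarrow> mnum set \<Rightarrow> bool" where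
  "sem_lattice L R M J \<longleftrightarrow> sem_partial_order L R \<and> sem_binop L M \<and> sem_binop L J \<and>
     (\<forall>x y z. pr (pr x y) z \<in> M \<longrightarrow>
        pr z x \<in> R \<and> pr z y \<in> R \<and> (\<forall>w. pr w x \<in> R \<and> pr w y \<in> R \<longrightarrow> pr w z \<in> R)) \<and>
     (\<forall>x y z. pr (pr x y) z \<in> J \<longrightarrow>
        pr x z \<in> R \<and> pr y z \<in> R \<and> (\<forall>w. pr x w \<in> R \<and> pr y w \<in> R \<longrightarrow> pr z w \<in> R))"

definition sem_length_three :: "mnum set \<Rightarrow> mnum set \<Rightarrow> bool" where
  "sem_length_three L R \<longleftrightarrow> (\<exists>b t. b \<in> L \<and> t \<in> L \<and>
     (\<forall>x. x \<in> L \<longrightarrow> pr b x \<in> R \<and> pr x t \<in> R) \<and>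
     (\<forall>x. x \<in> L \<and> x \<noteq> b \<and> x \<noteq> t \<longrightarrow>
        \<not> (\<exists>y. y \<in> L \<and> (pr b y \<in> R \<and> b \<noteq> y) \<and> (pr y x \<in> R \<and> y \<noteq> x)) \<or>
        \<not> (\<exists>y. y \<in> L \<and> (pr x y \<in> R \<and> x \<noteq> y) \<and> (pr y t \<in> R \<and> y \<noteq> t))))"

definition sem_codes_set :: "mnum \<Rightarrow> bool" where
  "sem_codes_set c \<longleftrightarrow> (\<exists>k m n. c = pr k (pr m n))"

definition sem_canonical :: "mnum \<Rightarrow> bool" where
  "sem_canonical c \<longleftrightarrow> sem_codes_set c \<and>
    (\<forall>c'. c' < c \<and> sem_codes_set c' \<longrightarrow> \<not> (\<forall>i. (eps i c' \<longrightarrow> eps i c) \<and> (eps i c \<longrightarrow> eps i c')))"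

definition sem_finitely_generated :: "mnum set \<Rightarrow> mnum set \<Rightarrow> mnum set \<Rightarrow> bool" where
  "sem_finitely_generated L M J \<longleftrightarrow> (\<exists>F\<in>SS.
     ((\<forall>p. p \<in> F \<longrightarrow> (\<exists>n c. p = pr n c \<and> sem_canonical c)) \<and>
      (\<forall>n. \<exists>c. pr n c \<in> F \<and> (\<forall>c'. pr n c' \<in> F \<longrightarrow> c' = c))) \<and>
     (\<exists>g. pr 1 g \<in> F \<and> (\<exists>x. eps x g) \<and> (\<forall>x. eps x g \<longrightarrow> x \<in> L)) \<and>
     (\<forall>n a a'. 0 < n \<and> pr n a \<in> F \<and> pr (n + 1) a' \<in> F \<longrightarrow>
        (\<forall>z. (eps z a' \<longrightarrow> (\<exists>x y. eps x a \<and> eps y a \<and> (pr (pr x y) z \<in> M \<or> pr (pr x y) z \<in> J))) \<and>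
             ((\<exists>x y. eps x a \<and> eps y a \<and> (pr (pr x y) z \<in> M \<or> pr (pr x y) z \<in> J)) \<longrightarrow> eps z a'))) \<and>
     (\<forall>x. x \<in> L \<longrightarrow> (\<exists>n a. 0 < n \<and> pr n a \<in> F \<and> eps x a)))"

definition sem_infinite :: "mnum set \<Rightarrow> bool" where
  "sem_infinite L \<longleftrightarrow> \<not> (\<exists>k. \<forall>i. i \<in> L \<longrightarrow> i < k)"

definition sem_even :: "mnum \<Rightarrow> bool" where
  "sem_even i \<longleftrightarrow> (\<exists>m. i = m + m)"

definition sem_seq :: "mnum \<Rightarrow> mnum \<Rightarrow> bool" where
  "sem_seq s l \<longleftrightarrow> sem_canonical s \<and>
    (\<forall>p. eps p s \<longrightarrow> (\<exists>i x. i < l \<and> p = pr i x)) \<and>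
    (\<forall>i. i < l \<longrightarrow> (\<exists>x. eps (pr i x) s \<and> (\<forall>y. eps (pr i y) s \<longrightarrow> y = x)))"

definition sem_fence :: "mnum set \<Rightarrow> mnum set \<Rightarrow> mnum \<Rightarrow> mnum \<Rightarrow> bool" where
  "sem_fence L R s n \<longleftrightarrow> sem_seq s (n + 1) \<and>
    (\<forall>i x. eps (pr i x) s \<longrightarrow> x \<in> L) \<and>
    (\<forall>x y. eps (pr 0 x) s \<and> eps (pr 1 y) s \<longrightarrow> pr x y \<in> R \<and> x \<noteq> y) \<and>
    (\<forall>i h w x y. sem_even i \<and> 0 < i \<and> i < n \<and> h + 1 = i \<and> eps (pr h w) s \<and> eps (pr i x) s \<and>
        eps (pr (i + 1) y) s \<longrightarrow>
       (pr x w \<in> R \<and> x \<noteq> w) \<and> (pr x y \<in> R \<and> x \<noteq> y)) \<and>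
    (\<forall>i j x y. eps (pr i x) s \<and> eps (pr j y) s \<and> pr x y \<in> R \<longrightarrow>
       i = j \<or> (sem_even i \<and> (j = i + 1 \<or> i = j + 1)))"

definition sem_long_fences :: "mnum set \<Rightarrow> mnum set \<Rightarrow> bool" where
  "sem_long_fences L R \<longleftrightarrow> (\<forall>n. (\<exists>m. n = m + m + 1) \<longrightarrow> (\<exists>s. sem_fence L R s n))"

lemmas sem_defs = sem_partial_order_def sem_binop_def sem_lattice_def sem_length_three_def
  sem_codes_set_def sem_canonical_def sem_finitely_generated_def sem_infinite_def sem_even_def
  sem_seq_def sem_fence_def sem_long_fences_def eps_def pr_def

text \<open>The semantic predicates copy the formulas connective by connective, with
  \<open>Iff\<close> split into two implications, so evaluation is mere rewriting.\<close>

lemma sat_fence_sentence: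
  "sat mm e E fence_sentence \<longleftrightarrow> (\<forall>L\<in>SS. \<forall>R\<in>SS. \<forall>M\<in>SS. \<forall>J\<in>SS.
    sem_lattice L R M J \<and> sem_length_three L R \<and> sem_finitely_generated L M J \<and> sem_infinite L \<longrightarrow>
    sem_long_fences L R)"
  unfolding sem_defs fence_sentence_def
  by (simp only: fence_defs form_defs sat.simps ev.simps mm_simps ball_UNIV bex_UNIV nat.case
      diff_Suc_Suc minus_nat.diff_0 diff_0_eq_0 diff_self_eq_0 One_nat_def simp_thms)

section \<open>Parity and canonical codes\<close>

lemma sem_even_dec: "sem_even i \<longleftrightarrow> (\<exists>m<i + 1. i = m + m)"
proof
  assume "sem_even i"
  then obtain m where m: "i = m + m" unfolding sem_even_def by blast
  then have "m \<le> i" by simp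
  then show "\<exists>m<i + 1. i = m + m" using m unfolding m_less_Suc_le by blast
qed (auto simp: sem_even_def)

lemma sem_even_0: "sem_even 0"
  unfolding sem_even_def by (intro exI[of _ 0]) simp

lemma dec_sem_even [def_intros]: "rec f \<Longrightarrow> dec (\<lambda>\<rho>. sem_even (f \<rho>))"
  by (rule dec_comp1[of sem_even]) (unfold sem_even_dec, intro def_intros)

lemma sem_even_Suc: "sem_even (i + 1) \<longleftrightarrow> \<not> sem_even i"
proof -
  have "sem_even i \<or> sem_even (i + 1)"
  proof (rule dec_induct[where p = "\<lambda>i. sem_even i \<or> sem_even (i + 1)"])
    show "dec (\<lambda>\<rho>. sem_even (\<rho> 0) \<or> sem_even (\<rho> 0 + 1))" by (intro def_intros)
    show "sem_even 0 \<or> sem_even (0 + 1)" using sem_even_0 by blast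
    fix i assume "sem_even i \<or> sem_even (i + 1)"
    moreover have "sem_even (i + 1 + 1)" if even: "sem_even i"
    proof -
      obtain m where "i = m + m" using even unfolding sem_even_def by blast
      then have "i + 1 + 1 = (m + 1) + (m + 1)" by (simp add: ac_simps)
      then show ?thesis unfolding sem_even_def by blast
    qed
    ultimately show "sem_even (i + 1) \<or> sem_even (i + 1 + 1)" by blast
  qed
  moreover have False if even: "sem_even i" "sem_even (i + 1)"
  proof -
    obtain m k where mk: "i = m + m" "i + 1 = k + k" using even unfolding sem_even_def by blast
    show False
    proof (cases "k \<le> m")
      case True
      then have "k + k \<le> m + m" by (intro add_mono)
      then show False using mk m_less_Suc[of i i] by (metis leD)
    next
      case False
      then have "m + 1 \<le> k" by (simp add: m_Suc_le[symmetric])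
      then have "(m + 1) + (m + 1) \<le> k + k" by (intro add_mono)
      then have "(i + 1) + 1 \<le> i + 1" using mk by (simp add: ac_simps)
      then show False by (simp add: m_Suc_le[symmetric])
    qed
  qed
  ultimately show ?thesis by blast
qed

text \<open>The least number that codes the set. The element \<open>a\<close> guarantees that the
  code to start from has the form of a triple, since only such numbers have elements.\<close>

lemma canonical_code_exists:
  assumes P: "dec (\<lambda>\<rho>. P (\<rho> 0))" and a: "P a" "a < k"
  shows "\<exists>c. sem_canonical c \<and> (\<forall>i. eps i c \<longleftrightarrow> i < k \<and> P i)"
proof -
  obtain c0 where c0: "\<And>i. eps i c0 \<longleftrightarrow> i < k \<and> P i" using code_exists[OF P, of k] by blast
  \<comment> \<open>Elements are smaller than their code, so comparing below \<open>c + c0\<close>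
    compares the whole sets and is decidable.\<close>
  define Q where "Q c \<longleftrightarrow> sem_codes_set c \<and> (\<forall>i<c + c0. eps i c \<longleftrightarrow> eps i c0)" for c
  have Q: "Q c \<longleftrightarrow> sem_codes_set c \<and> (\<forall>i. eps i c \<longleftrightarrow> eps i c0)" for c
  proof -
    have "i < c + c0" if "eps i c \<or> eps i c0" for i
      using that eps_less[of i c] eps_less[of i c0] by (auto intro: less_le_trans)
    then show ?thesis unfolding Q_def by blast
  qed
  have codes: "sem_codes_set c \<longleftrightarrow> (\<exists>k<c + 1. \<exists>m<c + 1. \<exists>n<c + 1. c = pr k (pr m n))" for c
  proof
    assume "sem_codes_set c"
    then obtain k m n where *: "c = pr k (pr m n)" unfolding sem_codes_set_def by blast
    then have "k \<le> c" "m \<le> c" "n \<le> c" using le_pr order_trans by metis+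
    then show "\<exists>k<c + 1. \<exists>m<c + 1. \<exists>n<c + 1. c = pr k (pr m n)" using * unfolding m_less_Suc_le by blast
  qed (auto simp: sem_codes_set_def)
  have "dec (\<lambda>\<rho>. Q (\<rho> 0))" unfolding Q_def codes by (intro def_intros)
  moreover have "sem_codes_set c0" using c0[of a] a unfolding eps_def sem_codes_set_def by blast
  then have "Q c0" unfolding Q by blast
  ultimately obtain c where c: "Q c" "\<forall>y<c. \<not> Q y" using least_exists[of Q c0] by blast
  have "sem_canonical c" unfolding sem_canonical_def
  proof (intro conjI allI impI notI)
    show "sem_codes_set c" using c(1) unfolding Q by blast
    fix c' assume c': "c' < c \<and> sem_codes_set c'" "\<forall>i. (eps i c' \<longrightarrow> eps i c) \<and> (eps i c \<longrightarrow> eps i c')"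
    have "eps i c' \<longleftrightarrow> eps i c0" for i using c(1) c'(2) unfolding Q by blast
    with c' have "Q c'" unfolding Q by blast
    with c(2) c'(1) show False by blast
  qed
  moreover have "eps i c \<longleftrightarrow> i < k \<and> P i" for i using c(1) c0 unfolding Q by simp
  ultimately show ?thesis by blast
qed

section \<open>The generating stages of the lattice\<close>

locale fg_lattice =
  fixes L R M J F :: "mnum set" and b t :: mnum
  assumes SS: "L \<in> SS" "R \<in> SS" "M \<in> SS" "J \<in> SS" "F \<in> SS"
    and lattice: "sem_lattice L R M J"
    and b: "b \<in> L" and t: "t \<in> L" and bt: "\<And>x. x \<in> L \<Longrightarrow> pr b x \<in> R \<and> pr x t \<in> R"
    and three: "\<And>x. x \<in> L \<Longrightarrow> x \<noteq> b \<Longrightarrow> x \<noteq> t \<Longrightarrow>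
        \<not> (\<exists>y. y \<in> L \<and> (pr b y \<in> R \<and> b \<noteq> y) \<and> (pr y x \<in> R \<and> y \<noteq> x)) \<or>
        \<not> (\<exists>y. y \<in> L \<and> (pr x y \<in> R \<and> x \<noteq> y) \<and> (pr y t \<in> R \<and> y \<noteq> t))"
    and F_fun: "\<And>n. \<exists>c. pr n c \<in> F \<and> (\<forall>c'. pr n c' \<in> F \<longrightarrow> c' = c)"
    and F_1: "\<exists>g. pr 1 g \<in> F \<and> (\<exists>x. eps x g) \<and> (\<forall>x. eps x g \<longrightarrow> x \<in> L)"
    and F_step: "\<And>n a a' z. 0 < n \<Longrightarrow> pr n a \<in> F \<Longrightarrow> pr (n + 1) a' \<in> F \<Longrightarrow>
        eps z a' \<longleftrightarrow> (\<exists>x y. eps x a \<and> eps y a \<and> (pr (pr x y) z \<in> M \<or> pr (pr x y) z \<in> J))"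
    and F_cover: "\<And>x. x \<in> L \<Longrightarrow> \<exists>n a. 0 < n \<and> pr n a \<in> F \<and> eps x a"
    and infinite: "sem_infinite L"
begin

definition le :: "mnum \<Rightarrow> mnum \<Rightarrow> bool" where "le x y \<longleftrightarrow> pr x y \<in> R"
definition lt :: "mnum \<Rightarrow> mnum \<Rightarrow> bool" where "lt x y \<longleftrightarrow> le x y \<and> x \<noteq> y"

lemma dec_lt [def_intros]: "rec f \<Longrightarrow> rec g \<Longrightarrow> dec (\<lambda>\<rho>. lt (f \<rho>) (g \<rho>))"
  unfolding lt_def le_def by (intro def_intros dec_mem[OF SS(2)])

lemma le_L: "le x y \<Longrightarrow> x \<in> L \<and> y \<in> L"
  using lattice pr_inj unfolding sem_lattice_def sem_partial_order_def le_def by metis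

lemma le_refl: "x \<in> L \<Longrightarrow> le x x"
  using lattice unfolding sem_lattice_def sem_partial_order_def le_def by blast

lemma le_antisym: "le x y \<Longrightarrow> le y x \<Longrightarrow> x = y"
  using lattice unfolding sem_lattice_def sem_partial_order_def le_def by blast

lemma meet: "pr (pr x y) z \<in> M \<Longrightarrow> le z x \<and> le z y"
  "pr (pr x y) z \<in> M \<Longrightarrow> le w x \<Longrightarrow> le w y \<Longrightarrow> le w z"
  "x \<in> L \<Longrightarrow> y \<in> L \<Longrightarrow> \<exists>z. pr (pr x y) z \<in> M"
  using lattice unfolding sem_lattice_def sem_binop_def le_def by blast+

lemma join: "pr (pr x y) z \<in> J \<Longrightarrow> le x z \<and> le y z"
  using lattice unfolding sem_lattice_def le_def by blast

definition Fc :: "mnum \<Rightarrow> mnum" where "Fc n = (THE c. pr n c \<in> F)"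

lemma Fc_iff: "pr n c \<in> F \<longleftrightarrow> c = Fc n"
proof -
  have "\<exists>!c. pr n c \<in> F" using F_fun[of n] by blast
  from the1_equality[OF this] theI'[OF this] show ?thesis unfolding Fc_def by blast
qed

lemma rec_Fc [def_intros]: "rec f \<Longrightarrow> rec (\<lambda>\<rho>. Fc (f \<rho>))"
  by (rule rec_comp1[where h = Fc], rule rec_graph[where G = "\<lambda>y \<rho>. pr (\<rho> 0) y \<in> F"])
    (intro SIG_dec def_intros dec_mem[OF SS(5)], rule Fc_iff)

definition El :: "mnum \<Rightarrow> mnum \<Rightarrow> bool" where "El n x \<longleftrightarrow> eps x (Fc n)"

lemma dec_El [def_intros]: "rec f \<Longrightarrow> rec g \<Longrightarrow> dec (\<lambda>\<rho>. El (f \<rho>) (g \<rho>))"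
  unfolding El_def by (intro def_intros)

lemma El_Suc: "0 < n \<Longrightarrow> El (n + 1) z \<longleftrightarrow>
    (\<exists>x y. El n x \<and> El n y \<and> (pr (pr x y) z \<in> M \<or> pr (pr x y) z \<in> J))"
  unfolding El_def by (rule F_step) (simp_all add: Fc_iff)

lemma El_less: "El n x \<Longrightarrow> x < Fc n"
  unfolding El_def by (rule eps_less)

lemma pos_Suc: "0 < n + (1 :: mnum)"
  by (simp add: m_less_Suc_le)

lemma El_L: "0 < n \<Longrightarrow> El n x \<Longrightarrow> x \<in> L"
proof -
  have *: "\<forall>x<Fc (m + 1). El (m + 1) x \<longrightarrow> x \<in> L" for m
  proof (rule dec_induct[where p = "\<lambda>m. \<forall>x<Fc (m + 1). El (m + 1) x \<longrightarrow> x \<in> L"])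
    show "dec (\<lambda>\<rho>. \<forall>x<Fc (\<rho> 0 + 1). El (\<rho> 0 + 1) x \<longrightarrow> x \<in> L)" by (intro def_intros dec_mem[OF SS(1)])
    show "\<forall>x<Fc (0 + 1). El (0 + 1) x \<longrightarrow> x \<in> L" using F_1 unfolding El_def Fc_iff by auto
    fix m assume IH: "\<forall>x<Fc (m + 1). El (m + 1) x \<longrightarrow> x \<in> L"
    show "\<forall>x<Fc (m + 1 + 1). El (m + 1 + 1) x \<longrightarrow> x \<in> L"
      unfolding El_Suc[OF pos_Suc] using meet(1) join le_L by blast
  qed
  assume "0 < n" "El n x"
  then obtain m where "n = m + 1" using m_cases[of n] by auto
  then show ?thesis using *[of m] \<open>El n x\<close> El_less by blast
qed

text \<open>The stages increase because meet is idempotent.\<close>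

lemma El_mono1: "0 < n \<Longrightarrow> El n x \<Longrightarrow> El (n + 1) x"
proof -
  assume n: "0 < n" "El n x"
  then have x: "x \<in> L" by (rule El_L)
  then obtain z where z: "pr (pr x x) z \<in> M" using meet(3) by blast
  then have "z = x" using meet(1,2) le_refl[OF x] le_antisym by blast
  then show ?thesis using z n El_Suc by blast
qed

lemma El_mono: "0 < n \<Longrightarrow> n \<le> m \<Longrightarrow> El n x \<Longrightarrow> El m x"
proof -
  assume n: "0 < n" "n \<le> m" "El n x"
  have "El (n + k) x" for k
  proof (rule dec_induct[where p = "\<lambda>k. El (n + k) x"])
    show "dec (\<lambda>\<rho>. El (n + \<rho> 0) x)" by (intro def_intros)
    show "El (n + (k + 1)) x" if "El (n + k) x" for k
      using El_mono1[OF _ that] n(1) by (simp add: add.assoc add_pos_nonneg)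
  qed (use n in simp)
  then show ?thesis using n(2) unfolding m_le_iff by blast
qed

text \<open>A stage that adds nothing stops the generation for good, and then \<open>Fc n\<close>
  bounds all of \<open>L\<close>.\<close>

lemma new_element:
  assumes n: "0 < n"
  shows "\<exists>x. El (n + 1) x \<and> \<not> El n x"
proof (rule ccontr)
  assume neg: "\<not> ?thesis"
  have *: "\<forall>x<Fc (n + k). El (n + k) x \<longrightarrow> El n x" for k
  proof (rule dec_induct[where p = "\<lambda>k. \<forall>x<Fc (n + k). El (n + k) x \<longrightarrow> El n x"])
    show "dec (\<lambda>\<rho>. \<forall>x<Fc (n + \<rho> 0). El (n + \<rho> 0) x \<longrightarrow> El n x)" by (intro def_intros)
    fix k assume IH: "\<forall>x<Fc (n + k). El (n + k) x \<longrightarrow> El n x"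
    have pos: "0 < n + k" using n by (simp add: add_pos_nonneg)
    have "El n z" if z: "El (n + k + 1) z" for z
    proof -
      have "El (n + 1) z" using z IH El_less unfolding El_Suc[OF pos] El_Suc[OF n] by blast
      then show ?thesis using neg by blast
    qed
    then show "\<forall>x<Fc (n + (k + 1)). El (n + (k + 1)) x \<longrightarrow> El n x" by (simp add: add.assoc)
  qed simp
  have "x < Fc n" if x: "x \<in> L" for x
  proof -
    obtain m where m: "0 < m" "El m x" using F_cover[OF x] unfolding El_def Fc_iff by blast
    then have "El (n + m) x" using El_mono[of m "n + m" x] by simp
    then show ?thesis using * El_less by blast
  qed
  with infinite show False unfolding sem_infinite_def by blast
qed

lemma start_level: "\<exists>r. 0 < r \<and> El r b \<and> El r t"
proof -
  obtain m where m: "0 < m" "El m b" using F_cover[OF b] unfolding El_def Fc_iff by blast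
  obtain n where n: "0 < n" "El n t" using F_cover[OF t] unfolding El_def Fc_iff by blast
  have "El (m + n) b" using El_mono[OF m(1) _ m(2)] by simp
  moreover have "El (m + n) t" using El_mono[OF n(1) _ n(2)] by simp
  moreover have "0 < m + n" using m(1) by (simp add: add_pos_nonneg)
  ultimately show ?thesis by blast
qed

text \<open>A new element is the meet or join of two elements of the previous stage, not both of
  which are older, or it would have appeared earlier. The newer one is comparable to it and, being
  of an earlier stage, different from it.\<close>

lemma descend:
  assumes n: "0 < n" and x: "El (n + 1 + 1) x" "\<not> El (n + 1) x"
  shows "\<exists>y. El (n + 1) y \<and> \<not> El n y \<and> (lt x y \<or> lt y x)"
proof -
  obtain y z where yz: "El (n + 1) y" "El (n + 1) z" "pr (pr y z) x \<in> M \<or> pr (pr y z) x \<in> J"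
    using x(1) unfolding El_Suc[OF pos_Suc] by blast
  have "\<not> El n y \<or> \<not> El n z" using x(2) yz(3) unfolding El_Suc[OF n] by blast
  moreover have "lt x w \<or> lt w x" if "w = y \<or> w = z" for w
    using that yz meet(1) join x(2) unfolding lt_def by blast
  ultimately show ?thesis using yz by blast
qed

text \<open>Here \<open>x\<close> shows that \<open>y\<close> is not an atom and \<open>z\<close>
  that it is not a coatom.\<close>

lemma no_chain:
  assumes "lt x y" "lt y z" "x \<noteq> b" "z \<noteq> t"
  shows False
proof -
  have L: "x \<in> L" "y \<in> L" "z \<in> L" using assms le_L unfolding lt_def by blast+
  have "y \<noteq> b" using assms(1,3) bt[OF L(1)] le_antisym unfolding lt_def le_def by blast
  moreover have "y \<noteq> t" using assms(2,4) bt[OF L(3)] le_antisym unfolding lt_def le_def by blast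
  ultimately show False
    using three[OF L(2)] L assms bt[OF L(1)] bt[OF L(3)] unfolding lt_def le_def by blast
qed

text \<open>Let \<open>m\<close> be the meet of \<open>y\<close> and \<open>y'\<close>. It is
  strictly below \<open>y\<close>, since otherwise \<open>x\<close>, \<open>y\<close>,
  \<open>y'\<close> is a chain; and then \<open>x\<close> and \<open>x'\<close> must both equal
  \<open>m\<close>, again by \<open>no_chain\<close>.\<close>

lemma no_square:
  assumes "lt x y" "lt x y'" "lt x' y" "lt x' y'" "x \<noteq> b" "x' \<noteq> b" "y \<noteq> t" "y' \<noteq> t"
  shows "x = x' \<or> y = y'"
proof (rule ccontr)
  assume neg: "\<not> ?thesis"
  have "y \<in> L" "y' \<in> L" using assms le_L unfolding lt_def by blast+
  then obtain m where m: "pr (pr y y') m \<in> M" using meet(3) by blast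
  have le: "le x m" "le x' m" "le m y" "le m y'" using meet(1,2)[OF m] assms unfolding lt_def by blast+
  have "m \<noteq> y"
  proof
    assume "m = y"
    then have "lt y y'" using le neg unfolding lt_def by blast
    with no_chain[OF assms(1)] assms show False by blast
  qed
  then have "lt m y" using le unfolding lt_def by blast
  then have "\<not> lt x m" "\<not> lt x' m" using no_chain assms by blast+
  then show False using le neg unfolding lt_def by blast
qed

section \<open>The comparability graph\<close>

definition adj :: "mnum \<Rightarrow> mnum \<Rightarrow> bool" where "adj x y \<longleftrightarrow> lt x y \<or> lt y x"

lemma dec_adj [def_intros]: "rec f \<Longrightarrow> rec g \<Longrightarrow> dec (\<lambda>\<rho>. adj (f \<rho>) (g \<rho>))"
  unfolding adj_def by (intro def_intros)

text \<open>By \<open>no_chain\<close> the neighbours of an element lie all above or all below it,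
  so the direction of one edge fixes the whole square and \<open>no_square\<close> applies.\<close>

lemma adj_square:
  assumes "adj x y" "adj x y'" "adj x' y" "adj x' y'" "{x, x', y, y'} \<inter> {b, t} = {}"
  shows "x = x' \<or> y = y'"
proof -
  have nt: "x \<noteq> b" "x' \<noteq> b" "y \<noteq> b" "y' \<noteq> b" "x \<noteq> t" "x' \<noteq> t" "y \<noteq> t" "y' \<noteq> t" using assms(5) by blast+
  from assms(1) consider "lt x y" | "lt y x" unfolding adj_def by blast
  then show ?thesis
  proof cases
    case 1
    then have "lt x' y" "lt x y'" using assms(2,3) no_chain nt unfolding adj_def by blast+
    moreover from this have "lt x' y'" using assms(4) no_chain[of x y' x'] nt unfolding adj_def by blast
    ultimately show ?thesis using 1 no_square nt by blast
  next
    case 2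
    then have "lt y x'" "lt y' x" using assms(2,3) no_chain nt unfolding adj_def by blast+
    moreover from this have "lt y' x'" using assms(4) no_chain[of x' y' x] nt unfolding adj_def by blast
    ultimately show ?thesis using 2 no_square[of y x x' y'] no_square[of y x y' x'] nt by blast
  qed
qed

text \<open>The rank of an entry, the least \<open>n\<close> such that \<open>F n\<close> contains it, decreases along the path.\<close>

lemma long_path:
  "\<exists>s. (\<forall>i<N. app s i \<in> L \<and> app s i \<noteq> b \<and> app s i \<noteq> t) \<and> (\<forall>i<N. \<forall>j<i. app s j \<noteq> app s i) \<and>
    (\<forall>i. i + 1 < N \<longrightarrow> adj (app s i) (app s (i + 1)))"
proof -
  obtain r where r: "0 < r" "El r b" "El r t" using start_level by blast
  \<comment> \<open>Entry \<open>i\<close> will belong to stage \<open>lv i + 1\<close> but not to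
    stage \<open>lv i\<close>. As the levels stay at or above \<open>r\<close>, where both bounds
    have been generated, no entry is \<open>b\<close> or \<open>t\<close>.\<close>
  define lv where "lv i = r + (N - i)" for i
  have rec_lv: "rec f \<Longrightarrow> rec (\<lambda>\<rho>. lv (f \<rho>))" for f unfolding lv_def by (intro def_intros)
  have lv_pos: "0 < lv i" for i unfolding lv_def using r(1) by (simp add: add_pos_nonneg)
  have lv_Suc: "lv i = lv (i + 1) + 1" if i: "i < N" for i
  proof -
    obtain w where "N = i + w + 1" using i unfolding m_less_iff by blast
    then have "N = i + (w + 1)" "N = (i + 1) + w" by (simp_all add: ac_simps)
    then have "N - i = w + 1" "N - (i + 1) = w" by (metis add_diff_cancel_left')+
    then show ?thesis unfolding lv_def by (simp add: add.assoc)
  qed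
  have r_lv: "r \<le> lv i" for i unfolding lv_def by simp
  have nontriv: "x \<noteq> b" "x \<noteq> t" if "\<not> El (lv i) x" for i x
    using that El_mono[OF r(1) r_lv] r by blast+
  define S where "S k \<longleftrightarrow> (\<exists>s. (\<forall>i<k + 1. El (lv i + 1) (app s i) \<and> \<not> El (lv i) (app s i)) \<and>
    (\<forall>i<k. adj (app s i) (app s (i + 1))))" for k
  have "\<not> k \<le> N \<or> S k" for k
  proof (rule sigma_induct[where p = "\<lambda>k. \<not> k \<le> N \<or> S k"])
    have "SIG (\<lambda>\<rho>. S (\<rho> 0))" unfolding S_def by (rule SIG_ex, rule SIG_dec) (intro def_intros rec_lv)
    then show "SIG (\<lambda>\<rho>. \<not> \<rho> 0 \<le> N \<or> S (\<rho> 0))" by (rule SIG_disj[rotated]) (intro SIG_dec def_intros)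
    obtain x where x: "El (lv 0 + 1) x" "\<not> El (lv 0) x" using new_element[OF lv_pos] by blast
    have "rec (\<lambda>\<rho>. (\<lambda>i. x) (\<rho> 0))" by (intro def_intros)
    from seq_exists[OF this, of 1] obtain s where s: "app s 0 = x" using zero_less_one by blast
    have z: "i < 0 + 1 \<longleftrightarrow> i = 0" for i :: mnum unfolding m_less_Suc by simp
    have "S 0" unfolding S_def z using s x by (intro exI[of _ s]) simp
    then show "\<not> 0 \<le> N \<or> S 0" by blast
    fix k assume IH: "\<not> k \<le> N \<or> S k"
    show "\<not> k + 1 \<le> N \<or> S (k + 1)"
    proof (cases "k + 1 \<le> N")
      case True
      then have k: "k < N" by (simp add: m_Suc_le)
      then obtain s where s: "\<forall>i<k + 1. El (lv i + 1) (app s i) \<and> \<not> El (lv i) (app s i)"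
        "\<forall>i<k. adj (app s i) (app s (i + 1))" using IH unfolding S_def by auto
      have "El (lv k + 1) (app s k)" "\<not> El (lv k) (app s k)" using s(1) by simp_all
      then obtain y where y: "El (lv (k + 1) + 1) y" "\<not> El (lv (k + 1)) y" "adj (app s k) y"
        using descend[OF lv_pos[of "k + 1"], of "app s k"] unfolding lv_Suc[OF k] adj_def by blast
      let ?f = "\<lambda>i. if i \<le> k then app s i else y"
      have "rec (\<lambda>\<rho>. ?f (\<rho> 0))" by (intro def_intros)
      from seq_exists[of ?f, OF this, of "k + 1 + 1"] obtain s' where s': "\<And>i. i < k + 1 + 1 \<Longrightarrow>
          app s' i = ?f i" by blast
      have old: "app s' i = app s i" if "i < k + 1" for i
        using that s'[of i] less_trans[OF that less_add_one] by (simp add: m_less_Suc_le)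
      have new: "app s' (k + 1) = y" using s'[of "k + 1"] by (simp add: m_Suc_le[symmetric])
      have "El (lv i + 1) (app s' i) \<and> \<not> El (lv i) (app s' i)" if i: "i < k + 1 + 1" for i
      proof (cases "i = k + 1")
        case True then show ?thesis using new y by simp
      next
        case False
        then have "i < k + 1" using i unfolding m_less_Suc[of i "k + 1"] by blast
        then show ?thesis using old s(1) by simp
      qed
      moreover have "adj (app s' i) (app s' (i + 1))" if i: "i < k + 1" for i
      proof (cases "i = k")
        case True then show ?thesis using old[OF i] new y(3) by simp
      next
        case False
        then have ik: "i < k" using i unfolding m_less_Suc by blast
        then have "i + 1 < k + 1" by simp
        then show ?thesis using old[OF i] old[of "i + 1"] s(2) ik by simp
      qed
      ultimately have "S (k + 1)" unfolding S_def by blast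
      then show ?thesis by blast
    qed blast
  qed
  then have "S N" by (metis order_refl)
  then obtain s where s: "\<And>i. i < N + 1 \<Longrightarrow> El (lv i + 1) (app s i) \<and> \<not> El (lv i) (app s i)"
    "\<And>i. i < N \<Longrightarrow> adj (app s i) (app s (i + 1))" unfolding S_def by blast
  have lt: "i < N + 1" if "i < N" for i using that less_trans less_add_one by blast
  have "app s i \<in> L \<and> app s i \<noteq> b \<and> app s i \<noteq> t" if "i < N" for i
    using s(1)[OF lt[OF that]] El_L[OF pos_Suc] nontriv by blast
  moreover have "app s j \<noteq> app s i" if ij: "i < N" "j < i" for i j
  proof
    assume eq: "app s j = app s i"
    have "j < N" using ij by simp
    have "N - i \<le> N - (j + 1)"
    proof -
      obtain w where w: "i = j + 1 + w" using ij(2) unfolding m_Suc_le m_le_iff by blast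
      obtain v where v: "N = i + v" using ij(1) unfolding m_le_iff[symmetric]
          by (metis less_imp_le m_le_iff)
      have "N = (j + 1) + (w + v)" using w v by (simp add: ac_simps)
      then have "N - (j + 1) = w + v" "N - i = v" using v by (metis add_diff_cancel_left')+
      then show ?thesis by simp
    qed
    \<comment> \<open>Later entries belong already to the stage that earlier ones avoid, so no entry
      is repeated.\<close>
    then have "lv i + 1 \<le> lv j" unfolding lv_Suc[OF \<open>j < N\<close>] by (simp add: lv_def)
    then have "El (lv j) (app s i)" using s(1)[OF lt[OF ij(1)]] El_mono[OF pos_Suc] by blast
    with s(1)[OF lt[OF \<open>j < N\<close>]] eq show False by simp
  qed
  moreover have "adj (app s i) (app s (i + 1))" if "i + 1 < N" for i
    using s(2) that less_trans[OF less_add_one that] by blast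
  ultimately show ?thesis by blast
qed

section \<open>From induced paths to fences\<close>

lemma induced_sequence:
  "\<exists>y. rec (\<lambda>\<rho>. y (\<rho> 0)) \<and> (\<forall>i<K. y i \<in> L \<and> y i \<noteq> b \<and> y i \<noteq> t) \<and>
    (\<forall>i<K. \<forall>k<i. y k \<noteq> y i \<and> (adj (y k) (y i) \<longleftrightarrow> i = k + 1))"
proof -
  let ?N = "size_bound ((pr K K + 1 + 1) * K) + 1"
  obtain s where s: "\<And>i. i < ?N \<Longrightarrow> app s i \<in> L \<and> app s i \<noteq> b \<and> app s i \<noteq> t"
    "\<And>i j. i < ?N \<Longrightarrow> j < i \<Longrightarrow> app s j \<noteq> app s i"
    "\<And>i. i + 1 < ?N \<Longrightarrow> adj (app s i) (app s (i + 1))" using long_path[of ?N] by blast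
  \<comment> \<open>The range condition is part of \<open>E\<close> because the four-cycle
    hypothesis quantifies over all numbers, while \<open>s\<close> is controlled only below the
    length.\<close>
  define E where "E i j \<longleftrightarrow> i < ?N \<and> j < ?N \<and> adj (app s i) (app s j)" for i j
  have inj: "i = j" if "i < ?N" "j < ?N" "app s i = app s j" for i j
    using that s(2) by (metis linorder_neqE)
  interpret fgraph ?N E
  proof
    show "dec (\<lambda>\<rho>. E (\<rho> 0) (\<rho> (Suc 0)))" unfolding E_def by (intro def_intros)
    show "E i j \<Longrightarrow> E j i" for i j unfolding E_def adj_def by blast
  qed
  have "\<exists>V. induced_path V K"
  proof (rule induced_path_exists)
    fix i j i' j' assume E: "E i j" "E i j'" "E i' j" "E i' j'"
    then have lt: "i < ?N" "i' < ?N" "j < ?N" "j' < ?N" unfolding E_def by blast+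
    have "app s i = app s i' \<or> app s j = app s j'"
      by (rule adj_square) (use E s(1)[OF lt(1)] s(1)[OF lt(2)] s(1)[OF lt(3)] s(1)[OF lt(4)] in
          \<open>simp_all add: E_def\<close>)
    then show "i = i' \<or> j = j'" using inj lt by blast
  next
    fix i assume i: "i + 1 < ?N"
    then show "E i (i + 1)" unfolding E_def using s(3) less_trans[OF less_add_one i] by blast
  qed simp
  then obtain V where V: "\<And>i. i < K \<Longrightarrow> app V i < ?N"
    "\<And>i k. i < K \<Longrightarrow> k < i \<Longrightarrow> app V k \<noteq> app V i \<and> (E (app V k) (app V i) \<longleftrightarrow> i = k + 1)"
    unfolding induced_path_def by blast
  show ?thesis
  proof (rule exI[of _ "\<lambda>i. app s (app V i)"], intro conjI allI impI)
    show "rec (\<lambda>\<rho>. app s (app V (\<rho> 0)))" by (intro def_intros)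
    fix i assume i: "i < K"
    show "app s (app V i) \<in> L" "app s (app V i) \<noteq> b" "app s (app V i) \<noteq> t" using s(1)[OF V(1)[OF i]]
        by blast+
    fix k assume k: "k < i"
    have "k < K" using i k by simp
    show "app s (app V k) \<noteq> app s (app V i)" using inj V(1)[OF i] V(1)[OF \<open>k < K\<close>] V(2)[OF i k] by blast
    show "adj (app s (app V k)) (app s (app V i)) \<longleftrightarrow> i = k + 1"
      using V(2)[OF i k] V(1)[OF i] V(1)[OF \<open>k < K\<close>] unfolding E_def by blast
  qed
qed

text \<open>One element more than required is requested. If the first edge goes down, the second
  goes up by \<open>no_chain\<close>, and the first element is dropped.\<close>

lemma oriented_sequence:
  assumes n: "0 < n"
  shows "\<exists>y. rec (\<lambda>\<rho>. y (\<rho> 0)) \<and> (\<forall>i<n + 1. y i \<in> L \<and> y i \<noteq> b \<and> y i \<noteq> t) \<and>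
    (\<forall>i<n + 1. \<forall>k<i. y k \<noteq> y i \<and> (adj (y k) (y i) \<longleftrightarrow> i = k + 1)) \<and> lt (y 0) (y 1)"
proof -
  obtain y where y: "rec (\<lambda>\<rho>. y (\<rho> 0))" "\<And>i. i < n + 1 + 1 \<Longrightarrow> y i \<in> L \<and> y i \<noteq> b \<and> y i \<noteq> t"
    "\<And>i k. i < n + 1 + 1 \<Longrightarrow> k < i \<Longrightarrow> y k \<noteq> y i \<and> (adj (y k) (y i) \<longleftrightarrow> i = k + 1)"
    using induced_sequence[of "n + 1 + 1"] by blast
  have up: "i < n + 1 + 1" if "i < n + 1" for i using that less_trans less_add_one by blast
  have n1: "1 < n + 1" using n by simp
  then have n1: "1 < n + 1" "1 + 1 < n + 1 + 1" using add_strict_right_mono by blast+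
  have "adj (y 0) (y 1)" using y(3)[of 1 0] up[OF n1(1)] by simp
  then consider "lt (y 0) (y 1)" | "lt (y 1) (y 0)" unfolding adj_def by blast
  then show ?thesis
  proof cases
    case 1
    then show ?thesis using y up by (intro exI[of _ y]) blast
  next
    case 2
    have "adj (y 1) (y (1 + 1))" using y(3)[of "1 + 1" 1] n1(2) by simp
    moreover have "\<not> lt (y (1 + 1)) (y 1)" using no_chain[OF _ 2] y(2)[OF n1(2)] y(2)[of 0]
        by (metis m_pos_iff less_trans n1(2) m_not_less0)
    ultimately have lt: "lt (y 1) (y (1 + 1))" unfolding adj_def by blast
    show ?thesis
    proof (rule exI[of _ "\<lambda>i. y (i + 1)"], intro conjI allI impI)
      show "rec (\<lambda>\<rho>. y (\<rho> 0 + 1))" by (intro rec_comp1[OF y(1)] def_intros)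
      show "lt (y (0 + 1)) (y (1 + 1))" using lt by simp
      fix i assume "i < n + 1"
      then have i: "i + 1 < n + 1 + 1" by simp
      show "y (i + 1) \<in> L" "y (i + 1) \<noteq> b" "y (i + 1) \<noteq> t" using y(2)[OF i] by blast+
      fix k assume "k < i"
      then have "k + 1 < i + 1" by simp
      from y(3)[OF i this] show "y (k + 1) \<noteq> y (i + 1)" "adj (y (k + 1)) (y (i + 1)) \<longleftrightarrow>
          i = k + 1" by simp_all
    qed
  qed
qed

lemma fence_exists:
  assumes n: "0 < n"
  shows "\<exists>s. sem_fence L R s n"
proof -
  obtain y where y: "rec (\<lambda>\<rho>. y (\<rho> 0))" "\<And>i. i < n + 1 \<Longrightarrow> y i \<in> L \<and> y i \<noteq> b \<and> y i \<noteq> t"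
    "\<And>i k. i < n + 1 \<Longrightarrow> k < i \<Longrightarrow> y k \<noteq> y i \<and> (adj (y k) (y i) \<longleftrightarrow> i = k + 1)" "lt (y 0) (y 1)"
    using oriented_sequence[OF n] by blast
  \<comment> \<open>Two consecutive edges in the same direction would be a chain, so directions
    alternate with the parity of the position.\<close>
  have dir: "i < n \<longrightarrow> (if sem_even i then lt (y i) (y (i + 1)) else lt (y (i + 1)) (y i))" for i
  proof (rule dec_induct[where p = "\<lambda>i. i < n \<longrightarrow>
      (if sem_even i then lt (y i) (y (i + 1)) else lt (y (i + 1)) (y i))"])
    show "dec (\<lambda>\<rho>. \<rho> 0 < n \<longrightarrow> (if sem_even (\<rho> 0) then lt (y (\<rho> 0)) (y (\<rho> 0 + 1)) else lt (y (\<rho> 0 +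
        1)) (y (\<rho> 0))))"
      by (intro def_intros rec_comp1[OF y(1)])
    show "0 < n \<longrightarrow> (if sem_even 0 then lt (y 0) (y (0 + 1)) else lt (y (0 + 1)) (y 0))"
        using y(4) sem_even_0 by simp
    fix i assume IH: "i < n \<longrightarrow> (if sem_even i then lt (y i) (y (i + 1)) else lt (y (i + 1)) (y i))"
    show "i + 1 < n \<longrightarrow> (if sem_even (i + 1) then lt (y (i + 1)) (y (i + 1 + 1)) else lt (y (i + 1 +
        1)) (y (i + 1)))"
    proof
      assume i: "i + 1 < n"
      then have b1: "i + 1 + 1 < n + 1" by simp
      have i0: "i < n" using less_trans[OF less_add_one i] .
      have b2: "i < n + 1" using less_trans[OF i0 less_add_one] .
      have "adj (y (i + 1)) (y (i + 1 + 1))" using y(3)[OF b1, of "i + 1"] by simp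
      then show "if sem_even (i + 1) then lt (y (i + 1)) (y (i + 1 + 1)) else lt (y (i + 1 + 1)) (y
          (i + 1))"
        using IH i0 no_chain[of "y i" "y (i + 1)" "y (i + 1 + 1)"] no_chain[of "y (i + 1 + 1)"
            "y (i + 1)" "y i"]
          y(2)[OF b1] y(2)[OF b2] unfolding adj_def sem_even_Suc by (auto split: if_splits)
    qed
  qed
  obtain B where B: "\<And>i. i < n + 1 \<Longrightarrow> y i < B" using rec_bounded[OF y(1), of "n + 1"] by blast
  have "dec (\<lambda>\<rho>. \<exists>i<n + 1. \<rho> 0 = pr i (y i))" by (intro def_intros rec_comp1[OF y(1)])
  moreover have prB: "pr i (y i) < pr (n + 1) B + 1" if "i < n + 1" for i
    unfolding m_less_Suc_le using that B[OF that] by (intro pr_mono) auto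
  moreover have "0 < n + 1" by (rule pos_Suc)
  ultimately obtain s where s: "sem_canonical s" "\<And>p. eps p s \<longleftrightarrow> p < pr (n + 1) B + 1 \<and>
      (\<exists>i<n + 1. p = pr i (y i))"
    \<comment> \<open>The pair at position 0 is the element that shows the set to be
      nonempty.\<close>
    using canonical_code_exists[of "\<lambda>p. \<exists>i<n + 1. p = pr i (y i)" "pr 0 (y 0)" "pr (n + 1) B + 1"]
        by blast
  have mem: "eps (pr i x) s \<longleftrightarrow> i < n + 1 \<and> x = y i" for i x
    unfolding s(2) pr_inj using prB by auto
  have "sem_fence L R s n" unfolding sem_fence_def
  proof (intro conjI allI impI)
    show "sem_seq s (n + 1)" unfolding sem_seq_def mem using s by auto
    show "x \<in> L" if "eps (pr i x) s" for i x using that y(2) unfolding mem by blast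
    show "pr x z \<in> R" "x \<noteq> z" if "eps (pr 0 x) s \<and> eps (pr 1 z) s" for x z
      using that y(4) unfolding mem lt_def le_def by blast+
  next
    fix i h w x z
    assume *: "sem_even i \<and> 0 < i \<and> i < n \<and> h + 1 = i \<and> eps (pr h w) s \<and> eps (pr i x) s \<and>
        eps (pr (i + 1) z) s"
    then have "\<not> sem_even h" "h < n" using sem_even_Suc[of h] less_trans[OF less_add_one] by blast+
    then have "lt x w" "lt x z" using * dir[of h] dir[of i] unfolding mem by auto
    then show "pr x w \<in> R" "x \<noteq> w" "pr x z \<in> R" "x \<noteq> z" unfolding lt_def le_def by blast+
  next
    fix i j x z
    assume *: "eps (pr i x) s \<and> eps (pr j z) s \<and> pr x z \<in> R"
    then have ij: "i < n + 1" "x = y i" "j < n + 1" "z = y j" unfolding mem by blast+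
    have le: "le (y i) (y j)" using * ij unfolding le_def by blast
    have bound: "k < n" if "k + 1 < n + 1" for k using that by simp
    consider "i = j" | "i < j" | "j < i" by (metis linorder_neqE)
    then show "i = j \<or> (sem_even i \<and> (j = i + 1 \<or> i = j + 1))"
    proof cases
      case 2
      then have "lt (y i) (y j)" using le y(3)[OF ij(3) 2] unfolding lt_def by blast
      moreover from this have j: "j = i + 1" using y(3)[OF ij(3) 2] unfolding adj_def by blast
      ultimately have "sem_even i" using dir[of i] bound[of i] ij(3) le_antisym unfolding lt_def
          by (auto split: if_splits)
      with j show ?thesis by blast
    next
      case 3
      then have "lt (y i) (y j)" using le y(3)[OF ij(1) 3] unfolding lt_def by metis
      moreover from this have i: "i = j + 1" using y(3)[OF ij(1) 3] unfolding adj_def by blast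
      ultimately have "\<not> sem_even j" using dir[of j] bound[of j] ij(1) le_antisym unfolding lt_def
          by (auto split: if_splits)
      with i show ?thesis using sem_even_Suc by blast
    qed blast
  qed
  then show ?thesis by blast
qed

end

lemma models_fence_sentence: "models MM fence_sentence"
  unfolding models_mm sat_fence_sentence
proof (intro allI impI ballI, elim conjE)
  fix L R M J assume SS: "L \<in> SS" "R \<in> SS" "M \<in> SS" "J \<in> SS"
    and l: "sem_lattice L R M J" "sem_length_three L R" "sem_finitely_generated L M J" "sem_infinite L"
  from l(2) obtain b t where bt: "b \<in> L" "t \<in> L" "\<forall>x. x \<in> L \<longrightarrow> pr b x \<in> R \<and> pr x t \<in> R"
    "\<forall>x. x \<in> L \<and> x \<noteq> b \<and> x \<noteq> t \<longrightarrow>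
        \<not> (\<exists>y. y \<in> L \<and> (pr b y \<in> R \<and> b \<noteq> y) \<and> (pr y x \<in> R \<and> y \<noteq> x)) \<or>
        \<not> (\<exists>y. y \<in> L \<and> (pr x y \<in> R \<and> x \<noteq> y) \<and> (pr y t \<in> R \<and> y \<noteq> t))"
    unfolding sem_length_three_def by (elim exE conjE)
  from l(3) obtain F where F: "F \<in> SS"
    "(\<forall>p. p \<in> F \<longrightarrow> (\<exists>n c. p = pr n c \<and> sem_canonical c)) \<and>
      (\<forall>n. \<exists>c. pr n c \<in> F \<and> (\<forall>c'. pr n c' \<in> F \<longrightarrow> c' = c))"
    "\<exists>g. pr 1 g \<in> F \<and> (\<exists>x. eps x g) \<and> (\<forall>x. eps x g \<longrightarrow> x \<in> L)"
    "\<forall>n a a'. 0 < n \<and> pr n a \<in> F \<and> pr (n + 1) a' \<in> F \<longrightarrow>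
        (\<forall>z. (eps z a' \<longrightarrow> (\<exists>x y. eps x a \<and> eps y a \<and> (pr (pr x y) z \<in> M \<or> pr (pr x y) z \<in> J))) \<and>
             ((\<exists>x y. eps x a \<and> eps y a \<and> (pr (pr x y) z \<in> M \<or> pr (pr x y) z \<in> J)) \<longrightarrow> eps z a'))"
    "\<forall>x. x \<in> L \<longrightarrow> (\<exists>n a. 0 < n \<and> pr n a \<in> F \<and> eps x a)"
    unfolding sem_finitely_generated_def by (elim bexE conjE) simp
  interpret fg_lattice L R M J F b t
  proof
    show "\<And>n. \<exists>c. pr n c \<in> F \<and> (\<forall>c'. pr n c' \<in> F \<longrightarrow> c' = c)" using F(2) by blast
    show "eps z a' \<longleftrightarrow> (\<exists>x y. eps x a \<and> eps y a \<and> (pr (pr x y) z \<in> M \<or> pr (pr x y) z \<in> J))"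
      if "0 < n" "pr n a \<in> F" "pr (n + 1) a' \<in> F" for n a a' z
      using F(4)[rule_format, of n a a' z] that by (intro iffI) simp_all
  qed (use SS l bt F in simp_all)
  show "sem_long_fences L R" unfolding sem_long_fences_def
  proof (intro allI impI)
    fix n :: mnum assume "\<exists>m. n = m + m + 1"
    then have "0 < n" using pos_Suc by blast
    then show "\<exists>s. sem_fence L R s n" by (rule fence_exists)
  qed
qed

theorem theorem3p3:
  shows "RCA0 \<turnstile> sentence (\<^bold>\<forall>\<^sub>S L R M J.
    lattice_f L R M J \<^bold>\<and> length_three L R \<^bold>\<and> finitely_generated L M J \<^bold>\<and> infinite_f L \<^bold>\<longrightarrow>
    long_fences L R)"
  using proves_fence_sentence[OF models_fence_sentence] unfolding fence_sentence_def .

end
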